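(* Let $M>0$, $\beta\in\mathbb{R}$ be a constant, $p(\rho)=\rho^\gamma$, and let $\mathfrak{R}\ge R_M$. Suppose that $\gamma>8/5$. Then the following three statements hold. (1) $\displaystyle\inf_{\rho\in W_M^{\ast\ast}}F(\rho)<0$, and there are positive constants $C_1,C_2$ independent of $\rho$ such that $$F(\rho)\ge C_1\int_{\mathbb{R}^3}\rho(x)^{\gamma}\,dx-C_2\qquad\text{for all }\rho\in W_M^{\ast\ast}.$$ (2) If $\{\rho^i\}\subset W_M^{\ast\ast}$ is a minimizing sequence for the functional $F$ (on $W_M^{\ast\ast}$), then there exist a sequence of vertical shifts $a_i\mathbf{e}_3$ ($a_i\in\mathbb{R}$, $\mathbf{e}_3=(0,0,1)$), a subsequence of $\{\rho^i\}$ (still labeled $\{\rho^i\}$), and a function $\tilde\rho\in W_M^{\ast\ast}$ such that for any $\epsilon>0$ there exists $R>0$ with $$\int_{a_i\mathbf{e}_3+B_R(0)}\rho^i(x)\,dx\ge M-\epsilon,\qquad i\in\mathbb{N},$$ and $$T\rho^i(x):=\rho^i(x+a_i\mathbf{e}_3)\rightharpoonup\tilde\rho\quad\text{weakly in }L^{\gamma}(\mathbb{R}^3)\text{ as }i\to\infty.$$ (3) The function $\tilde\rho$ in (2) is a minimizer of $F$ in $W_M^{\ast\ast}$.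
   Context: Write $x=(x_1,x_2,x_3)\in\mathbb{R}^3$, $r=\sqrt{x_1^2+x_2^2}$, $z=x_3$. A function is axisymmetric if it depends only on $(r,z)$. $B_R(0)$ is the ball of radius $R$ centered at $0$ in $\mathbb{R}^3$. Pressure and potentials: $p(\rho)=\rho^{\gamma}$ and $A(\rho)=\frac{p(\rho)}{\gamma-1}$. Set $\mathfrak{G}(\rho)(x)=\int_{\mathbb{R}^3}\frac{\rho(y)}{|x-y|}\,dy$. The magnetic potential $\psi=\mathfrak{P}(\rho)$ of an axisymmetric density $\rho$ is the solution of $\operatorname{div}\left(\frac{1}{r^2}\nabla\psi\right)=-4\pi\beta\rho$ given by $\mathfrak{P}(\rho)(x)=-4\pi\beta\int_{\mathbb{R}^3}G(x,y)\rho(y)\,dy$, where $G$ is the Green's function, $\operatorname{div}\left(\frac1{r^2}\nabla G(x,y)\right)=\delta(x-y)$. Explicitly, $\mathfrak{P}(\rho)(x)=r^2\chi_e(x_1,x_2,x_3,0,0)$, where, writing $\rho(x)=f(r,x_3)$ and, for $x\in\mathbb{R}^5$, $\rho_e(x)=f\left(\sqrt{x_1^2+x_2^2+x_4^2+x_5^2},\,x_3\right)$, $$\chi_e(x)=\int_{\mathbb{R}^5}G_5(x-y)\,(-4\pi\beta)\,\rho_e(y)\,dy,\qquad G_5(x)=-\frac{1}{15\,\omega_5}|x|^{-3},$$ with $\omega_5$ the volume of the unit ball of $\mathbb{R}^5$ (so $\Delta_5\chi_e=-4\pi\beta\rho_e$). Energy functional: $\displaystyle F(\rho)=\int_{\mathbb{R}^3}\left(A(\rho)-\tfrac12\rho\,\mathfrak{G}(\rho)-\tfrac12\beta\rho\,\mathfrak{P}(\rho)\right)dx.$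 Radius $R_M$: let $X_M$ be the set of $\rho:\mathbb{R}^3\to\mathbb{R}$ with $\rho\ge0$ a.e., $\int\rho\,dx=M$ and $\int_{\mathbb{R}^3}[A(\rho)+\frac12\rho\,\mathfrak{G}(\rho)]\,dx<\infty$, and let $\tilde F(\rho)=\int_{\mathbb{R}^3}[A(\rho)-\frac12\rho\,\mathfrak{G}(\rho)]\,dx$. For $\gamma>4/3$ it is known that $\tilde F$ has a minimizer $\hat\rho$ in $X_M$ (the non-rotating non-magnetic star solution), which is radial (about the origin), unique, and compactly supported: there is a unique $R_M>0$ with $\hat\rho(x)>0$ for $|x|<R_M$ and $\hat\rho(x)=0$ for $|x|\ge R_M$. Function classes: $W_M$ is the set of axisymmetric $\rho:\mathbb{R}^3\to\mathbb{R}$ with $\rho\ge 0$ a.e., $\rho\in L^1(\mathbb{R}^3)\cap L^{\gamma}(\mathbb{R}^3)$, $\int_{\mathbb{R}^3}\rho\,dx=M$. For a fixed constant $\mathfrak{R}\ge R_M$, $W_M^{\ast\ast}=\{\rho\in W_M:\ \rho(r,z)=0\text{ for }\sqrt{r^2+z^2}\ge\mathfrak{R}\}$. *)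

theory Defs
  imports "HOL-Analysis.Analysis"
begin

text \<open>Elements of $L^p$ are represented by Lebesgue measurable functions.\<close>

definition Lp_fun :: "real \<Rightarrow> (real^3 \<Rightarrow> real) \<Rightarrow> bool" where
  "Lp_fun p f \<longleftrightarrow>
     f \<in> borel_measurable lebesgue \<and> integrable lebesgue (\<lambda>x. \<bar>f x\<bar> powr p)"

text \<open>Weak convergence in $L^p$ for $1 < p < \infty$, tested against the conjugate space $L^{p'}$,
  $p' = p / (p - 1)$.\<close>

definition weakly_converges_Lp ::
    "real \<Rightarrow> (nat \<Rightarrow> real^3 \<Rightarrow> real) \<Rightarrow> (real^3 \<Rightarrow> real) \<Rightarrow> bool" where
  "weakly_converges_Lp p u v \<longleftrightarrow>
     (\<forall>i. Lp_fun p (u i)) \<and> Lp_fun p v \<and>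
     (\<forall>\<phi>. Lp_fun (p / (p - 1)) \<phi> \<longrightarrow>
        (\<lambda>i. LINT x|lebesgue. u i x * \<phi> x) \<longlonglongrightarrow> (LINT x|lebesgue. v x * \<phi> x))"

definition cyl_radius :: "real^3 \<Rightarrow> real" where
  "cyl_radius x = sqrt ((x $ 1)\<^sup>2 + (x $ 2)\<^sup>2)"

definition axisymmetric :: "(real^3 \<Rightarrow> real) \<Rightarrow> bool" where
  "axisymmetric \<rho> \<longleftrightarrow> (\<exists>f :: real \<Rightarrow> real \<Rightarrow> real. \<forall>x. \<rho> x = f (cyl_radius x) (x $ 3))"

definition radial :: "(real^3 \<Rightarrow> real) \<Rightarrow> bool" where
  "radial \<rho> \<longleftrightarrow> (\<exists>g :: real \<Rightarrow> real. \<forall>x. \<rho> x = g (norm x))"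

definition pressure :: "real \<Rightarrow> real \<Rightarrow> real" where
  "pressure \<gamma> s = s powr \<gamma>"

definition internal_energy :: "real \<Rightarrow> real \<Rightarrow> real" where
  "internal_energy \<gamma> s = pressure \<gamma> s / (\<gamma> - 1)"

definition grav_potential :: "(real^3 \<Rightarrow> real) \<Rightarrow> real^3 \<Rightarrow> real" where
  "grav_potential \<rho> x = (LINT y|lebesgue. \<rho> y / norm (x - y))"

text \<open>If \<open>\<rho> x = f (cyl_radius x) (x $ 3)\<close> then \<open>f s z = \<rho> (s, 0, z)\<close> for all \<open>s \<ge> 0\<close>;
  the definition is only meaningful for axisymmetric \<open>\<rho>\<close>.\<close>

definition lift5 :: "(real^3 \<Rightarrow> real) \<Rightarrow> real^5 \<Rightarrow> real" where
  "lift5 \<rho> y =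
     \<rho> (vector [sqrt ((y $ 1)\<^sup>2 + (y $ 2)\<^sup>2 + (y $ 4)\<^sup>2 + (y $ 5)\<^sup>2), 0, y $ 3])"

lemma lift5_axisymmetric:
  assumes "\<And>x. \<rho> x = f (cyl_radius x) (x $ 3)"
  shows "lift5 \<rho> y = f (sqrt ((y $ 1)\<^sup>2 + (y $ 2)\<^sup>2 + (y $ 4)\<^sup>2 + (y $ 5)\<^sup>2)) (y $ 3)"
  unfolding lift5_def by (subst assms) (simp add: cyl_radius_def vector_3)

definition fund_sol5 :: "real^5 \<Rightarrow> real" where
  "fund_sol5 x = - 1 / (15 * measure lebesgue (ball (0::real^5) 1)) * norm x powr (- 3)"

definition chi5 :: "real \<Rightarrow> (real^3 \<Rightarrow> real) \<Rightarrow> real^5 \<Rightarrow> real" where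
  "chi5 \<beta> \<rho> x = (LINT y|lebesgue. fund_sol5 (x - y) * (- 4 * pi * \<beta>) * lift5 \<rho> y)"

definition embed5 :: "real^3 \<Rightarrow> real^5" where
  "embed5 x = (\<chi> i. if i = 1 then x $ 1 else if i = 2 then x $ 2 else if i = 3 then x $ 3 else 0)"

definition mag_potential :: "real \<Rightarrow> (real^3 \<Rightarrow> real) \<Rightarrow> real^3 \<Rightarrow> real" where
  "mag_potential \<beta> \<rho> x = (cyl_radius x)\<^sup>2 * chi5 \<beta> \<rho> (embed5 x)"

definition energy :: "real \<Rightarrow> real \<Rightarrow> (real^3 \<Rightarrow> real) \<Rightarrow> real" where
  "energy \<gamma> \<beta> \<rho> =
     (LINT x|lebesgue. internal_energy \<gamma> (\<rho> x) - 1/2 * \<rho> x * grav_potential \<rho> x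
        - 1/2 * \<beta> * \<rho> x * mag_potential \<beta> \<rho> x)"

definition energy_nonmag :: "real \<Rightarrow> (real^3 \<Rightarrow> real) \<Rightarrow> real" where
  "energy_nonmag \<gamma> \<rho> =
     (LINT x|lebesgue. internal_energy \<gamma> (\<rho> x) - 1/2 * \<rho> x * grav_potential \<rho> x)"

text \<open>For \<open>\<rho> \<in> L\<^sup>1\<close> the integral defining \<open>grav_potential \<rho>\<close> converges almost everywhere,
  so for nonnegative densities integrability below says that the integral is finite.\<close>

definition X_class :: "real \<Rightarrow> real \<Rightarrow> (real^3 \<Rightarrow> real) set" where
  "X_class \<gamma> M = {\<rho>. (AE x in lebesgue. 0 \<le> \<rho> x) \<and>
     integrable lebesgue \<rho> \<and> (LINT x|lebesgue. \<rho> x) = M \<and>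
     integrable lebesgue (\<lambda>x. internal_energy \<gamma> (\<rho> x) + 1/2 * \<rho> x * grav_potential \<rho> x)}"

text \<open>\<open>R\<close> is the radius of the radial non-rotating, non-magnetic star of mass \<open>M\<close>.
  By the classical theory exactly one such \<open>R\<close> exists for \<open>\<gamma> > 4/3\<close>; being a relation,
  the definition does not depend on that result.\<close>

definition star_radius :: "real \<Rightarrow> real \<Rightarrow> real \<Rightarrow> bool" where
  "star_radius \<gamma> M R \<longleftrightarrow> 0 < R \<and>
     (\<exists>\<rho>. is_arg_min (energy_nonmag \<gamma>) (\<lambda>\<sigma>. \<sigma> \<in> X_class \<gamma> M) \<rho> \<and> radial \<rho> \<and>
        (\<forall>x. norm x < R \<longrightarrow> 0 < \<rho> x) \<and> (\<forall>x. R \<le> norm x \<longrightarrow> \<rho> x = 0))"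

definition W_class :: "real \<Rightarrow> real \<Rightarrow> (real^3 \<Rightarrow> real) set" where
  "W_class \<gamma> M = {\<rho>. axisymmetric \<rho> \<and> (AE x in lebesgue. 0 \<le> \<rho> x) \<and>
     Lp_fun 1 \<rho> \<and> Lp_fun \<gamma> \<rho> \<and> (LINT x|lebesgue. \<rho> x) = M}"

definition W_class_supp :: "real \<Rightarrow> real \<Rightarrow> real \<Rightarrow> (real^3 \<Rightarrow> real) set" where
  "W_class_supp \<gamma> M Rmax =
     {\<rho> \<in> W_class \<gamma> M. \<forall>x. Rmax \<le> sqrt ((cyl_radius x)\<^sup>2 + (x $ 3)\<^sup>2) \<longrightarrow> \<rho> x = 0}"

definition minimizing_sequence ::
    "('a \<Rightarrow> real) \<Rightarrow> 'a set \<Rightarrow> (nat \<Rightarrow> 'a) \<Rightarrow> bool" where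
  "minimizing_sequence F S u \<longleftrightarrow>
     (\<forall>i. u i \<in> S) \<and> (\<lambda>i. F (u i)) \<longlonglongrightarrow> (INF \<rho>\<in>S. F \<rho>)"

definition e3 :: "real^3" where
  "e3 = axis 3 1"

text \<open>\<open>a i\<close> is the shift applied to the \<open>i\<close>-th member \<open>\<rho> (s i)\<close> of the relabelled subsequence.\<close>

definition shifted_weak_limit ::
    "real \<Rightarrow> real \<Rightarrow> real \<Rightarrow> (nat \<Rightarrow> real^3 \<Rightarrow> real) \<Rightarrow>
     (nat \<Rightarrow> real) \<Rightarrow> (nat \<Rightarrow> nat) \<Rightarrow> (real^3 \<Rightarrow> real) \<Rightarrow> bool" where
  "shifted_weak_limit \<gamma> M Rmax \<rho> a s \<rho>' \<longleftrightarrow>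
     strict_mono s \<and> \<rho>' \<in> W_class_supp \<gamma> M Rmax \<and>
     (\<forall>\<epsilon>>0. \<exists>R>0. \<forall>i.
        (LINT x:(\<lambda>x. a i *\<^sub>R e3 + x) ` ball 0 R|lebesgue. \<rho> (s i) x) \<ge> M - \<epsilon>) \<and>
     weakly_converges_Lp \<gamma> (\<lambda>i x. \<rho> (s i) (x + a i *\<^sub>R e3)) \<rho>'"

end

theory Submission
  imports Defs "HOL-Probability.Conditional_Expectation" "HOL-Library.Diagonal_Subsequence"
begin

text \<open>
  The proof rests on one quadratic form, the Newtonian self-energy
  \<open>D\<^sub>n(\<rho>) = \<integral>\<integral> \<rho>(x) \<rho>(y) / |x - y| ^ (n - 2) dx dy\<close> on \<open>n\<close>-dimensional space. For an
  axisymmetric density of bounded support the gravitational term is \<open>D\<^sub>3(\<rho>)/2\<close>, and the magnetic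
  term is a nonnegative multiple of \<open>D\<^sub>5\<close> of the lift of \<open>\<rho>\<close> to five dimensions, so the energy is
  the integral of \<open>\<rho> powr \<gamma>\<close>, divided by \<open>\<gamma> - 1\<close>, minus multiples of two self-energies (\<open>energy_eq\<close>). Both
  are treated by the same estimates, for general \<open>n\<close>.

  \<^item> Coercivity. In \<open>D\<^sub>n\<close> one may assume \<open>\<rho>(y) \<le> \<rho>(x)\<close> at the cost of a factor 2. The potential of
  a density of given mass and height at most \<open>s\<close> is at most a constant times
  \<open>s powr (1 - 2/n)\<close>; hence \<open>D\<^sub>n\<close> is bounded by a constant times the integral of \<open>\<rho> powr (2 - 2/n)\<close>.
  This exponent is \<open>4/3\<close> for \<open>n = 3\<close> and \<open>8/5\<close> for \<open>n = 5\<close>: as \<open>\<gamma> > 8/5\<close>, both self-energies are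
  absorbed by the internal energy (\<open>self_energy_near_absorbed\<close>, \<open>energy_coercive\<close>).

  \<^item> Negative infimum. The magnetic term can only lower the energy, and the non-magnetic star
  belongs to the class. Its energy is at most that of a uniform ball of the same mass and any radius,
  which is negative for large radii because \<open>\<gamma> > 4/3\<close> (\<open>star_energy_negative\<close>).

  \<^item> Weak limits. All densities of the class live in one ball, so no mass can escape and the shifts
  can be taken to be zero; what is needed is weak sequential compactness of bounded sequences in
  the Lebesgue space of exponent \<open>\<gamma>\<close>, which is proved from a diagonal argument, a Dynkin class and the
  Radon-Nikodym theorem (\<open>weakly_convergent_subsequence\<close>). The limit has to be axisymmetric at
  every point. This is achieved by conditioning on the Lebesgue sets that are invariant under
  rotations about the axis (\<open>axisymmetric_weak_limit\<close>).

  \<^item> Minimality. Tightness forces arbitrary shifts to be bounded, so the shifted densities again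
  live in one ball, and the energy does not see the shifts. The integral of
  \<open>\<rho> powr \<gamma>\<close> is weakly lower semicontinuous by convexity. The part of \<open>D\<^sub>n\<close> from pairs at distance less
  than \<open>d\<close> is small uniformly along the sequence, while the part at distance at least \<open>d\<close> has a bounded
  kernel and converges; so \<open>D\<^sub>n\<close> is weakly upper semicontinuous (\<open>self_energy_newton_usc\<close>).
  Therefore the energy of the limit is at most the infimum (\<open>energy_lower_semicontinuous\<close>).

  Five and three dimensions are linked by the map \<open>fold5\<close>. Composition with it lifts an
  axisymmetric density, and it pushes Lebesgue measure to a measure with a locally bounded density,
  which transfers measurability, integrals and weak convergence.
\<close>

section \<open>Transport of Lebesgue measure\<close>

lemma id_lebesgue_borel: "(\<lambda>x. x) \<in> lebesgue \<rightarrow>\<^sub>M borel"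
  using id_borel_measurable_lebesgue by (simp add: id_def)

lemma sigma_finite_lebesgue: "sigma_finite_measure (lebesgue :: 'a::euclidean_space measure)"
proof
  obtain A :: "nat \<Rightarrow> 'a set" where A: "range A \<subseteq> sets lborel" "(\<Union>i. A i) = space lborel"
     "\<And>i. emeasure lborel (A i) \<noteq> \<infinity>"
    using lborel.sigma_finite by blast
  show "\<exists>A. countable A \<and> A \<subseteq> sets lebesgue \<and> \<Union> A = space lebesgue \<and> (\<forall>a\<in>A. emeasure (lebesgue::'a measure) a \<noteq> \<infinity>)"
    using A by (intro exI[of _ "range A"]) (auto simp: emeasure_completion)
qed

text \<open>
  If the image of Borel-Lebesgue measure under \<open>T\<close> has a density, then \<open>T\<close> pulls null sets back to
  null sets. Hence \<open>T\<close> remains measurable between the completed sigma-algebras, and the substitution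
  rule extends from Borel to Lebesgue measurable integrands.
\<close>

lemma lebesgue_pushforward:
  fixes T :: "'a::euclidean_space \<Rightarrow> 'b::euclidean_space" and f :: "'b \<Rightarrow> ennreal"
  assumes T[measurable]: "T \<in> borel_measurable borel" and w[measurable]: "w \<in> borel_measurable borel"
    and D: "distr lborel borel T = density lborel w"
  shows "T \<in> lebesgue \<rightarrow>\<^sub>M lebesgue"
    and "f \<in> borel_measurable lebesgue \<Longrightarrow>
      (\<integral>\<^sup>+x. f (T x) \<partial>lebesgue) = (\<integral>\<^sup>+x. w x * f x \<partial>lebesgue)"
proof -
  have nul: "T -` N \<in> null_sets lborel" if "N \<in> null_sets lborel" for N
  proof -
    have [measurable]: "N \<in> sets borel" using that by auto
    have "emeasure lborel (T -` N) = emeasure (distr lborel borel T) N"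
      by (simp add: emeasure_distr)
    also have "\<dots> = (\<integral>\<^sup>+x. w x * indicator N x \<partial>lborel)" unfolding D by (simp add: emeasure_density)
    also have "\<dots> = 0" using that by (simp add: nn_integral_null_set)
    finally show ?thesis
      by (intro null_setsI) (use measurable_sets[OF T \<open>N \<in> sets borel\<close>] in auto)
  qed
  show TL: "T \<in> lebesgue \<rightarrow>\<^sub>M lebesgue"
  proof (rule complete_measure.measurable_completion2)
    show "complete_measure (lebesgue :: 'a measure)" ..
    show T1: "T \<in> lebesgue \<rightarrow>\<^sub>M lborel" by (simp add: measurable_completion)
    show "null_sets lborel \<subseteq> null_sets (distr lebesgue lborel T)"
    proof
      fix N assume N: "N \<in> null_sets (lborel :: 'b measure)"
      then have "T -` N \<in> null_sets lebesgue" using nul by (intro null_sets_completionI)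
      then show "N \<in> null_sets (distr lebesgue lborel T)"
        using N T1 by (subst null_sets_distr_iff) auto
    qed
  qed
  assume f: "f \<in> borel_measurable lebesgue"
  then obtain f' where f'[measurable]: "f' \<in> borel_measurable lborel" and ae: "AE x in lborel. f x = f' x"
    using completion_ex_borel_measurable by blast
  obtain N where N: "N \<in> null_sets lborel" "\<And>x. x \<notin> N \<Longrightarrow> f x = f' x"
    by (rule AE_E3[OF ae]) simp
  have ae2: "AE x in lborel. f (T x) = f' (T x)"
    by (rule AE_I'[OF nul[OF N(1)]]) (use N(2) in auto)
  have [measurable]: "f' \<in> borel_measurable borel" using f' by simp
  have "(\<integral>\<^sup>+x. f (T x) \<partial>lebesgue) = (\<integral>\<^sup>+x. f' (T x) \<partial>lborel)"
    unfolding nn_integral_completion using ae2 by (rule nn_integral_cong_AE)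
  also have "\<dots> = (\<integral>\<^sup>+x. f' x \<partial>distr lborel borel T)" by (simp add: nn_integral_distr)
  also have "\<dots> = (\<integral>\<^sup>+x. w x * f' x \<partial>lborel)" unfolding D by (simp add: nn_integral_density)
  also have "\<dots> = (\<integral>\<^sup>+x. w x * f x \<partial>lebesgue)"
    unfolding nn_integral_completion using ae by (intro nn_integral_cong_AE) auto
  finally show "(\<integral>\<^sup>+x. f (T x) \<partial>lebesgue) = (\<integral>\<^sup>+x. w x * f x \<partial>lebesgue)" .
qed

lemma lebesgue_measure_preserving:
  fixes T :: "'a::euclidean_space \<Rightarrow> 'a" and f :: "'a \<Rightarrow> ennreal"
  assumes T: "T \<in> borel_measurable borel"
    and D: "distr lborel borel T = lborel"
  shows "T \<in> lebesgue \<rightarrow>\<^sub>M lebesgue"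
    and "f \<in> borel_measurable lebesgue \<Longrightarrow>
      (\<integral>\<^sup>+x. f (T x) \<partial>lebesgue) = (\<integral>\<^sup>+x. f x \<partial>lebesgue)"
  using lebesgue_pushforward(1)[OF T, of "\<lambda>_. 1"] lebesgue_pushforward(2)[OF T, of "\<lambda>_. 1" f]
  by (auto simp: D density_1)

lemma lborel_distr_orthogonal:
  fixes S :: "real^'n::{finite,wellorder} \<Rightarrow> real^'n::{finite,wellorder}"
  assumes S: "orthogonal_transformation S"
  shows "distr lborel borel S = lborel"
proof (rule lborel_eqI[symmetric])
  have lin: "linear S" using S by (rule orthogonal_transformation_linear)
  then have [measurable]: "S \<in> borel_measurable borel"
    by (intro borel_measurable_continuous_onI linear_continuous_on) (simp add: linear_conv_bounded_linear)
  fix l u :: "real^'n::{finite,wellorder}" assume lu: "\<And>b. b \<in> Basis \<Longrightarrow> l \<bullet> b \<le> u \<bullet> b"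
  have invS: "orthogonal_transformation (inv S)" using S by (rule orthogonal_transformation_inv)
  have bij: "bij S" using S by (rule orthogonal_transformation_bij)
  have vim: "S -` box l u = inv S ` box l u" using bij by (rule bij_vimage_eq_inv_image)
  have B: "box l u \<in> lmeasurable" by simp
  have M: "inv S ` box l u \<in> lmeasurable" "measure lebesgue (inv S ` box l u) = measure lebesgue (box l u)"
    using measurable_orthogonal_image[OF invS B] measure_orthogonal_image[OF invS B] by auto
  have borel: "S -` box l u \<in> sets borel" using measurable_sets[of S borel borel "box l u"] by simp
  have "emeasure (distr lborel borel S) (box l u) = emeasure lborel (S -` box l u)"
    by (simp add: emeasure_distr)
  also have "\<dots> = emeasure lebesgue (S -` box l u)" using borel by simp
  also have "\<dots> = emeasure lebesgue (box l u)"
    using M B unfolding vim by (metis emeasure_eq_measure2)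
  also have "\<dots> = (\<Prod>b\<in>Basis. (u - l) \<bullet> b)" using lu by (simp add: emeasure_lborel_box_eq)
  finally show "emeasure (distr lborel borel S) (box l u) = (\<Prod>b\<in>Basis. (u - l) \<bullet> b)" .
qed simp

section \<open>The Newtonian kernel\<close>

text \<open>
  Both sides give \<open>{..x}\<close> the volume of the ball of radius \<open>x\<close>. This takes the place of polar
  coordinates throughout.
\<close>

lemma distr_norm_lborel:
  "distr lborel borel (norm :: 'a::euclidean_space \<Rightarrow> real) =
   density lborel (\<lambda>t. ennreal (DIM('a) * unit_ball_vol DIM('a) * t ^ (DIM('a) - 1)) * indicator {0..} t)"
    (is "?L = density lborel ?w")
proof (rule measure_eqI_generator_eq[where E="range (\<lambda>x. {..x::real})" and \<Omega>=UNIV and A="\<lambda>i. {..real i}"])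
  define n where "n = DIM('a)"
  have n: "n > 0" by (simp add: n_def)
  have emL: "emeasure ?L {..x} = ennreal (if x \<ge> 0 then unit_ball_vol n * x ^ n else 0)" for x :: real
  proof -
    have "emeasure ?L {..x} = emeasure lborel (norm -` {..x} :: 'a set)" by (simp add: emeasure_distr)
    also have "(norm -` {..x} :: 'a set) = cball 0 x" by (auto simp: dist_norm)
    also have "emeasure lborel (cball (0::'a) x) = ennreal (if x \<ge> 0 then unit_ball_vol n * x ^ n else 0)"
      by (cases "x \<ge> 0") (simp_all add: emeasure_cball n_def)
    finally show ?thesis .
  qed
  have emR: "emeasure (density lborel ?w) {..x} = ennreal (if x \<ge> 0 then unit_ball_vol n * x ^ n else 0)" for x :: real
  proof (cases "x \<ge> 0")
    case True
    have "emeasure (density lborel ?w) {..x} = (\<integral>\<^sup>+t. ?w t * indicator {..x} t \<partial>lborel)"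
      by (subst emeasure_density) auto
    also have "\<dots> = (\<integral>\<^sup>+t. ennreal (n * unit_ball_vol n * t ^ (n-1)) * indicator {0..x} t \<partial>lborel)"
      unfolding n_def by (intro nn_integral_cong) (auto split: split_indicator)
    also have "\<dots> = unit_ball_vol n * x ^ n - unit_ball_vol n * 0 ^ n"
      by (rule nn_integral_FTC_Icc)
        (use True n in \<open>auto intro!: derivative_eq_intros mult_nonneg_nonneg\<close>)
    finally show ?thesis using n True by (simp add: power_0_left)
  next
    case False
    have "emeasure (density lborel ?w) {..x} = (\<integral>\<^sup>+t. ?w t * indicator {..x} t \<partial>lborel)"
      by (subst emeasure_density) auto
    also have "\<dots> = (\<integral>\<^sup>+t. 0 \<partial>(lborel::real measure))"
      using False by (intro nn_integral_cong) (auto split: split_indicator)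
    finally show ?thesis using False by simp
  qed
  show "emeasure ?L X = emeasure (density lborel ?w) X" if "X \<in> range (\<lambda>x. {..x::real})" for X
    using that emL emR by auto
  show "emeasure ?L {..real i} \<noteq> \<infinity>" for i unfolding emL by simp
  show "Int_stable (range (\<lambda>x. {..x::real}))" by (auto simp: Int_stable_def)
  show "(\<Union>i. {..real i}) = UNIV" by (auto simp: real_arch_simple)
qed (auto simp: borel_eq_atMost)

lemma nn_integral_norm_lborel:
  fixes g :: "real \<Rightarrow> ennreal"
  assumes g[measurable]: "g \<in> borel_measurable borel"
  shows "(\<integral>\<^sup>+x. g (norm x) \<partial>(lborel :: 'a::euclidean_space measure)) =
    (\<integral>\<^sup>+t. ennreal (DIM('a) * unit_ball_vol DIM('a) * t ^ (DIM('a) - 1)) * indicator {0..} t * g t \<partial>lborel)"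
proof -
  have "(\<integral>\<^sup>+x. g (norm x) \<partial>(lborel :: 'a::euclidean_space measure)) =
    (\<integral>\<^sup>+t. g t \<partial>distr lborel borel (norm :: 'a \<Rightarrow> real))"
    by (simp add: nn_integral_distr)
  also have "\<dots> = (\<integral>\<^sup>+t. ennreal (DIM('a) * unit_ball_vol DIM('a) * t ^ (DIM('a) - 1)) * indicator {0..} t * g t \<partial>lborel)"
    unfolding distr_norm_lborel by (subst nn_integral_density) auto
  finally show ?thesis .
qed

text \<open>
  The Newtonian kernel up to a constant factor: \<open>1 / norm z\<close> in dimension 3, the inverse cube of the norm
  in dimension 5. By the convention for division by zero it vanishes at the origin when the dimension exceeds 2.
\<close>

definition newton :: "'a::euclidean_space \<Rightarrow> real" where
  "newton z = 1 / norm z ^ (DIM('a) - 2)"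

lemma newton_measurable[measurable]: "newton \<in> borel_measurable borel"
  unfolding newton_def[abs_def] by measurable

lemma newton_nonneg: "newton z \<ge> 0" by (simp add: newton_def)

lemma newton_minus: "newton (x - y) = newton (y - x)"
  by (simp add: newton_def norm_minus_commute)

lemma newton_le:
  assumes "d > 0" "norm (z::'a::euclidean_space) \<ge> d"
  shows "newton z \<le> 1 / d ^ (DIM('a) - 2)"
  unfolding newton_def using assms by (intro divide_left_mono power_mono mult_pos_pos zero_less_power) auto

text \<open>
  In every dimension the surface area of the sphere of radius \<open>t\<close> exceeds the inverse of the kernel by
  exactly one power of \<open>t\<close>, which explains the factor \<open>d\<^sup>2\<close>.
\<close>

lemma nn_integral_newton_ball:
  assumes n: "DIM('a::euclidean_space) \<ge> 2" and d: "d \<ge> 0"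
  shows "(\<integral>\<^sup>+z. ennreal (newton z) * indicator (ball 0 d) z \<partial>(lborel :: 'a measure)) =
    ennreal (DIM('a) * unit_ball_vol DIM('a) / 2 * d\<^sup>2)"
proof -
  define c where "c = DIM('a) * unit_ball_vol DIM('a)"
  have c: "c \<ge> 0" by (simp add: c_def)
  have "(\<integral>\<^sup>+z. ennreal (newton z) * indicator (ball 0 d) z \<partial>(lborel :: 'a measure)) =
    (\<integral>\<^sup>+z. (\<lambda>t. ennreal (1 / t ^ (DIM('a) - 2)) * indicator {..<d} t) (norm z) \<partial>(lborel :: 'a measure))"
    by (intro nn_integral_cong) (auto simp: newton_def split: split_indicator)
  also have "\<dots> = (\<integral>\<^sup>+t. ennreal (c * t ^ (DIM('a) - 1)) * indicator {0..} t *
      (ennreal (1 / t ^ (DIM('a) - 2)) * indicator {..<d} t) \<partial>lborel)"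
    unfolding c_def by (subst nn_integral_norm_lborel) auto
  also have "\<dots> = (\<integral>\<^sup>+t. ennreal (c * t) * indicator {0..d} t \<partial>lborel)"
  proof (rule nn_integral_cong_AE)
    have pw: "c * t ^ (DIM('a) - 1) * (1 / t ^ (DIM('a) - 2)) = c * t" if "t > 0" for t :: real
    proof -
      have "DIM('a) - 1 = Suc (DIM('a) - 2)" using n by simp
      then show ?thesis using that by simp
    qed
    show "AE t in lborel. ennreal (c * t ^ (DIM('a) - 1)) * indicator {0..} t *
      (ennreal (1 / t ^ (DIM('a) - 2)) * indicator {..<d} t) = ennreal (c * t) * indicator {0..d} t"
      using AE_lborel_singleton[of 0] AE_lborel_singleton[of d]
    proof eventually_elim
      case (elim t)
      then show ?case using c pw[of t]
        by (auto split: split_indicator simp: ennreal_mult[symmetric])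
    qed
  qed
  also have "\<dots> = c / 2 * d\<^sup>2 - c / 2 * 0\<^sup>2"
    by (rule nn_integral_FTC_Icc) (use c d in \<open>auto intro!: derivative_eq_intros\<close>)
  finally show ?thesis by (simp add: c_def)
qed

section \<open>Self-energies and the contribution of close pairs\<close>

text \<open>
  The value is an extended nonnegative real, so that Tonelli's theorem is available before finiteness is known.
\<close>

definition self_energy :: "('a::euclidean_space \<Rightarrow> real) \<Rightarrow> ('a \<Rightarrow> real) \<Rightarrow> ennreal" where
  "self_energy k \<rho> =
     (\<integral>\<^sup>+x. \<integral>\<^sup>+y. ennreal (\<rho> x) * ennreal (\<rho> y) * ennreal (k (x - y)) \<partial>lebesgue \<partial>lebesgue)"

text \<open>
  The kernel is split at distance \<open>d\<close>: \<open>near d\<close> carries the singularity and \<open>far d\<close> is bounded.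
\<close>

definition near :: "real \<Rightarrow> 'a::euclidean_space \<Rightarrow> real" where
  "near d z = newton z * indicator (ball 0 d) z"

definition far :: "real \<Rightarrow> 'a::euclidean_space \<Rightarrow> real" where
  "far d z = newton z * indicator (- ball 0 d) z"

lemma near_measurable[measurable]: "near d \<in> borel_measurable borel"
  unfolding near_def[abs_def]
  by (intro borel_measurable_times newton_measurable borel_measurable_indicator) auto

lemma far_measurable[measurable]: "far d \<in> borel_measurable borel"
  unfolding far_def[abs_def]
  by (intro borel_measurable_times newton_measurable borel_measurable_indicator) auto

lemma near_nonneg: "near d z \<ge> 0" and far_nonneg: "far d z \<ge> 0"
  by (auto simp: near_def far_def newton_nonneg)

lemma near_plus_far: "newton z = near d z + far d z"
  by (auto simp: near_def far_def split: split_indicator)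

lemma far_le: "d > 0 \<Longrightarrow> far d (z :: 'a::euclidean_space) \<le> 1 / d ^ (DIM('a) - 2)"
  by (auto simp: far_def intro!: newton_le split: split_indicator)

text \<open>
  The product of two copies of the Lebesgue sigma-algebra is not complete, but it contains the Borel sets
  and makes Lebesgue measurable functions of one coordinate measurable. Tonelli's theorem can therefore be used
  without replacing densities by Borel versions.
\<close>

lemma kernel_measurable_pair:
  fixes k :: "'a::euclidean_space \<Rightarrow> real"
  assumes [measurable]: "k \<in> borel_measurable borel"
  shows "(\<lambda>p. k (fst p - snd p)) \<in> borel_measurable (lebesgue \<Otimes>\<^sub>M lebesgue)"
proof -
  have [measurable]: "(\<lambda>p. fst p) \<in> borel_measurable (lebesgue \<Otimes>\<^sub>M (lebesgue :: 'a measure))"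
    "(\<lambda>p. snd p) \<in> borel_measurable ((lebesgue :: 'a measure) \<Otimes>\<^sub>M lebesgue)"
    using measurable_compose[OF measurable_fst id_lebesgue_borel]
      measurable_compose[OF measurable_snd id_lebesgue_borel] by auto
  show ?thesis by measurable
qed

lemma kernel_measurable:
  fixes k :: "'a::euclidean_space \<Rightarrow> real"
  assumes [measurable]: "k \<in> borel_measurable borel"
  shows "(\<lambda>y. k (x - y)) \<in> borel_measurable lebesgue"
  by (rule measurable_completion) simp

lemma self_energy_integrand_measurable:
  fixes \<rho> :: "'a::euclidean_space \<Rightarrow> real"
  assumes [measurable]: "\<rho> \<in> borel_measurable lebesgue" and k: "k \<in> borel_measurable borel"
  shows "(\<lambda>p. ennreal (\<rho> (fst p)) * ennreal (\<rho> (snd p)) * ennreal (k (fst p - snd p)))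
    \<in> borel_measurable (lebesgue \<Otimes>\<^sub>M lebesgue)"
proof -
  note [measurable] = kernel_measurable_pair[OF k]
  show ?thesis by measurable
qed

lemma potential_measurable:
  fixes \<rho> :: "'a::euclidean_space \<Rightarrow> real"
  assumes [measurable]: "\<rho> \<in> borel_measurable lebesgue" and k: "k \<in> borel_measurable borel"
  shows "(\<lambda>x. \<integral>\<^sup>+y. ennreal (\<rho> y) * ennreal (k (x - y)) \<partial>lebesgue) \<in> borel_measurable borel"
proof -
  interpret L: sigma_finite_measure "lebesgue :: 'a measure" by (rule sigma_finite_lebesgue)
  have s[measurable]: "(\<lambda>p. snd p) \<in> borel_measurable ((borel :: 'a measure) \<Otimes>\<^sub>M lebesgue)"
    using measurable_compose[OF measurable_snd id_lebesgue_borel] by auto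
  have [measurable]: "(\<lambda>p. \<rho> (snd p)) \<in> borel_measurable ((borel :: 'a measure) \<Otimes>\<^sub>M lebesgue)"
    by measurable
  note [measurable] = k
  have "(\<lambda>p. ennreal (\<rho> (snd p)) * ennreal (k (fst p - snd p))) \<in> borel_measurable ((borel :: 'a measure) \<Otimes>\<^sub>M lebesgue)"
    by measurable
  from L.borel_measurable_nn_integral_fst[OF this] show ?thesis by simp
qed

lemma self_energy_alt:
  fixes \<rho> :: "'a::euclidean_space \<Rightarrow> real"
  assumes [measurable]: "\<rho> \<in> borel_measurable lebesgue" and k: "k \<in> borel_measurable borel"
  shows "self_energy k \<rho> = (\<integral>\<^sup>+x. ennreal (\<rho> x) * (\<integral>\<^sup>+y. ennreal (\<rho> y) * ennreal (k (x - y)) \<partial>lebesgue) \<partial>lebesgue)"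
proof -
  note [measurable] = kernel_measurable[OF k]
  show ?thesis unfolding self_energy_def
    by (intro nn_integral_cong) (simp add: mult.assoc nn_integral_cmult)
qed

lemma self_energy_add:
  fixes \<rho> :: "'a::euclidean_space \<Rightarrow> real"
  assumes [measurable]: "\<rho> \<in> borel_measurable lebesgue"
    and k: "k \<in> borel_measurable borel" and l: "l \<in> borel_measurable borel"
    and nn: "\<And>z. k z \<ge> 0" "\<And>z. l z \<ge> 0"
  shows "self_energy (\<lambda>z. k z + l z) \<rho> = self_energy k \<rho> + self_energy l \<rho>"
proof -
  interpret L: sigma_finite_measure "lebesgue :: 'a measure" by (rule sigma_finite_lebesgue)
  note [measurable] = kernel_measurable[OF k] kernel_measurable[OF l]
  note mk = L.borel_measurable_nn_integral_fst[OF self_energy_integrand_measurable[OF assms(1) k]]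
  note ml = L.borel_measurable_nn_integral_fst[OF self_energy_integrand_measurable[OF assms(1) l]]
  show ?thesis
    unfolding self_energy_def using mk ml nn
    by (simp add: nn_integral_add[symmetric] distrib_left[symmetric] flip: ennreal_plus)
qed

lemma self_energy_mono: "(\<And>z. k z \<le> l z) \<Longrightarrow> self_energy k \<rho> \<le> self_energy l \<rho>"
  unfolding self_energy_def by (intro nn_integral_mono mult_left_mono ennreal_leI) auto

lemma self_energy_newton_split:
  fixes \<rho> :: "'a::euclidean_space \<Rightarrow> real"
  assumes "\<rho> \<in> borel_measurable lebesgue"
  shows "self_energy newton \<rho> = self_energy (near d) \<rho> + self_energy (far d) \<rho>"
proof -
  have "newton = (\<lambda>z::'a. near d z + far d z)" by (simp add: near_plus_far[symmetric])
  then show ?thesis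
    using self_energy_add[OF assms near_measurable far_measurable near_nonneg far_nonneg, of d d] by simp
qed

lemma self_energy_far_le:
  fixes \<rho> :: "'a::euclidean_space \<Rightarrow> real"
  assumes [measurable]: "\<rho> \<in> borel_measurable lebesgue" and d: "d > 0" and m: "m \<ge> 0"
    and mass: "(\<integral>\<^sup>+x. ennreal (\<rho> x) \<partial>lebesgue) \<le> ennreal m"
  shows "self_energy (far d) \<rho> \<le> ennreal (m\<^sup>2 / d ^ (DIM('a) - 2))"
proof -
  define K where "K = 1 / d ^ (DIM('a) - 2)"
  have K: "K \<ge> 0" using d by (simp add: K_def)
  have "self_energy (far d) \<rho> \<le> (\<integral>\<^sup>+x. \<integral>\<^sup>+y. ennreal (\<rho> x) * ennreal (\<rho> y) * ennreal K \<partial>lebesgue \<partial>lebesgue)"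
    unfolding self_energy_def K_def
    by (intro nn_integral_mono mult_left_mono ennreal_leI far_le d) auto
  also have "\<dots> = (\<integral>\<^sup>+x. ennreal (\<rho> x) \<partial>lebesgue) * (\<integral>\<^sup>+x. ennreal (\<rho> x) \<partial>lebesgue) * ennreal K"
    by (simp add: nn_integral_cmult nn_integral_multc)
  also have "\<dots> \<le> ennreal m * ennreal m * ennreal K"
    by (intro mult_mono mass) auto
  also have "\<dots> = ennreal (m\<^sup>2 / d ^ (DIM('a) - 2))"
    using m K by (simp add: ennreal_mult[symmetric] K_def power2_eq_square)
  finally show ?thesis .
qed

text \<open>
  For each pair one of the two densities is the smaller one, and since \<open>k\<close> is even the two cases contribute
  equally. This reduces the quadratic form to potentials of densities truncated at the height \<open>\<rho> x\<close>.
\<close>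

lemma self_energy_le_min:
  fixes \<rho> :: "'a::euclidean_space \<Rightarrow> real"
  assumes meas[measurable]: "\<rho> \<in> borel_measurable lebesgue" and k: "k \<in> borel_measurable borel"
    and even: "\<And>x y. k (x - y) = k (y - x)"
  shows "self_energy k \<rho> \<le> 2 * (\<integral>\<^sup>+x. ennreal (\<rho> x) *
    (\<integral>\<^sup>+y. min (ennreal (\<rho> y)) (ennreal (\<rho> x)) * ennreal (k (x - y)) \<partial>lebesgue) \<partial>lebesgue)"
proof -
  interpret L: sigma_finite_measure "lebesgue :: 'a measure" by (rule sigma_finite_lebesgue)
  interpret P: pair_sigma_finite "lebesgue :: 'a measure" "lebesgue :: 'a measure" ..
  define h where "h = (\<lambda>p. ennreal (\<rho> (fst p)) * (min (ennreal (\<rho> (snd p))) (ennreal (\<rho> (fst p))) * ennreal (k (fst p - snd p))))"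
  note [measurable] = kernel_measurable_pair[OF k] kernel_measurable[OF k]
  have h[measurable]: "h \<in> borel_measurable (lebesgue \<Otimes>\<^sub>M lebesgue)"
    unfolding h_def by measurable
  have pt: "ennreal (\<rho> x) * ennreal (\<rho> y) * ennreal (k (x - y)) \<le> h (x, y) + h (y, x)" for x y
  proof (cases "ennreal (\<rho> y) \<le> ennreal (\<rho> x)")
    case True
    then have "ennreal (\<rho> x) * ennreal (\<rho> y) * ennreal (k (x - y)) = h (x, y)"
      by (simp add: h_def min_def mult.assoc)
    then show ?thesis by simp
  next
    case False
    then have "ennreal (\<rho> x) * ennreal (\<rho> y) * ennreal (k (x - y)) = h (y, x)"
      using even[of x y] linear[of "ennreal (\<rho> x)" "ennreal (\<rho> y)"]
      by (auto simp: h_def min_def mult_ac)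
    then show ?thesis by simp
  qed
  have mx: "(\<lambda>x. h (a, x)) \<in> borel_measurable lebesgue" "(\<lambda>x. h (x, a)) \<in> borel_measurable lebesgue" for a
    by measurable
  have m1: "(\<lambda>x. \<integral>\<^sup>+y. h (x, y) \<partial>lebesgue) \<in> borel_measurable lebesgue"
    by (rule L.borel_measurable_nn_integral_fst[OF h])
  have m2: "(\<lambda>x. \<integral>\<^sup>+y. h (y, x) \<partial>lebesgue) \<in> borel_measurable lebesgue"
    using L.borel_measurable_nn_integral_fst[of "\<lambda>p. h (snd p, fst p)" lebesgue] by simp
  have "self_energy k \<rho> \<le> (\<integral>\<^sup>+x. \<integral>\<^sup>+y. h (x, y) + h (y, x) \<partial>lebesgue \<partial>lebesgue)"
    unfolding self_energy_def by (intro nn_integral_mono pt)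
  also have "\<dots> = (\<integral>\<^sup>+x. \<integral>\<^sup>+y. h (x, y) \<partial>lebesgue \<partial>lebesgue) + (\<integral>\<^sup>+x. \<integral>\<^sup>+y. h (y, x) \<partial>lebesgue \<partial>lebesgue)"
    using m1 m2 mx by (simp add: nn_integral_add)
  also have "(\<integral>\<^sup>+x. \<integral>\<^sup>+y. h (y, x) \<partial>lebesgue \<partial>lebesgue) = (\<integral>\<^sup>+x. \<integral>\<^sup>+y. h (x, y) \<partial>lebesgue \<partial>lebesgue)"
    using P.Fubini[OF h] by simp
  also have "(\<integral>\<^sup>+x. \<integral>\<^sup>+y. h (x, y) \<partial>lebesgue \<partial>lebesgue) = (\<integral>\<^sup>+x. ennreal (\<rho> x) *
    (\<integral>\<^sup>+y. min (ennreal (\<rho> y)) (ennreal (\<rho> x)) * ennreal (k (x - y)) \<partial>lebesgue) \<partial>lebesgue)"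
    unfolding h_def by (simp add: nn_integral_cmult)
  finally show ?thesis by (simp add: mult_2)
qed

lemma lborel_distr_reflect:
  "distr lborel borel (\<lambda>y. x - y) = (lborel :: 'a::euclidean_space measure)"
  using lborel_affine[of "-1" x] by (simp add: density_1)

lemma nn_integral_near:
  assumes n: "DIM('a::euclidean_space) \<ge> 2" and d: "d \<ge> 0"
  shows "(\<integral>\<^sup>+y. ennreal (near d (x - y)) \<partial>(lebesgue :: 'a measure)) =
    ennreal (DIM('a) * unit_ball_vol DIM('a) / 2 * d\<^sup>2)"
proof -
  have "(\<integral>\<^sup>+y. ennreal (near d (x - y)) \<partial>(lebesgue :: 'a measure)) =
    (\<integral>\<^sup>+y. ennreal (near d y) \<partial>(distr lborel borel (\<lambda>y. x - y)))"
    by (subst nn_integral_distr) (auto simp: nn_integral_completion)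
  also have "\<dots> = (\<integral>\<^sup>+y. ennreal (newton y) * indicator (ball 0 d) y \<partial>(lborel :: 'a measure))"
    unfolding lborel_distr_reflect near_def
    by (intro nn_integral_cong) (auto split: split_indicator)
  finally show ?thesis using nn_integral_newton_ball[OF n d] by simp
qed

definition newton_const :: "'a::euclidean_space itself \<Rightarrow> real" where
  "newton_const _ = DIM('a) * unit_ball_vol DIM('a) / 2"

lemma newton_const_pos: "newton_const TYPE('a::euclidean_space) > 0"
  by (simp add: newton_const_def)

lemma potential_min_bound1:
  fixes \<rho> :: "'a::euclidean_space \<Rightarrow> real"
  assumes n: "DIM('a) \<ge> 2" and d: "d \<ge> 0"
  shows "(\<integral>\<^sup>+y. min (ennreal (\<rho> y)) (ennreal s) * ennreal (near d (x - y)) \<partial>lebesgue)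
    \<le> ennreal s * ennreal (newton_const TYPE('a) * d\<^sup>2)"
proof -
  have "(\<integral>\<^sup>+y. min (ennreal (\<rho> y)) (ennreal s) * ennreal (near d (x - y)) \<partial>lebesgue) \<le>
    (\<integral>\<^sup>+y. ennreal s * ennreal (near d (x - y)) \<partial>lebesgue)"
    by (intro nn_integral_mono mult_right_mono) auto
  also have "\<dots> = ennreal s * ennreal (newton_const TYPE('a) * d\<^sup>2)"
    using kernel_measurable[OF near_measurable, of d x]
    by (simp add: nn_integral_cmult nn_integral_near[OF n d] newton_const_def)
  finally show ?thesis .
qed

text \<open>
  A density with bounded mass and height has the largest potential when it is concentrated near the
  point. Inside a ball of radius \<open>e\<close> the height bound is used and outside it the mass bound.
\<close>

lemma potential_min_bound2:
  fixes \<rho> :: "'a::euclidean_space \<Rightarrow> real"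
  assumes [measurable]: "\<rho> \<in> borel_measurable lebesgue"
    and n: "DIM('a) \<ge> 2" and s: "s > 0" and m: "m \<ge> 0"
    and mass: "(\<integral>\<^sup>+x. ennreal (\<rho> x) \<partial>lebesgue) \<le> ennreal m"
  shows "(\<integral>\<^sup>+y. min (ennreal (\<rho> y)) (ennreal s) * ennreal (near d (x - y)) \<partial>lebesgue)
    \<le> ennreal ((newton_const TYPE('a) + m) * s powr (1 - 2 / DIM('a)))"
proof -
  define c where "c = newton_const TYPE('a)"
  have c: "c > 0" by (simp add: c_def newton_const_pos)
  \<comment> \<open>this radius balances the contribution \<open>s * e\<^sup>2\<close> of the height bound against \<open>m / e ^ (DIM('a) - 2)\<close> of the mass bound\<close>
  define e where "e = s powr (- 1 / DIM('a))"
  have e: "e > 0" using s by (simp add: e_def)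
  define K where "K = 1 / e ^ (DIM('a) - 2)"
  have K: "K \<ge> 0" using e by (simp add: K_def)
  have pt: "min (ennreal (\<rho> y)) (ennreal s) * ennreal (near d (x - y)) \<le>
     ennreal s * ennreal (near e (x - y)) + ennreal (\<rho> y) * ennreal K" for y
  proof (cases "x - y \<in> ball 0 e")
    case True
    have "min (ennreal (\<rho> y)) (ennreal s) * ennreal (near d (x - y)) \<le> ennreal s * ennreal (near e (x - y))"
      using True by (intro mult_mono ennreal_leI) (auto simp: near_def newton_nonneg split: split_indicator)
    then show ?thesis by (simp add: add_increasing2)
  next
    case False
    have "near d (x - y) \<le> K" 
    proof -
      have "near d (x - y) \<le> newton (x - y)" by (auto simp: near_def newton_nonneg split: split_indicator)
      also have "\<dots> \<le> K" unfolding K_def using False e by (intro newton_le) auto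
      finally show ?thesis .
    qed
    then have "min (ennreal (\<rho> y)) (ennreal s) * ennreal (near d (x - y)) \<le> ennreal (\<rho> y) * ennreal K"
      by (intro mult_mono ennreal_leI) auto
    then show ?thesis by (simp add: add_increasing)
  qed
  note [measurable] = kernel_measurable[OF near_measurable, of e x]
  have "(\<integral>\<^sup>+y. min (ennreal (\<rho> y)) (ennreal s) * ennreal (near d (x - y)) \<partial>lebesgue) \<le>
    (\<integral>\<^sup>+y. ennreal s * ennreal (near e (x - y)) + ennreal (\<rho> y) * ennreal K \<partial>lebesgue)"
    by (intro nn_integral_mono pt)
  also have "\<dots> = ennreal s * ennreal (c * e\<^sup>2) + (\<integral>\<^sup>+x. ennreal (\<rho> x) \<partial>lebesgue) * ennreal K"
    using n e by (simp add: nn_integral_add nn_integral_cmult nn_integral_multc nn_integral_near c_def newton_const_def)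
  also have "\<dots> \<le> ennreal s * ennreal (c * e\<^sup>2) + ennreal m * ennreal K"
    by (intro add_mono mult_right_mono mass) auto
  also have "\<dots> = ennreal (s * (c * e\<^sup>2) + m * K)"
    using s c m K by (simp add: ennreal_mult[symmetric] ennreal_plus[symmetric] del: ennreal_plus)
  also have "s * (c * e\<^sup>2) + m * K = (c + m) * s powr (1 - 2 / DIM('a))"
  proof -
    have "e\<^sup>2 = s powr (- 2 / DIM('a))" using s by (simp add: e_def powr_realpow[symmetric] powr_powr flip: powr_numeral)
    then have 1: "s * e\<^sup>2 = s powr (1 - 2 / DIM('a))"
      using s powr_add[of s 1 "- 2 / DIM('a)"] by simp
    have "e ^ (DIM('a) - 2) = s powr (- 1 / DIM('a) * real (DIM('a) - 2))"
      using s unfolding e_def by (simp add: powr_powr flip: powr_realpow)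
    also have "- 1 / DIM('a) * real (DIM('a) - 2) = - (1 - 2 / DIM('a))"
      using n by (simp add: of_nat_diff field_simps)
    finally have 2: "K = s powr (1 - 2 / DIM('a))"
      unfolding K_def using s by (simp only: powr_minus) (simp add: field_simps)
    show ?thesis unfolding 2 using 1 by (simp add: algebra_simps)
  qed
  finally show ?thesis by (simp add: c_def)
qed

text \<open>
  Where \<open>\<rho> x \<le> L\<close> the height bound on the potential is used. It gives the first term, small with \<open>d\<close>. Where
  \<open>\<rho> x > L\<close> the bound from height and mass applies, and the surplus of \<open>\<gamma>\<close> over the critical exponent \<open>2 - 2 / DIM('a)\<close>
  yields a negative power of \<open>L\<close>.
\<close>

lemma self_energy_near_le:
  fixes \<rho> :: "'a::euclidean_space \<Rightarrow> real"
  assumes meas[measurable]: "\<rho> \<in> borel_measurable lebesgue"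
    and n: "DIM('a) \<ge> 2" and d: "d > 0" and L: "L > 0" and m: "m \<ge> 0" and P: "P \<ge> 0"
    and \<gamma>: "\<gamma> \<ge> 2 - 2 / DIM('a)"
    and mass: "(\<integral>\<^sup>+x. ennreal (\<rho> x) \<partial>lebesgue) \<le> ennreal m"
    and power: "(\<integral>\<^sup>+x. ennreal (\<rho> x powr \<gamma>) \<partial>lebesgue) \<le> ennreal P"
  shows "self_energy (near d) \<rho> \<le> ennreal (2 * (newton_const TYPE('a) * L * d\<^sup>2 * m +
    (newton_const TYPE('a) + m) * L powr (2 - 2 / DIM('a) - \<gamma>) * P))"
proof -
  define c where "c = newton_const TYPE('a)"
  have c: "c > 0" by (simp add: c_def newton_const_pos)
  define q where "q = 2 - 2 / real DIM('a)"
  define A where "A = c * L * d\<^sup>2"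
  define B where "B = (c + m) * L powr (q - \<gamma>)"
  have A: "A \<ge> 0" and B: "B \<ge> 0" using c L m by (auto simp: A_def B_def)
  have pt: "ennreal (\<rho> x) * (\<integral>\<^sup>+y. min (ennreal (\<rho> y)) (ennreal (\<rho> x)) * ennreal (near d (x - y)) \<partial>lebesgue)
    \<le> ennreal A * ennreal (\<rho> x) + ennreal B * ennreal (\<rho> x powr \<gamma>)" (is "?l \<le> _") for x
  proof -
    define s where "s = \<rho> x"
    consider "s \<le> 0" | "0 < s" "s \<le> L" | "s > L" by linarith
    then show ?thesis
    proof cases
      case 1
      then show ?thesis by (simp add: s_def ennreal_neg)
    next
      case 2
      have "?l \<le> ennreal s * (ennreal s * ennreal (c * d\<^sup>2))"
        unfolding s_def c_def using d by (intro mult_left_mono potential_min_bound1 n) auto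
      also have "\<dots> = ennreal (s * s * (c * d\<^sup>2))"
        using 2 c by (simp add: ennreal_mult[symmetric] mult_ac)
      also have "\<dots> \<le> ennreal (A * s)"
        using mult_right_mono[OF mult_left_mono[OF 2(2), of s], of "c * d\<^sup>2"] 2 c
        by (intro ennreal_leI) (simp add: A_def mult_ac)
      also have "\<dots> = ennreal A * ennreal s" using A 2 by (simp add: ennreal_mult)
      finally show ?thesis by (simp add: s_def add_increasing2)
    next
      case 3
      have s: "s > 0" using 3 L by simp
      have "?l \<le> ennreal s * ennreal ((c + m) * s powr (1 - 2 / DIM('a)))"
        unfolding s_def c_def using s by (intro mult_left_mono potential_min_bound2 n m mass meas) (auto simp: s_def)
      also have "\<dots> = ennreal ((c + m) * s powr q)"
        using s c m powr_add[of s 1 "1 - 2 / DIM('a)"] by (simp add: ennreal_mult[symmetric] q_def mult_ac)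
      also have "\<dots> \<le> ennreal (B * s powr \<gamma>)"
      proof -
        have "s powr q = s powr (q - \<gamma>) * s powr \<gamma>" by (simp flip: powr_add)
        also have "\<dots> \<le> L powr (q - \<gamma>) * s powr \<gamma>"
          using 3 L \<gamma> by (intro mult_right_mono powr_mono2') (auto simp: q_def)
        finally have "(c + m) * s powr q \<le> (c + m) * (L powr (q - \<gamma>) * s powr \<gamma>)"
          using c m by (intro mult_left_mono) auto
        then show ?thesis by (intro ennreal_leI) (simp add: B_def mult_ac)
      qed
      also have "\<dots> = ennreal B * ennreal (s powr \<gamma>)" using B by (simp add: ennreal_mult)
      finally show ?thesis by (simp add: s_def add_increasing)
    qed
  qed
  have "self_energy (near d) \<rho> \<le> 2 * (\<integral>\<^sup>+x. ennreal (\<rho> x) *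
    (\<integral>\<^sup>+y. min (ennreal (\<rho> y)) (ennreal (\<rho> x)) * ennreal (near d (x - y)) \<partial>lebesgue) \<partial>lebesgue)"
    by (rule self_energy_le_min) (auto simp: meas near_def newton_minus norm_minus_commute split: split_indicator)
  also have "\<dots> \<le> 2 * (\<integral>\<^sup>+x. ennreal A * ennreal (\<rho> x) + ennreal B * ennreal (\<rho> x powr \<gamma>) \<partial>lebesgue)"
    by (intro mult_left_mono nn_integral_mono pt) auto
  also have "\<dots> = 2 * (ennreal A * (\<integral>\<^sup>+x. ennreal (\<rho> x) \<partial>lebesgue) + ennreal B * (\<integral>\<^sup>+x. ennreal (\<rho> x powr \<gamma>) \<partial>lebesgue))"
    by (simp add: nn_integral_add nn_integral_cmult)
  also have "\<dots> \<le> 2 * (ennreal A * ennreal m + ennreal B * ennreal P)"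
    by (intro mult_left_mono add_mono mass power) auto
  also have "\<dots> = ennreal 2 * ennreal (A * m + B * P)"
    using A B m P by (simp add: ennreal_mult)
  also have "\<dots> = ennreal (2 * (A * m + B * P))"
    using A B m P by (intro ennreal_mult[symmetric]) auto
  finally show ?thesis unfolding A_def B_def c_def q_def by simp
qed

section \<open>Upper semicontinuity and bounds for the self-energy\<close>

lemma integrable_mult_bounded_borel:
  fixes \<rho> \<phi> :: "'a::euclidean_space \<Rightarrow> real"
  assumes \<rho>: "integrable lebesgue \<rho>" and \<phi>: "\<phi> \<in> borel_measurable lebesgue" and B: "\<And>x. \<bar>\<phi> x\<bar> \<le> B"
  shows "integrable lebesgue (\<lambda>x. \<rho> x * \<phi> x)"
proof (rule Bochner_Integration.integrable_bound)
  show "integrable lebesgue (\<lambda>x. B * \<rho> x)" using \<rho> by simp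
  note [measurable] = \<phi> borel_measurable_integrable[OF \<rho>]
  show "(\<lambda>x. \<rho> x * \<phi> x) \<in> borel_measurable lebesgue" by measurable
  show "AE x in lebesgue. norm (\<rho> x * \<phi> x) \<le> norm (B * \<rho> x)"
  proof (rule AE_I2)
    fix x show "norm (\<rho> x * \<phi> x) \<le> norm (B * \<rho> x)"
      using mult_right_mono[OF B[of x], of "\<bar>\<rho> x\<bar>"] B[of x] by (simp add: abs_mult mult.commute)
  qed
qed

definition potential :: "('a::euclidean_space \<Rightarrow> real) \<Rightarrow> ('a \<Rightarrow> real) \<Rightarrow> 'a \<Rightarrow> real" where
  "potential k \<rho> x = (LINT y|lebesgue. \<rho> y * k (x - y))"

lemma self_energy_bounded_kernel:
  fixes \<rho> :: "'a::euclidean_space \<Rightarrow> real"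
  assumes \<rho>: "integrable lebesgue \<rho>" and nn: "AE x in lebesgue. 0 \<le> \<rho> x"
    and k[measurable]: "k \<in> borel_measurable borel" and K: "\<And>z. 0 \<le> k z" "\<And>z. k z \<le> K"
  shows "potential k \<rho> \<in> borel_measurable borel"
    and "0 \<le> potential k \<rho> x" and "potential k \<rho> x \<le> K * (LINT x|lebesgue. \<rho> x)"
    and "self_energy k \<rho> = ennreal (LINT x|lebesgue. \<rho> x * potential k \<rho> x)"
proof -
  define U where "U = potential k \<rho>"
  have U: "U = potential k \<rho>" by (fact U_def)
  have U_def: "U x = (LINT y|lebesgue. \<rho> y * k (x - y))" for x
    by (simp add: U_def potential_def)
  have \<rho>m[measurable]: "\<rho> \<in> borel_measurable lebesgue" using \<rho> by simp
  have kb: "\<bar>k z\<bar> \<le> K" for z using K[of z] by simp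
  have km: "(\<lambda>y. k (x - y)) \<in> borel_measurable lebesgue" for x by (rule kernel_measurable[OF k])
  have int: "integrable lebesgue (\<lambda>y. \<rho> y * k (x - y))" for x
    by (rule integrable_mult_bounded_borel[OF \<rho> km kb])
  have Unn: "U x \<ge> 0" for x
    unfolding U_def using nn K by (intro integral_nonneg_AE) auto
  have eq: "(\<integral>\<^sup>+y. ennreal (\<rho> y) * ennreal (k (x - y)) \<partial>lebesgue) = ennreal (U x)" for x
  proof -
    have "(\<integral>\<^sup>+y. ennreal (\<rho> y) * ennreal (k (x - y)) \<partial>lebesgue) = (\<integral>\<^sup>+y. ennreal (\<rho> y * k (x - y)) \<partial>lebesgue)"
      using nn K by (intro nn_integral_cong_AE) (auto simp: ennreal_mult)
    also have "\<dots> = ennreal (U x)"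
      unfolding U_def using nn K by (intro nn_integral_eq_integral int) auto
    finally show ?thesis .
  qed
  have "U = (\<lambda>x. enn2real (\<integral>\<^sup>+y. ennreal (\<rho> y) * ennreal (k (x - y)) \<partial>lebesgue))"
    unfolding eq using Unn by (intro ext) simp
  moreover have "\<dots> \<in> borel_measurable borel"
    using potential_measurable[OF \<rho>m k] by measurable
  ultimately have Um: "U \<in> borel_measurable borel" by simp
  then show "potential k \<rho> \<in> borel_measurable borel" by (simp add: U)
  show "0 \<le> potential k \<rho> x" using Unn by (simp add: U)
  have Ule: "U x \<le> K * (LINT x|lebesgue. \<rho> x)" for x
  proof -
    have "U x \<le> (LINT y|lebesgue. K * \<rho> y)"
      unfolding U_def using nn K \<rho> int
      by (intro integral_mono_AE) (auto simp: mult.commute[of K] intro!: mult_left_mono)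
    then show ?thesis by simp
  qed
  from Ule show "potential k \<rho> x \<le> K * (LINT x|lebesgue. \<rho> x)" by (simp add: U)
  have UL: "U \<in> borel_measurable lebesgue" using Um by (simp add: measurable_completion)
  have "\<bar>U x\<bar> \<le> K * (LINT x|lebesgue. \<rho> x)" for x using Ule Unn by simp
  note int2 = integrable_mult_bounded_borel[OF \<rho> UL this]
  have "self_energy k \<rho> = (\<integral>\<^sup>+x. ennreal (\<rho> x) * ennreal (U x) \<partial>lebesgue)"
    unfolding self_energy_alt[OF \<rho>m k] eq ..
  also have "\<dots> = (\<integral>\<^sup>+x. ennreal (\<rho> x * U x) \<partial>lebesgue)"
    using nn Unn by (intro nn_integral_cong_AE) (auto simp: ennreal_mult)
  also have "\<dots> = ennreal (LINT x|lebesgue. \<rho> x * U x)"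
    using nn Unn by (intro nn_integral_eq_integral int2) auto
  finally show "self_energy k \<rho> = ennreal (LINT x|lebesgue. \<rho> x * potential k \<rho> x)" by (simp add: U)
qed

lemma mult_le_truncate:
  fixes s t L B g :: real
  assumes "L > 0" "s \<ge> 0" "0 \<le> t" "t \<le> B" "g > 1"
  shows "s * t \<le> L * t + B * L powr (1 - g) * s powr g"
proof (cases "s \<le> L")
  case True
  then have "s * t \<le> L * t" using assms by (intro mult_right_mono)
  then show ?thesis using assms by (simp add: add_increasing2)
next
  case False
  then have s: "s > 0" "s \<ge> L" using assms by auto
  have "s = s powr (1 - g) * s powr g" using s by (simp flip: powr_add)
  also have "\<dots> \<le> L powr (1 - g) * s powr g"
    using s assms by (intro mult_right_mono powr_mono2') auto
  finally have "s * t \<le> (L powr (1 - g) * s powr g) * B"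
    using assms s by (intro mult_mono) auto
  then show ?thesis using assms by (simp add: add_increasing mult_ac)
qed

lemma powr_neg_tendsto_0: "a > 0 \<Longrightarrow> ((\<lambda>L::real. L powr (- a)) \<longlongrightarrow> 0) at_top"
  using tendsto_neg_powr[of "- a" "\<lambda>x. x" at_top] by (simp add: filterlim_ident)

text \<open>
  A bound on the integrals of \<open>\<sigma> i x powr \<gamma>\<close> with \<open>\<gamma> > 1\<close> and a common bounded support make the \<open>\<sigma> i\<close> uniformly
  integrable. Dominated convergence of the \<open>D i\<close> then holds even though the density changes with \<open>i\<close>.
\<close>

lemma uniform_small_pairing:
  fixes \<sigma> D :: "nat \<Rightarrow> 'a::euclidean_space \<Rightarrow> real"
  assumes \<gamma>: "\<gamma> > 1"
    and int: "\<And>i. integrable lebesgue (\<sigma> i)" and nn: "\<And>i. AE x in lebesgue. 0 \<le> \<sigma> i x"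
    and supp: "\<And>i x. R \<le> norm x \<Longrightarrow> \<sigma> i x = 0"
    and pint: "\<And>i. integrable lebesgue (\<lambda>x. \<sigma> i x powr \<gamma>)"
    and pbd: "\<And>i. (LINT x|lebesgue. \<sigma> i x powr \<gamma>) \<le> P"
    and Dm: "\<And>i. D i \<in> borel_measurable lebesgue" and Db: "\<And>i x. 0 \<le> D i x" "\<And>i x. D i x \<le> B"
    and D0: "\<And>x. (\<lambda>i. D i x) \<longlonglongrightarrow> 0"
  shows "(\<lambda>i. LINT x|lebesgue. \<sigma> i x * D i x) \<longlonglongrightarrow> 0"
proof (rule order_tendstoI)
  have "\<bar>D i x\<bar> \<le> B" for i x using Db[of i x] by simp
  note intD = integrable_mult_bounded_borel[OF int Dm this]
  have ge0: "(LINT x|lebesgue. \<sigma> i x * D i x) \<ge> 0" for i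
    using nn[of i] Db by (intro integral_nonneg_AE) auto
  have B: "B \<ge> 0" using Db[of 0 0] by simp
  have P: "P \<ge> 0" by (rule order_trans[OF Bochner_Integration.integral_nonneg pbd[of 0]]) simp
  have ball: "integrable lebesgue (indicator (ball (0::'a) R) :: 'a \<Rightarrow> real)"
    using emeasure_lborel_ball_finite[of "0::'a" R] by (simp add: integrable_indicator_iff)
  have intI: "integrable lebesgue (\<lambda>x. D i x * indicator (ball 0 R) x)" for i
    using integrable_mult_bounded_borel[OF ball Dm[of i], of B] \<open>\<And>i x. \<bar>D i x\<bar> \<le> B\<close>
    by (simp add: mult.commute)
  have lim: "(\<lambda>i. LINT x|lebesgue. D i x * indicator (ball 0 R) x) \<longlonglongrightarrow> (LINT x|lebesgue. (0::real) * indicator (ball (0::'a) R) x)"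
  proof (rule integral_dominated_convergence[where w="\<lambda>x. B * indicator (ball 0 R) x"])
    show "integrable lebesgue (\<lambda>x. B * indicat_real (ball (0::'a) R) x)" using ball by simp
    show "(\<lambda>x. D i x * indicator (ball 0 R) x) \<in> borel_measurable lebesgue" for i
      using intI[of i] by simp
    show "AE x in lebesgue. (\<lambda>i. D i x * indicator (ball 0 R) x) \<longlonglongrightarrow> (0::real) * indicator (ball (0::'a) R) x"
      by (intro AE_I2 tendsto_mult D0 tendsto_const)
    show "AE x in lebesgue. norm (D i x * indicator (ball 0 R) x) \<le> B * indicat_real (ball (0::'a) R) x" for i
      using Db by (auto split: split_indicator)
  qed simp
  have bound: "(LINT x|lebesgue. \<sigma> i x * D i x) \<le> L * (LINT x|lebesgue. D i x * indicator (ball 0 R) x) + B * L powr (1 - \<gamma>) * P"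
    if L: "L > 0" for L i
  proof -
    have "(LINT x|lebesgue. \<sigma> i x * D i x) \<le> (LINT x|lebesgue. L * (D i x * indicator (ball 0 R) x) + B * L powr (1 - \<gamma>) * \<sigma> i x powr \<gamma>)"
    proof (rule integral_mono_AE)
      show "AE x in lebesgue. \<sigma> i x * D i x \<le> L * (D i x * indicator (ball 0 R) x) + B * L powr (1 - \<gamma>) * \<sigma> i x powr \<gamma>"
        using nn[of i]
      proof eventually_elim
        case (elim x)
        show ?case
        proof (cases "norm x < R")
          case True
          then show ?thesis using mult_le_truncate[OF L elim Db \<gamma>] by simp
        next
          case False
          then show ?thesis using supp[of x i] by simp
        qed
      qed
    qed (use intD intI pint in auto)
    also have "\<dots> = L * (LINT x|lebesgue. D i x * indicator (ball 0 R) x) + B * L powr (1 - \<gamma>) * (LINT x|lebesgue. \<sigma> i x powr \<gamma>)"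
      using intI pint by (simp del: Bochner_Integration.integral_mult_left_zero)
    also have "\<dots> \<le> L * (LINT x|lebesgue. D i x * indicator (ball 0 R) x) + B * L powr (1 - \<gamma>) * P"
      using pbd[of i] B by (intro add_left_mono mult_left_mono) auto
    finally show ?thesis .
  qed
  show "eventually (\<lambda>i. a < (LINT x|lebesgue. \<sigma> i x * D i x)) sequentially" if "a < 0" for a
    using ge0 that by (intro always_eventually) (auto intro: less_le_trans)
  show "eventually (\<lambda>i. (LINT x|lebesgue. \<sigma> i x * D i x) < a) sequentially" if "0 < a" for a
  proof -
    have "((\<lambda>L. B * L powr (- (\<gamma> - 1)) * P) \<longlongrightarrow> B * 0 * P) at_top"
      using \<gamma> by (intro tendsto_intros powr_neg_tendsto_0) auto
    then have "eventually (\<lambda>L. B * L powr (- (\<gamma> - 1)) * P < a / 2) at_top"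
      using that by (intro order_tendstoD) auto
    then have "eventually (\<lambda>L. B * L powr (- (\<gamma> - 1)) * P < a / 2 \<and> L > 0) at_top"
      using eventually_gt_at_top[of 0] by eventually_elim auto
    then obtain L where L: "B * L powr (1 - \<gamma>) * P < a / 2" "L > 0"
      by (auto simp: eventually_at_top_linorder)
    have "(\<lambda>i. L * (LINT x|lebesgue. D i x * indicator (ball 0 R) x)) \<longlonglongrightarrow> L * 0"
      using lim by (intro tendsto_intros) auto
    then have "eventually (\<lambda>i. L * (LINT x|lebesgue. D i x * indicator (ball 0 R) x) < a / 2) sequentially"
      using that by (intro order_tendstoD) auto
    then show ?thesis
    proof eventually_elim
      case (elim i)
      then show ?case using bound[OF L(2), of i] L(1) by simp
    qed
  qed
qed

text \<open>
  The far kernel centred at a fixed point is a bounded test function, so the far potentials converge pointwise and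
  boundedly. Their deviation from the limit potential is negligible by \<open>uniform_small_pairing\<close>, and the limit
  potential is itself a bounded test function.
\<close>

lemma self_energy_far_tendsto:
  fixes \<sigma> :: "nat \<Rightarrow> 'a::euclidean_space \<Rightarrow> real"
  assumes \<gamma>: "\<gamma> > 1"
    and int: "\<And>i. integrable lebesgue (\<sigma> i)" and nn: "\<And>i. AE x in lebesgue. 0 \<le> \<sigma> i x"
    and supp: "\<And>i x. R \<le> norm x \<Longrightarrow> \<sigma> i x = 0"
    and mass: "\<And>i. (LINT x|lebesgue. \<sigma> i x) \<le> m"
    and pint: "\<And>i. integrable lebesgue (\<lambda>x. \<sigma> i x powr \<gamma>)"
    and pbd: "\<And>i. (LINT x|lebesgue. \<sigma> i x powr \<gamma>) \<le> P"
    and int': "integrable lebesgue \<tau>" and nn': "AE x in lebesgue. 0 \<le> \<tau> x"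
    and weak: "\<And>\<phi> B. \<phi> \<in> borel_measurable borel \<Longrightarrow> (\<And>x. \<bar>\<phi> x\<bar> \<le> B) \<Longrightarrow>
       (\<lambda>i. LINT x|lebesgue. \<sigma> i x * \<phi> x) \<longlonglongrightarrow> (LINT x|lebesgue. \<tau> x * \<phi> x)"
    and d: "d > 0"
  shows "(\<lambda>i. enn2real (self_energy (far d) (\<sigma> i))) \<longlonglongrightarrow> enn2real (self_energy (far d) \<tau>)"
proof -
  define K where "K = 1 / d ^ (DIM('a) - 2)"
  have K: "K \<ge> 0" using d by (simp add: K_def)
  have kK: "far d z \<le> K" for z :: 'a unfolding K_def using d by (rule far_le)
  define U where "U = (\<lambda>i. potential (far d) (\<sigma> i))"
  have Ui: "U i = potential (far d) (\<sigma> i)" for i by (simp add: U_def)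
  define V where "V = potential (far d) \<tau>"
  note u = self_energy_bounded_kernel[OF int nn far_measurable far_nonneg kK, folded Ui]
  note v = self_energy_bounded_kernel[OF int' nn' far_measurable far_nonneg kK, folded V_def]
  define m' where "m' = (LINT x|lebesgue. \<tau> x)"
  have m'0: "m' \<ge> 0" unfolding m'_def using nn' by (rule integral_nonneg_AE)
  have m0: "m \<ge> 0" using integral_nonneg_AE[OF nn[of 0]] mass[of 0] by simp
  have Ub: "U i x \<le> K * m" for i x
    using u(3)[of i x] mult_left_mono[OF mass[of i] K] by simp
  have Vb: "V x \<le> K * m'" for x using v(3)[of x] by (simp add: m'_def)
  have lim: "(\<lambda>i. U i x) \<longlonglongrightarrow> V x" for x
    unfolding U_def V_def potential_def by (rule weak[of _ K]) (auto simp: kK far_nonneg abs_of_nonneg)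
  define D where "D = (\<lambda>i x. \<bar>U i x - V x\<bar>)"
  have Um: "U i \<in> borel_measurable lebesgue" for i using measurable_completion[of "U i" lborel borel] u(1)[of i] by simp
  have Vm: "V \<in> borel_measurable lebesgue" using measurable_completion[of V lborel borel] v(1) by simp
  have \<sigma>m: "\<sigma> i \<in> borel_measurable lebesgue" for i using int[of i] by simp
  note [measurable] = Um Vm
  have Dm: "D i \<in> borel_measurable lebesgue" for i unfolding D_def by measurable
  have Db: "D i x \<le> K * m + K * m'" for i x
    using Ub[of i x] Vb[of x] u(2)[of i x] v(2)[of x] mult_nonneg_nonneg[OF K m0] mult_nonneg_nonneg[OF K m'0]
    by (simp add: D_def abs_le_iff)
  have D0: "(\<lambda>i. D i x) \<longlonglongrightarrow> 0" for x
    unfolding D_def using tendsto_rabs[OF tendsto_diff[OF lim[of x] tendsto_const[of "V x"]]] by simp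
  have small: "(\<lambda>i. LINT x|lebesgue. \<sigma> i x * D i x) \<longlonglongrightarrow> 0"
    by (rule uniform_small_pairing[OF \<gamma> int nn supp pint pbd Dm _ Db D0]) (auto simp: D_def)
  have Uab: "\<bar>U i x\<bar> \<le> K * m" and Vab: "\<bar>V x\<bar> \<le> K * m'" for i x
    using Ub[of i x] Vb[of x] u(2)[of i x] v(2)[of x] by auto
  have Dab: "\<bar>D i x\<bar> \<le> K * m + K * m'" for i x using Db[of i x] by (simp add: D_def)
  have i1: "integrable lebesgue (\<lambda>x. \<sigma> i x * U i x)" for i by (rule integrable_mult_bounded_borel[OF int Um Uab])
  have i2: "integrable lebesgue (\<lambda>x. \<sigma> i x * V x)" for i by (rule integrable_mult_bounded_borel[OF int Vm Vab])
  have i3: "integrable lebesgue (\<lambda>x. \<sigma> i x * D i x)" for i by (rule integrable_mult_bounded_borel[OF int Dm Dab])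
  have "\<bar>(LINT x|lebesgue. \<sigma> i x * U i x) - (LINT x|lebesgue. \<sigma> i x * V x)\<bar> \<le> (LINT x|lebesgue. \<sigma> i x * D i x)" for i
  proof -
    have "(LINT x|lebesgue. \<sigma> i x * U i x) - (LINT x|lebesgue. \<sigma> i x * V x) = (LINT x|lebesgue. \<sigma> i x * U i x - \<sigma> i x * V x)"
      using i1 i2 by simp
    also have "\<bar>\<dots>\<bar> \<le> (LINT x|lebesgue. \<bar>\<sigma> i x * U i x - \<sigma> i x * V x\<bar>)"
      by (rule integral_abs_bound)
    also have "\<dots> = (LINT x|lebesgue. \<sigma> i x * D i x)"
      using nn[of i] \<sigma>m[of i] Um[of i] Vm
      by (intro integral_cong_AE) (auto simp: D_def abs_mult simp flip: right_diff_distrib)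
    finally show ?thesis .
  qed
  then have l1: "(\<lambda>i. (LINT x|lebesgue. \<sigma> i x * U i x) - (LINT x|lebesgue. \<sigma> i x * V x)) \<longlonglongrightarrow> 0"
    by (intro Lim_null_comparison[OF _ small]) (auto intro!: always_eventually)
  have l2: "(\<lambda>i. LINT x|lebesgue. \<sigma> i x * V x) \<longlonglongrightarrow> (LINT x|lebesgue. \<tau> x * V x)"
    by (rule weak[OF v(1) Vab])
  from tendsto_add[OF l1 l2] have "(\<lambda>i. (LINT x|lebesgue. \<sigma> i x * U i x)) \<longlonglongrightarrow> (LINT x|lebesgue. \<tau> x * V x)"
    by simp
  moreover have "enn2real (self_energy (far d) (\<sigma> i)) = (LINT x|lebesgue. \<sigma> i x * U i x)" for i
    unfolding u(4) using nn[of i] u(2) by (intro enn2real_ennreal integral_nonneg_AE) auto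
  moreover have "enn2real (self_energy (far d) \<tau>) = (LINT x|lebesgue. \<tau> x * V x)"
    unfolding v(4) using nn' v(2) by (intro enn2real_ennreal integral_nonneg_AE) auto
  ultimately show ?thesis by simp
qed

text \<open>
  Because \<open>\<gamma>\<close> exceeds the critical exponent strictly, a large threshold \<open>L\<close> in \<open>self_energy_near_le\<close> makes the
  coefficient of the power integral as small as desired.
\<close>

lemma self_energy_near_absorbed:
  assumes n: "DIM('a::euclidean_space) \<ge> 2" and \<gamma>: "\<gamma> > 2 - 2 / DIM('a)" and m: "m \<ge> 0" and \<epsilon>: "\<epsilon> > 0"
  obtains A where "A \<ge> 0" "\<And>(\<rho> :: 'a \<Rightarrow> real) P d. \<rho> \<in> borel_measurable lebesgue \<Longrightarrow> P \<ge> 0 \<Longrightarrow> d > 0 \<Longrightarrow>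
    (\<integral>\<^sup>+x. ennreal (\<rho> x) \<partial>lebesgue) \<le> ennreal m \<Longrightarrow> (\<integral>\<^sup>+x. ennreal (\<rho> x powr \<gamma>) \<partial>lebesgue) \<le> ennreal P \<Longrightarrow>
    self_energy (near d) \<rho> \<le> ennreal (A * d\<^sup>2 + \<epsilon> * P)"
proof -
  define c where "c = newton_const TYPE('a)"
  define a where "a = \<gamma> - (2 - 2 / DIM('a))"
  have a: "a > 0" using \<gamma> by (simp add: a_def)
  have c: "c > 0" by (simp add: c_def newton_const_pos)
  have "((\<lambda>L. 2 * ((c + m) * L powr (- a))) \<longlongrightarrow> 2 * ((c + m) * 0)) at_top"
    using a by (intro tendsto_intros powr_neg_tendsto_0)
  then have "eventually (\<lambda>L. 2 * ((c + m) * L powr (- a)) < \<epsilon>) at_top"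
    using \<epsilon> by (intro order_tendstoD) auto
  then have "eventually (\<lambda>L. 2 * ((c + m) * L powr (- a)) < \<epsilon> \<and> L > 0) at_top"
    using eventually_gt_at_top[of 0] by eventually_elim auto
  then obtain L where L: "2 * ((c + m) * L powr (- a)) < \<epsilon>" "L > 0"
    by (auto simp: eventually_at_top_linorder)
  show thesis
  proof (rule that[of "2 * (c * L * m)"])
    show "0 \<le> 2 * (c * L * m)" using c L m by simp
    fix \<rho> :: "'a \<Rightarrow> real" and P d :: real
    assume r: "\<rho> \<in> borel_measurable lebesgue" "P \<ge> 0" "d > 0" "(\<integral>\<^sup>+x. ennreal (\<rho> x) \<partial>lebesgue) \<le> ennreal m"
      "(\<integral>\<^sup>+x. ennreal (\<rho> x powr \<gamma>) \<partial>lebesgue) \<le> ennreal P"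
    have "self_energy (near d) \<rho> \<le> ennreal (2 * (c * L * d\<^sup>2 * m + (c + m) * L powr (- a) * P))"
      using self_energy_near_le[OF r(1) n r(3) L(2) m r(2) less_imp_le[OF \<gamma>] r(4,5)]
      by (simp add: c_def a_def)
    also have "\<dots> \<le> ennreal (2 * (c * L * m) * d\<^sup>2 + \<epsilon> * P)"
    proof (rule ennreal_leI)
      have "2 * ((c + m) * L powr (- a)) * P \<le> \<epsilon> * P" using L(1) r(2) by (intro mult_right_mono) auto
      then show "2 * (c * L * d\<^sup>2 * m + (c + m) * L powr (- a) * P) \<le> 2 * (c * L * m) * d\<^sup>2 + \<epsilon> * P"
        by (simp add: algebra_simps)
    qed
    finally show "self_energy (near d) \<rho> \<le> ennreal (2 * (c * L * m) * d\<^sup>2 + \<epsilon> * P)" .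
  qed
qed

lemma self_energy_near_uniformly_small:
  assumes n: "DIM('a::euclidean_space) \<ge> 2" and \<gamma>: "\<gamma> > 2 - 2 / DIM('a)" and m: "m \<ge> 0" and P: "P \<ge> 0" and \<epsilon>: "\<epsilon> > 0"
  obtains d where "d > 0" "\<And>\<rho> :: 'a \<Rightarrow> real. \<rho> \<in> borel_measurable lebesgue \<Longrightarrow>
    (\<integral>\<^sup>+x. ennreal (\<rho> x) \<partial>lebesgue) \<le> ennreal m \<Longrightarrow> (\<integral>\<^sup>+x. ennreal (\<rho> x powr \<gamma>) \<partial>lebesgue) \<le> ennreal P \<Longrightarrow>
    self_energy (near d) \<rho> \<le> ennreal \<epsilon>"
proof -
  define \<eta> where "\<eta> = \<epsilon> / (2 * (P + 1))"
  have \<eta>: "\<eta> > 0" using \<epsilon> P by (simp add: \<eta>_def)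
  have "\<eta> * P \<le> \<eta> * (P + 1)" using \<eta> by simp
  also have "\<dots> = \<epsilon> / 2" using P by (simp add: \<eta>_def field_simps)
  finally have \<eta>P: "\<eta> * P \<le> \<epsilon> / 2" .
  obtain A where A: "A \<ge> 0" and b: "\<And>(\<rho> :: 'a \<Rightarrow> real) P d. \<rho> \<in> borel_measurable lebesgue \<Longrightarrow> P \<ge> 0 \<Longrightarrow> d > 0 \<Longrightarrow>
    (\<integral>\<^sup>+x. ennreal (\<rho> x) \<partial>lebesgue) \<le> ennreal m \<Longrightarrow> (\<integral>\<^sup>+x. ennreal (\<rho> x powr \<gamma>) \<partial>lebesgue) \<le> ennreal P \<Longrightarrow>
    self_energy (near d) \<rho> \<le> ennreal (A * d\<^sup>2 + \<eta> * P)"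
    by (rule self_energy_near_absorbed[OF n \<gamma> m \<eta>]) (rule that, blast+)
  have "((\<lambda>d. A * d\<^sup>2) \<longlongrightarrow> A * 0\<^sup>2) (at_right 0)"
    by (intro tendsto_intros)
  then have "eventually (\<lambda>d. A * d\<^sup>2 < \<epsilon> / 2) (at_right 0)"
    using \<epsilon> by (intro order_tendstoD) auto
  then have "eventually (\<lambda>d. A * d\<^sup>2 < \<epsilon> / 2 \<and> d > 0) (at_right 0)"
    using eventually_at_right_less[of "0::real"] by eventually_elim auto
  then obtain d where d: "A * d\<^sup>2 < \<epsilon> / 2" "d > 0"
    using eventually_happens'[OF trivial_limit_at_right_real] by blast
  have "A * d\<^sup>2 + \<eta> * P \<le> \<epsilon>" using d(1) \<eta>P by simp
  then show thesis
    using b[OF _ P d(2)] by (intro that[OF d(2)]) (meson ennreal_leI order_trans)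
qed

lemma nn_integral_le_of_LINT:
  assumes "integrable M f" "AE x in M. 0 \<le> f x" "(LINT x|M. f x) \<le> B"
  shows "(\<integral>\<^sup>+x. ennreal (f x) \<partial>M) \<le> ennreal B"
  using nn_integral_eq_integral[OF assms(1,2)] assms(3) by (simp add: ennreal_leI)

text \<open>
  Self-energies enter the energy with a negative sign, so only an upper bound is needed: the near parts of the
  sequence are uniformly small, the far parts converge, and dropping the near part of \<open>\<tau>\<close> is harmless.
\<close>

lemma self_energy_newton_usc:
  fixes \<sigma> :: "nat \<Rightarrow> 'a::euclidean_space \<Rightarrow> real"
  assumes n: "DIM('a) \<ge> 2" and \<gamma>: "\<gamma> > 2 - 2 / DIM('a)"
    and int: "\<And>i. integrable lebesgue (\<sigma> i)" and nn: "\<And>i. AE x in lebesgue. 0 \<le> \<sigma> i x"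
    and supp: "\<And>i x. R \<le> norm x \<Longrightarrow> \<sigma> i x = 0"
    and mass: "\<And>i. (LINT x|lebesgue. \<sigma> i x) \<le> m"
    and pint: "\<And>i. integrable lebesgue (\<lambda>x. \<sigma> i x powr \<gamma>)"
    and pbd: "\<And>i. (LINT x|lebesgue. \<sigma> i x powr \<gamma>) \<le> P"
    and int': "integrable lebesgue \<tau>" and nn': "AE x in lebesgue. 0 \<le> \<tau> x"
    and fin: "self_energy newton \<tau> < \<infinity>"
    and weak: "\<And>\<phi> B. \<phi> \<in> borel_measurable borel \<Longrightarrow> (\<And>x. \<bar>\<phi> x\<bar> \<le> B) \<Longrightarrow>
       (\<lambda>i. LINT x|lebesgue. \<sigma> i x * \<phi> x) \<longlonglongrightarrow> (LINT x|lebesgue. \<tau> x * \<phi> x)"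
    and \<epsilon>: "\<epsilon> > 0"
  shows "eventually (\<lambda>i. enn2real (self_energy newton (\<sigma> i)) \<le> enn2real (self_energy newton \<tau>) + \<epsilon>) sequentially"
proof -
  have \<gamma>1: "\<gamma> > 1"
  proof -
    have "2 / real DIM('a) \<le> 1" using n by simp
    then show ?thesis using \<gamma> by linarith
  qed
  have P: "P \<ge> 0" by (rule order_trans[OF Bochner_Integration.integral_nonneg pbd[of 0]]) simp
  have m: "m \<ge> 0" using integral_nonneg_AE[OF nn[of 0]] mass[of 0] by simp
  obtain d where d: "d > 0" and near: "\<And>\<rho> :: 'a \<Rightarrow> real. \<rho> \<in> borel_measurable lebesgue \<Longrightarrow>
    (\<integral>\<^sup>+x. ennreal (\<rho> x) \<partial>lebesgue) \<le> ennreal m \<Longrightarrow> (\<integral>\<^sup>+x. ennreal (\<rho> x powr \<gamma>) \<partial>lebesgue) \<le> ennreal P \<Longrightarrow>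
    self_energy (near d) \<rho> \<le> ennreal (\<epsilon> / 2)"
    using self_energy_near_uniformly_small[OF n \<gamma> m P, of "\<epsilon> / 2"] \<epsilon> by auto
  have nr: "self_energy (near d) (\<sigma> i) \<le> ennreal (\<epsilon> / 2)" for i
    by (intro near nn_integral_le_of_LINT int pint mass pbd nn) (use int[of i] in auto)
  have far: "(\<lambda>i. enn2real (self_energy (far d) (\<sigma> i))) \<longlonglongrightarrow> enn2real (self_energy (far d) \<tau>)"
    by (rule self_energy_far_tendsto[OF \<gamma>1 int nn supp mass pint pbd int' nn' weak d])
  have "eventually (\<lambda>i. enn2real (self_energy (far d) (\<sigma> i)) < enn2real (self_energy (far d) \<tau>) + \<epsilon> / 2) sequentially"
    using \<epsilon> by (intro order_tendstoD(2)[OF far]) auto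
  then show ?thesis
  proof eventually_elim
    case (elim i)
    have fi: "self_energy (far d) (\<sigma> i) \<noteq> \<infinity>"
      using self_energy_far_le[OF _ d m nn_integral_le_of_LINT[OF int nn mass], of i] int[of i]
      by (auto simp: top_unique)
    have "enn2real (self_energy newton (\<sigma> i)) = enn2real (self_energy (near d) (\<sigma> i)) + enn2real (self_energy (far d) (\<sigma> i))"
    proof -
      have "self_energy (near d) (\<sigma> i) < top" using nr[of i] by (rule le_less_trans) simp
      then show ?thesis
        using self_energy_newton_split[of "\<sigma> i" d] int[of i] fi
        by (simp add: enn2real_plus less_top)
    qed
    also have "\<dots> \<le> \<epsilon> / 2 + (enn2real (self_energy (far d) \<tau>) + \<epsilon> / 2)"
      using elim enn2real_mono[OF nr[of i]] \<epsilon> by (intro add_mono) auto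
    also have "enn2real (self_energy (far d) \<tau>) \<le> enn2real (self_energy newton \<tau>)"
      using fin by (intro enn2real_mono self_energy_mono) (auto simp: near_plus_far[of _ d] near_nonneg)
    finally show ?case by simp
  qed
qed

lemma self_energy_newton_bound:
  assumes n: "DIM('a::euclidean_space) \<ge> 2" and \<gamma>: "\<gamma> > 2 - 2 / DIM('a)" and m: "m \<ge> 0" and \<epsilon>: "\<epsilon> > 0"
  obtains C where "C \<ge> 0" "\<And>(\<rho> :: 'a \<Rightarrow> real) P. \<rho> \<in> borel_measurable lebesgue \<Longrightarrow> P \<ge> 0 \<Longrightarrow>
    (\<integral>\<^sup>+x. ennreal (\<rho> x) \<partial>lebesgue) \<le> ennreal m \<Longrightarrow> (\<integral>\<^sup>+x. ennreal (\<rho> x powr \<gamma>) \<partial>lebesgue) \<le> ennreal P \<Longrightarrow>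
    self_energy newton \<rho> \<le> ennreal (C + \<epsilon> * P)"
proof -
  obtain A where A: "A \<ge> 0" and b: "\<And>(\<rho> :: 'a \<Rightarrow> real) P d. \<rho> \<in> borel_measurable lebesgue \<Longrightarrow> P \<ge> 0 \<Longrightarrow> d > 0 \<Longrightarrow>
    (\<integral>\<^sup>+x. ennreal (\<rho> x) \<partial>lebesgue) \<le> ennreal m \<Longrightarrow> (\<integral>\<^sup>+x. ennreal (\<rho> x powr \<gamma>) \<partial>lebesgue) \<le> ennreal P \<Longrightarrow>
    self_energy (near d) \<rho> \<le> ennreal (A * d\<^sup>2 + \<epsilon> * P)"
    by (rule self_energy_near_absorbed[OF n \<gamma> m \<epsilon>]) (rule that, blast+)
  show thesis
  proof (rule that[of "A + m\<^sup>2"])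
    show "0 \<le> A + m\<^sup>2" using A by simp
    fix \<rho> :: "'a \<Rightarrow> real" and P
    assume r: "\<rho> \<in> borel_measurable lebesgue" "P \<ge> 0" "(\<integral>\<^sup>+x. ennreal (\<rho> x) \<partial>lebesgue) \<le> ennreal m"
      "(\<integral>\<^sup>+x. ennreal (\<rho> x powr \<gamma>) \<partial>lebesgue) \<le> ennreal P"
    have nr: "self_energy (near 1) \<rho> \<le> ennreal (A + \<epsilon> * P)"
      using b[OF r(1,2) zero_less_one r(3,4)] by simp
    have fr: "self_energy (far 1) \<rho> \<le> ennreal (m\<^sup>2)"
      using self_energy_far_le[OF r(1) zero_less_one m r(3)] by simp
    have "self_energy newton \<rho> \<le> ennreal (A + \<epsilon> * P) + ennreal (m\<^sup>2)"
      unfolding self_energy_newton_split[OF r(1), of 1] by (rule add_mono[OF nr fr])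
    also have "\<dots> = ennreal (A + m\<^sup>2 + \<epsilon> * P)"
      using A \<epsilon> r(2) by (simp add: ennreal_plus[symmetric] del: ennreal_plus)
    finally show "self_energy newton \<rho> \<le> ennreal (A + m\<^sup>2 + \<epsilon> * P)" .
  qed
qed

section \<open>Folding five dimensions onto three\<close>

lemma exhaust_5: "(x::5) = 1 \<or> x = 2 \<or> x = 3 \<or> x = 4 \<or> x = 5"
proof (induct x)
  case (of_int z)
  then have "0 \<le> z" "z < 5" by simp_all
  then have "z = 0 \<or> z = 1 \<or> z = 2 \<or> z = 3 \<or> z = 4" by arith
  then show ?case by auto
qed

lemma forall_5: "(\<forall>i::5. P i) \<longleftrightarrow> P 1 \<and> P 2 \<and> P 3 \<and> P 4 \<and> P 5"
  by (metis exhaust_5)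

lemma UNIV_5: "(UNIV::5 set) = {1, 2, 3, 4, 5}"
  using exhaust_5 by auto

lemma prod_UNIV_5: "prod f (UNIV::5 set) = f 1 * f 2 * f 3 * f 4 * (f 5 :: 'a::comm_monoid_mult)"
  unfolding UNIV_5 by (simp add: mult.assoc)

lemma sum_UNIV_5: "sum f (UNIV::5 set) = f 1 + f 2 + f 3 + f 4 + (f 5 :: 'a::comm_monoid_add)"
  unfolding UNIV_5 by (simp add: add.assoc)

lemma prod_UNIV_3: "prod f (UNIV::3 set) = f 1 * f 2 * (f 3 :: 'a::comm_monoid_mult)"
  unfolding UNIV_3 by (simp add: mult.assoc)

lemma prod_Basis_vec:
  fixes f :: "real^'n \<Rightarrow> real"
  shows "prod f Basis = (\<Prod>i\<in>UNIV. f (axis i 1))"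
proof -
  have "(Basis :: (real^'n) set) = (\<lambda>i. axis i 1) ` UNIV" by (auto simp: Basis_vec_def)
  then show ?thesis by (metis (no_types, lifting) axis_eq_axis injI prod.reindex_cong zero_neq_one)
qed

text \<open>
  Points of five-space are grouped as (coordinates 2, 4, 5), coordinate 1, coordinate 3, and points of three-space as
  coordinates 2, 1, 3. In this order the folding map below is the norm on the first factor and the identity on the others.
\<close>

definition join5 :: "(real^3) \<times> real \<times> real \<Rightarrow> real^5" where
  "join5 p = (\<chi> i. if i = 1 then fst (snd p) else if i = 3 then snd (snd p)
     else if i = 2 then fst p $ 1 else if i = 4 then fst p $ 2 else fst p $ 3)"

definition join3 :: "real \<times> real \<times> real \<Rightarrow> real^3" where
  "join3 p = vector [fst (snd p), fst p, snd (snd p)]"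

lemma borel_measurable_vecI:
  fixes f :: "'b \<Rightarrow> real^'n"
  assumes "\<And>i. (\<lambda>x. f x $ i) \<in> borel_measurable M"
  shows "f \<in> borel_measurable M"
  by (rule borel_measurable_euclidean_space[THEN iffD2])
    (use assms in \<open>auto simp: Basis_vec_def inner_axis\<close>)

lemma emeasure_lborel_Times:
  fixes A :: "'a::euclidean_space set" and B :: "'b::euclidean_space set"
  assumes "A \<in> sets borel" "B \<in> sets borel"
  shows "emeasure lborel (A \<times> B) = emeasure lborel A * emeasure lborel B"
  using assms by (subst lborel_prod[symmetric]) (simp add: lborel.emeasure_pair_measure_Times)

lemma join5_measurable[measurable]: "join5 \<in> borel_measurable borel"
proof (rule borel_measurable_vecI)
  fix i
  have "continuous_on UNIV (\<lambda>p. join5 p $ i)"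
    by (cases "i = 1"; cases "i = 3"; cases "i = 2"; cases "i = 4"; simp add: join5_def; intro continuous_intros)
  then show "(\<lambda>p. join5 p $ i) \<in> borel_measurable borel" by (rule borel_measurable_continuous_onI)
qed

lemma join3_measurable[measurable]: "join3 \<in> borel_measurable borel"
proof (rule borel_measurable_vecI)
  fix i :: 3
  have "continuous_on UNIV (\<lambda>p. join3 p $ i)"
    using exhaust_3[of i] by (elim disjE; simp add: join3_def; intro continuous_intros)
  then show "(\<lambda>p. join3 p $ i) \<in> borel_measurable borel" by (rule borel_measurable_continuous_onI)
qed

lemma distr_join5: "distr lborel borel join5 = lborel"
proof (rule lborel_eqI[symmetric])
  fix l u :: "real^5" assume le: "\<And>b. b \<in> Basis \<Longrightarrow> l \<bullet> b \<le> u \<bullet> b"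
  have lu: "l $ i \<le> u $ i" for i using le[of "axis i 1"] by (simp add: inner_axis)
  define l3 u3 :: "real^3" where "l3 = vector [l$2, l$4, l$5]" and "u3 = vector [u$2, u$4, u$5]"
  have vim: "join5 -` box l u = box l3 u3 \<times> box (l$1) (u$1) \<times> box (l$3) (u$3)"
    by (auto simp: join5_def mem_box_cart forall_5 forall_3 l3_def u3_def vector_3)
  have "\<forall>i. l3 $ i \<le> u3 $ i" using lu by (simp add: forall_3 l3_def u3_def)
  then have lu3: "l3 \<bullet> b \<le> u3 \<bullet> b" if "b \<in> Basis" for b
    using that by (auto simp: Basis_vec_def inner_axis)
  have "emeasure (distr lborel borel join5) (box l u) = emeasure (lborel :: ((real^3) \<times> real \<times> real) measure) (join5 -` box l u)"
    by (subst emeasure_distr) auto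
  also have "\<dots> = emeasure (lborel :: (real^3) measure) (box l3 u3) *
      (emeasure (lborel :: real measure) (box (l$1) (u$1)) * emeasure (lborel :: real measure) (box (l$3) (u$3)))"
    unfolding vim by (simp add: emeasure_lborel_Times borel_Times)
  also have "emeasure (lborel :: (real^3) measure) (box l3 u3) = ennreal ((u$2 - l$2) * (u$4 - l$4) * (u$5 - l$5))"
    using lu3 by (simp add: emeasure_lborel_box_eq prod_Basis_vec prod_UNIV_3 inner_axis l3_def u3_def vector_3)
  also have "emeasure (lborel :: real measure) (box (l$1) (u$1)) = ennreal (u$1 - l$1)"
    using lu[of 1] by (simp add: emeasure_lborel_box_eq)
  also have "emeasure (lborel :: real measure) (box (l$3) (u$3)) = ennreal (u$3 - l$3)"
    using lu[of 3] by (simp add: emeasure_lborel_box_eq)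
  also have "ennreal ((u$2 - l$2) * (u$4 - l$4) * (u$5 - l$5)) * (ennreal (u$1 - l$1) * ennreal (u$3 - l$3)) =
     ennreal ((u$1 - l$1) * (u$2 - l$2) * (u$3 - l$3) * (u$4 - l$4) * (u$5 - l$5))"
    using lu by (simp add: ennreal_mult[symmetric] mult_ac)
  also have "\<dots> = (\<Prod>b\<in>Basis. (u - l) \<bullet> b)"
    by (simp add: prod_Basis_vec prod_UNIV_5 inner_axis)
  finally show "emeasure (distr lborel borel join5) (box l u) = (\<Prod>b\<in>Basis. (u - l) \<bullet> b)" .
qed simp

lemma distr_join3: "distr lborel borel join3 = lborel"
proof (rule lborel_eqI[symmetric])
  fix l u :: "real^3" assume le: "\<And>b. b \<in> Basis \<Longrightarrow> l \<bullet> b \<le> u \<bullet> b"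
  have lu: "l $ i \<le> u $ i" for i using le[of "axis i 1"] by (simp add: inner_axis)
  have vim: "join3 -` box l u = box (l$2) (u$2) \<times> box (l$1) (u$1) \<times> box (l$3) (u$3)"
    by (auto simp: join3_def mem_box_cart forall_3 vector_3)
  have "emeasure (distr lborel borel join3) (box l u) = emeasure (lborel :: (real \<times> real \<times> real) measure) (join3 -` box l u)"
    by (simp add: emeasure_distr)
  also have "\<dots> = emeasure (lborel :: real measure) (box (l$2) (u$2)) *
      (emeasure (lborel :: real measure) (box (l$1) (u$1)) * emeasure (lborel :: real measure) (box (l$3) (u$3)))"
    unfolding vim by (simp add: emeasure_lborel_Times borel_Times)
  also have "\<dots> = ennreal ((u$1 - l$1) * (u$2 - l$2) * (u$3 - l$3))"
    using lu by (simp add: emeasure_lborel_box_eq ennreal_mult[symmetric] mult_ac)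
  also have "\<dots> = (\<Prod>b\<in>Basis. (u - l) \<bullet> b)"
    by (simp add: prod_Basis_vec prod_UNIV_3 inner_axis)
  finally show "emeasure (distr lborel borel join3) (box l u) = (\<Prod>b\<in>Basis. (u - l) \<bullet> b)" .
qed simp

text \<open>
  The point \<open>fold5 y\<close> has the distance from the axis and the height that the lifted density sees at \<open>y\<close>, so lifting is
  composition with \<open>fold5\<close> (\<open>lift5_fold5\<close>). The evaluation point in the definition of \<open>lift5\<close> lies in a
  half-plane, a null set; \<open>fold5\<close> instead carries Lebesgue measure to an absolutely continuous measure.
\<close>

definition fold5 :: "real^5 \<Rightarrow> real^3" where
  "fold5 y = vector [y$1, sqrt ((y$2)\<^sup>2 + (y$4)\<^sup>2 + (y$5)\<^sup>2), y$3]"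

lemma fold5_measurable[measurable]: "fold5 \<in> borel_measurable borel"
proof (rule borel_measurable_vecI)
  fix i :: 3
  have "continuous_on UNIV (\<lambda>p. fold5 p $ i)"
    using exhaust_3[of i] by (elim disjE; simp add: fold5_def; intro continuous_intros)
  then show "(\<lambda>p. fold5 p $ i) \<in> borel_measurable borel" by (rule borel_measurable_continuous_onI)
qed

lemma fold5_join5: "fold5 (join5 (v, q)) = join3 (norm v, q)"
  by (simp add: fold5_def join5_def join3_def norm_vec_def L2_set_def sum_3)

lemma fold5_comp: "cyl_radius (fold5 y) = sqrt ((y$1)\<^sup>2 + (y$2)\<^sup>2 + (y$4)\<^sup>2 + (y$5)\<^sup>2)" "fold5 y $ 3 = y $ 3"
  by (simp_all add: fold5_def cyl_radius_def vector_3 add.assoc)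

lemma norm_fold5: "norm (fold5 y) = norm y"
  by (simp add: fold5_def norm_vec_def L2_set_def sum_3 sum_UNIV_5 vector_3 add_ac)

definition fold_weight :: "real^3 \<Rightarrow> ennreal" where
  "fold_weight x = ennreal (4 * pi * (x$2)\<^sup>2) * indicator {0..} (x$2)"

lemma fold_weight_measurable[measurable]: "fold_weight \<in> borel_measurable borel"
  unfolding fold_weight_def[abs_def] by measurable

lemma nn_integral_lborel_pair:
  fixes f :: "'a::euclidean_space \<times> 'b::euclidean_space \<Rightarrow> ennreal"
  assumes f: "f \<in> borel_measurable borel"
  shows "integral\<^sup>N lborel f = (\<integral>\<^sup>+x. \<integral>\<^sup>+y. f (x, y) \<partial>lborel \<partial>lborel)"
    "integral\<^sup>N lborel f = (\<integral>\<^sup>+y. \<integral>\<^sup>+x. f (x, y) \<partial>lborel \<partial>lborel)"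
proof -
  have "f \<in> borel_measurable (lborel \<Otimes>\<^sub>M lborel)" using f by (simp add: lborel_prod)
  then show "integral\<^sup>N lborel f = (\<integral>\<^sup>+x. \<integral>\<^sup>+y. f (x, y) \<partial>lborel \<partial>lborel)"
    "integral\<^sup>N lborel f = (\<integral>\<^sup>+y. \<integral>\<^sup>+x. f (x, y) \<partial>lborel \<partial>lborel)"
    by (simp_all add: lborel_prod[symmetric] lborel.nn_integral_fst lborel_pair.nn_integral_snd)
qed

lemma nn_integral_fold5:
  assumes g[measurable]: "g \<in> borel_measurable borel"
  shows "(\<integral>\<^sup>+y. g (fold5 y) \<partial>lborel) = (\<integral>\<^sup>+x. fold_weight x * g x \<partial>lborel)"
proof -
  have vol3: "unit_ball_vol (real DIM(real^3)) = 4 / 3 * pi"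
    using unit_ball_vol_numeral(2)[of Num.One] by (simp add: fact_numeral)
  have w: "ennreal (DIM(real^3) * unit_ball_vol (real DIM(real^3)) * t ^ (DIM(real^3) - 1)) * indicator {0..} t
     = fold_weight (join3 (t, q))" for t q
    unfolding vol3 by (simp add: fold_weight_def join3_def vector_3)
  have "(\<integral>\<^sup>+y. g (fold5 y) \<partial>lborel) = (\<integral>\<^sup>+y. g (fold5 y) \<partial>(distr lborel borel join5))"
    by (simp add: distr_join5)
  also have "\<dots> = (\<integral>\<^sup>+p. g (fold5 (join5 p)) \<partial>lborel)"
    by (subst nn_integral_distr) auto
  also have "\<dots> = (\<integral>\<^sup>+q. \<integral>\<^sup>+v. g (fold5 (join5 (v, q))) \<partial>lborel \<partial>lborel)"
    by (rule nn_integral_lborel_pair(2)) auto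
  also have "\<dots> = (\<integral>\<^sup>+q. \<integral>\<^sup>+v. (\<lambda>t. g (join3 (t, q))) (norm v) \<partial>(lborel :: (real^3) measure) \<partial>lborel)"
    unfolding fold5_join5 ..
  also have "\<dots> = (\<integral>\<^sup>+q. \<integral>\<^sup>+t. fold_weight (join3 (t, q)) * g (join3 (t, q)) \<partial>lborel \<partial>lborel)"
  proof (rule nn_integral_cong)
    fix q :: "real \<times> real"
    have "(\<lambda>t. (t, q)) \<in> borel_measurable borel"
      by (intro borel_measurable_continuous_onI continuous_intros)
    then have m: "(\<lambda>t. g (join3 (t, q))) \<in> borel_measurable borel"
      using measurable_compose[OF measurable_compose[OF _ join3_measurable] g] by simp
    show "(\<integral>\<^sup>+v. (\<lambda>t. g (join3 (t, q))) (norm v) \<partial>(lborel :: (real^3) measure)) =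
        (\<integral>\<^sup>+t. fold_weight (join3 (t, q)) * g (join3 (t, q)) \<partial>lborel)"
      unfolding nn_integral_norm_lborel[OF m] w[of _ q] ..
  qed
  also have "\<dots> = (\<integral>\<^sup>+p. fold_weight (join3 p) * g (join3 p) \<partial>lborel)"
    by (rule nn_integral_lborel_pair(2)[symmetric]) auto
  also have "\<dots> = (\<integral>\<^sup>+x. fold_weight x * g x \<partial>(distr lborel borel join3))"
    by (subst nn_integral_distr) auto
  finally show ?thesis by (simp add: distr_join3)
qed

lemma distr_fold5: "distr lborel borel fold5 = density lborel fold_weight"
proof (rule measure_eqI)
  fix A assume "A \<in> sets (distr lborel borel fold5)"
  then have [measurable]: "A \<in> sets borel" by simp
  have "emeasure (distr lborel borel fold5) A = (\<integral>\<^sup>+x. indicator A x \<partial>distr lborel borel fold5)"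
    by simp
  also have "\<dots> = (\<integral>\<^sup>+y. indicator A (fold5 y) \<partial>lborel)"
    by (subst nn_integral_distr) auto
  also have "\<dots> = emeasure (density lborel fold_weight) A"
    by (subst nn_integral_fold5) (auto simp: emeasure_density)
  finally show "emeasure (distr lborel borel fold5) A = emeasure (density lborel fold_weight) A" .
qed simp

lemmas fold5_lebesgue = lebesgue_pushforward[OF fold5_measurable fold_weight_measurable distr_fold5]

section \<open>Reflections and axisymmetric functions\<close>

text \<open>
  The reflection in the hyperplane orthogonal to \<open>u - v\<close>. If \<open>u = v\<close> the division by zero yields the identity.
\<close>

lemma householder:
  fixes u v :: "real^'n"
  assumes uv: "norm u = norm v"
  obtains S where "orthogonal_transformation S" "S u = v" "\<And>x k. u $ k = v $ k \<Longrightarrow> S x $ k = x $ k"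
proof -
  define d where "d = u - v"
  define S where "S = (\<lambda>x. x - (2 * (d \<bullet> x) / (d \<bullet> d)) *\<^sub>R d)"
  have uu: "u \<bullet> u = v \<bullet> v" using uv by (simp add: norm_eq)
  have "linear S"
    unfolding S_def by (rule linearI) (simp_all add: inner_add_right algebra_simps add_divide_distrib flip: scaleR_add_left)
  moreover have "S x \<bullet> S y = x \<bullet> y" for x y
  proof (cases "d = 0")
    case True
    then show ?thesis by (simp add: S_def)
  next
    case False
    then have "d \<bullet> d \<noteq> 0" by simp
    then show ?thesis
      unfolding S_def by (simp add: inner_diff_left inner_diff_right inner_commute field_simps)
  qed
  ultimately have "orthogonal_transformation S" by (simp add: orthogonal_transformation_def)
  moreover have "S u = v"
  proof (cases "d = 0")
    case True
    then show ?thesis by (simp add: S_def d_def)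
  next
    case False
    have "d \<bullet> d = 2 * (d \<bullet> u)"
      using uu by (simp add: d_def inner_diff_left inner_diff_right inner_commute)
    moreover have "d \<bullet> d \<noteq> 0" using False by simp
    ultimately have one: "2 * (d \<bullet> u) / (d \<bullet> d) = 1" by simp
    show ?thesis unfolding S_def one by (simp add: d_def)
  qed
  moreover have "S x $ k = x $ k" if "u $ k = v $ k" for x k
    using that by (simp add: S_def d_def)
  ultimately show thesis by (rule that)
qed

lemma axisymmetricD:
  "axisymmetric \<rho> \<Longrightarrow> cyl_radius x = cyl_radius x' \<Longrightarrow> x $ 3 = x' $ 3 \<Longrightarrow> \<rho> x = \<rho> x'"
  unfolding axisymmetric_def by metis

lemma lift5_fold5:
  assumes "axisymmetric \<rho>"
  shows "lift5 \<rho> y = \<rho> (fold5 y)"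
proof -
  obtain f where f: "\<And>x. \<rho> x = f (cyl_radius x) (x $ 3)" using assms by (auto simp: axisymmetric_def)
  show ?thesis unfolding lift5_axisymmetric[of \<rho> f, OF f] f[of "fold5 y"] fold5_comp ..
qed

lemma cyl_radius_norm: "(cyl_radius x)\<^sup>2 + (x $ 3)\<^sup>2 = (norm x)\<^sup>2"
  by (simp add: cyl_radius_def norm_vec_def L2_set_def sum_3)

lemma cyl_radius_nonneg: "cyl_radius x \<ge> 0"
  by (simp add: cyl_radius_def)

lemma cyl_radius_eqI:
  assumes "norm x = norm x'" "x $ 3 = x' $ 3"
  shows "cyl_radius x = cyl_radius x'"
proof -
  have "(cyl_radius x)\<^sup>2 = (cyl_radius x')\<^sup>2"
    using cyl_radius_norm[of x] cyl_radius_norm[of x'] assms by simp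
  then show ?thesis using cyl_radius_nonneg by (simp add: power2_eq_iff_nonneg)
qed

lemma norm_eq_of_cyl_radius:
  assumes "cyl_radius x = cyl_radius x'" "x $ 3 = x' $ 3"
  shows "norm x = norm x'"
  using cyl_radius_norm[of x] cyl_radius_norm[of x'] assms by (metis norm_ge_zero power2_eq_iff_nonneg)

lemma AE_fold5:
  assumes "AE x in lebesgue. P x"
  shows "AE y in lebesgue. P (fold5 y)"
proof -
  obtain N where N: "\<And>x. x \<notin> N \<Longrightarrow> P x" "N \<in> null_sets lebesgue"
    using AE_E3[OF assms] by auto
  note [measurable] = fold5_lebesgue(1)
  have [measurable]: "N \<in> sets lebesgue" using N(2) by auto
  have V: "fold5 -` N \<in> sets lebesgue"
    using measurable_sets[OF fold5_lebesgue(1), of N] by simp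
  have "(\<lambda>y. indicator N (fold5 y) :: ennreal) = indicator (fold5 -` N)"
    by (rule ext) (simp add: indicator_def)
  then have "emeasure lebesgue (fold5 -` N) = (\<integral>\<^sup>+y. indicator N (fold5 y) \<partial>lebesgue)"
    using nn_integral_indicator[OF V] by (simp only:)
  also have "\<dots> = (\<integral>\<^sup>+x. fold_weight x * indicator N x \<partial>lebesgue)"
    by (rule fold5_lebesgue(2)) simp
  also have "\<dots> = 0" using N(2) by (rule nn_integral_null_set)
  finally have "fold5 -` N \<in> null_sets lebesgue" using V by auto
  then show ?thesis by (rule AE_I') (use N(1) in auto)
qed

lemma measurable_fold5_comp:
  "f \<in> borel_measurable lebesgue \<Longrightarrow> (\<lambda>y. f (fold5 y)) \<in> borel_measurable lebesgue"
  by (rule measurable_compose[OF fold5_lebesgue(1)])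

lemma fold_weight_le: "norm x \<le> R \<Longrightarrow> fold_weight x \<le> ennreal (4 * pi * R\<^sup>2)"
proof -
  assume "norm x \<le> R"
  then have "\<bar>x $ 2\<bar> \<le> R" using component_le_norm_cart[of x 2] by linarith
  then have "(x $ 2)\<^sup>2 \<le> R\<^sup>2" by (metis abs_ge_zero power2_abs power_mono)
  then show ?thesis
    unfolding fold_weight_def by (auto intro!: ennreal_leI mult_left_mono split: split_indicator)
qed

lemma fold5_integral_le:
  fixes f :: "real^3 \<Rightarrow> real"
  assumes f: "integrable lebesgue f" and nn: "AE x in lebesgue. 0 \<le> f x" and supp: "\<And>x. R \<le> norm x \<Longrightarrow> f x = 0"
    and m: "(LINT x|lebesgue. f x) \<le> m"
  shows "integrable lebesgue (\<lambda>y. f (fold5 y))" and "(LINT y|lebesgue. f (fold5 y)) \<le> 4 * pi * R\<^sup>2 * m"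
proof -
  have [measurable]: "f \<in> borel_measurable lebesgue" using f by simp
  note [measurable] = measurable_fold5_comp[OF this]
  have m0: "m \<ge> 0" using integral_nonneg_AE[OF nn] m by simp
  have "(\<integral>\<^sup>+y. ennreal (f (fold5 y)) \<partial>lebesgue) = (\<integral>\<^sup>+x. fold_weight x * ennreal (f x) \<partial>lebesgue)"
    by (rule fold5_lebesgue(2)) simp
  also have "\<dots> \<le> (\<integral>\<^sup>+x. ennreal (4 * pi * R\<^sup>2) * ennreal (f x) \<partial>lebesgue)"
  proof (rule nn_integral_mono)
    fix x show "fold_weight x * ennreal (f x) \<le> ennreal (4 * pi * R\<^sup>2) * ennreal (f x)"
      using fold_weight_le[of x R] supp[of x] by (cases "norm x \<le> R") (auto intro!: mult_right_mono)
  qed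
  also have "\<dots> = ennreal (4 * pi * R\<^sup>2) * (\<integral>\<^sup>+x. ennreal (f x) \<partial>lebesgue)"
    by (rule nn_integral_cmult) simp
  also have "\<dots> \<le> ennreal (4 * pi * R\<^sup>2) * ennreal m"
    by (intro mult_left_mono nn_integral_le_of_LINT f nn m) simp
  also have "\<dots> = ennreal (4 * pi * R\<^sup>2 * m)" using m0 by (simp add: ennreal_mult)
  finally have le: "(\<integral>\<^sup>+y. ennreal (f (fold5 y)) \<partial>lebesgue) \<le> ennreal (4 * pi * R\<^sup>2 * m)" .
  have nn5: "AE y in lebesgue. 0 \<le> f (fold5 y)" using nn by (rule AE_fold5)
  show int: "integrable lebesgue (\<lambda>y. f (fold5 y))"
    using nn5 le by (intro integrableI_nonneg) (auto intro: le_less_trans)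
  have "ennreal (LINT y|lebesgue. f (fold5 y)) \<le> ennreal (4 * pi * R\<^sup>2 * m)"
    using nn_integral_eq_integral[OF int nn5] le by simp
  then show "(LINT y|lebesgue. f (fold5 y)) \<le> 4 * pi * R\<^sup>2 * m"
    using m0 by (simp add: ennreal_le_iff)
qed

lemma lborel_distr_flip: "distr lborel borel (\<lambda>x::real^3. vector [x$1, - x$2, x$3] :: real^3) = lborel"
  and lborel_distr_swap: "distr lborel borel (\<lambda>x::real^3. vector [x$2, x$1, x$3] :: real^3) = lborel"
  by (rule lborel_distr_orthogonal;
      auto simp: orthogonal_transformation_def inner_vec_def sum_3 vec_eq_iff forall_3 algebra_simps intro!: linearI)+

lemma flip_measurable: "(\<lambda>x::real^3. vector [x$1, - x$2, x$3] :: real^3) \<in> borel_measurable borel"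
  and swap_measurable: "(\<lambda>x::real^3. vector [x$2, x$1, x$3] :: real^3) \<in> borel_measurable borel"
proof -
  have c: "(\<lambda>x::real^3. x $ i) \<in> borel_measurable borel" for i
    by (intro borel_measurable_continuous_onI continuous_intros)
  note c' = borel_measurable_uminus[OF c]
  show "(\<lambda>x::real^3. vector [x$1, - x$2, x$3] :: real^3) \<in> borel_measurable borel"
  proof (rule borel_measurable_vecI)
    fix i :: 3
    show "(\<lambda>x::real^3. (vector [x$1, - x$2, x$3] :: real^3) $ i) \<in> borel_measurable borel"
      using exhaust_3[of i] c c'[of 2] by (elim disjE) simp_all
  qed
  show "(\<lambda>x::real^3. vector [x$2, x$1, x$3] :: real^3) \<in> borel_measurable borel"
  proof (rule borel_measurable_vecI)
    fix i :: 3
    show "(\<lambda>x::real^3. (vector [x$2, x$1, x$3] :: real^3) $ i) \<in> borel_measurable borel"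
      using exhaust_3[of i] c by (elim disjE) simp_all
  qed
qed

section \<open>Potentials of lifted densities\<close>

lemma borel_imp_lebesgue_measurable:
  fixes f :: "'a::euclidean_space \<Rightarrow> 'b::topological_space"
  shows "f \<in> borel_measurable borel \<Longrightarrow> f \<in> borel_measurable lebesgue"
  by (rule measurable_completion) simp

lemma component_lebesgue_measurable: "(\<lambda>x::real^'n. x $ i) \<in> borel_measurable lebesgue"
proof -
  have "(\<lambda>x::real^'n. x $ i) \<in> borel_measurable borel"
    by (intro borel_measurable_continuous_onI continuous_intros)
  then show ?thesis by (rule borel_imp_lebesgue_measurable)
qed

lemma cyl_radius_measurable: "cyl_radius \<in> borel_measurable lebesgue"
proof -
  note [measurable] = component_lebesgue_measurable
  show ?thesis unfolding cyl_radius_def[abs_def] by measurable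
qed

text \<open>
  Averaging \<open>fold_weight\<close> over the reflection that reverses coordinate 2 and over the exchange of coordinates 1 and 2,
  both of which leave \<open>g\<close> unchanged, produces \<open>pi * (cyl_radius x)\<^sup>2\<close>.
\<close>

lemma nn_integral_fold5_axisymmetric:
  fixes g :: "real^3 \<Rightarrow> ennreal"
  assumes g: "g \<in> borel_measurable lebesgue"
    and sym: "\<And>x x'. cyl_radius x = cyl_radius x' \<Longrightarrow> x $ 3 = x' $ 3 \<Longrightarrow> g x = g x'"
  shows "(\<integral>\<^sup>+y. g (fold5 y) \<partial>lebesgue) = (\<integral>\<^sup>+x. ennreal (pi * (cyl_radius x)\<^sup>2) * g x \<partial>lebesgue)"
proof -
  note [measurable] = g component_lebesgue_measurable cyl_radius_measurable
  have fw[measurable]: "fold_weight \<in> borel_measurable lebesgue"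
    by (rule borel_imp_lebesgue_measurable[OF fold_weight_measurable])
  define F where "F = (\<lambda>x::real^3. vector [x$1, - x$2, x$3] :: real^3)"
  define Sw where "Sw = (\<lambda>x::real^3. vector [x$2, x$1, x$3] :: real^3)"
  have F: "F \<in> borel_measurable borel" "distr lborel borel F = lborel"
    unfolding F_def by (fact flip_measurable lborel_distr_flip)+
  have Sw: "Sw \<in> borel_measurable borel" "distr lborel borel Sw = lborel"
    unfolding Sw_def by (fact swap_measurable lborel_distr_swap)+
  note pF = lebesgue_measure_preserving[OF F] and pS = lebesgue_measure_preserving[OF Sw]
  have gF: "g (F x) = g x" and gS: "g (Sw x) = g x" for x
    by (rule sym; simp add: F_def Sw_def cyl_radius_def add.commute)+
  define L where "L = (\<integral>\<^sup>+x. fold_weight x * g x \<partial>lebesgue)"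
  define A where "A = (\<integral>\<^sup>+x. ennreal (4 * pi * (x$2)\<^sup>2) * g x \<partial>lebesgue)"
  define B where "B = (\<integral>\<^sup>+x. ennreal (pi * (cyl_radius x)\<^sup>2) * g x \<partial>lebesgue)"
  have m1: "(\<lambda>x. fold_weight x * g x) \<in> borel_measurable lebesgue" by measurable
  have m1F: "(\<lambda>x. fold_weight (F x) * g x) \<in> borel_measurable lebesgue"
    using measurable_compose[OF pF(1) m1] by (simp add: gF)
  have LF: "L = (\<integral>\<^sup>+x. fold_weight (F x) * g x \<partial>lebesgue)"
    unfolding L_def using pF(2)[OF m1] by (simp add: gF)
  \<comment> \<open>the factor 2 from the reflection, and below a further factor 2 from the exchange of coordinates\<close>
  have "2 * L = L + (\<integral>\<^sup>+x. fold_weight (F x) * g x \<partial>lebesgue)" unfolding LF[symmetric] by (rule mult_2)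
  also have "\<dots> = (\<integral>\<^sup>+x. fold_weight x * g x + fold_weight (F x) * g x \<partial>lebesgue)"
    unfolding L_def by (rule nn_integral_add[symmetric, OF m1 m1F])
  also have "\<dots> = A"
    unfolding A_def
  proof (rule nn_integral_cong)
    fix x :: "real^3"
    have "fold_weight x + fold_weight (F x) = ennreal (4 * pi * (x$2)\<^sup>2)"
      by (cases "x$2 = 0") (auto simp: fold_weight_def F_def split: split_indicator)
    then show "fold_weight x * g x + fold_weight (F x) * g x = ennreal (4 * pi * (x$2)\<^sup>2) * g x"
      by (simp flip: distrib_right)
  qed
  finally have 1: "2 * L = A" .
  have m2: "(\<lambda>x. ennreal (4 * pi * (x$2)\<^sup>2) * g x) \<in> borel_measurable lebesgue" by measurable
  have m3: "(\<lambda>x. ennreal (4 * pi * (x$1)\<^sup>2) * g x) \<in> borel_measurable lebesgue" by measurable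
  have AS: "A = (\<integral>\<^sup>+x. ennreal (4 * pi * (x$1)\<^sup>2) * g x \<partial>lebesgue)"
    unfolding A_def using pS(2)[OF m2] by (simp add: gS) (simp add: Sw_def)
  have "2 * A = (\<integral>\<^sup>+x. ennreal (4 * pi * (x$1)\<^sup>2) * g x \<partial>lebesgue) + A"
    unfolding AS[symmetric] by (rule mult_2)
  also have "\<dots> = (\<integral>\<^sup>+x. ennreal (4 * pi * (x$1)\<^sup>2) * g x + ennreal (4 * pi * (x$2)\<^sup>2) * g x \<partial>lebesgue)"
    unfolding A_def by (rule nn_integral_add[symmetric, OF m3 m2])
  also have "\<dots> = (\<integral>\<^sup>+x. 4 * (ennreal (pi * (cyl_radius x)\<^sup>2) * g x) \<partial>lebesgue)"
  proof (rule nn_integral_cong)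
    fix x :: "real^3"
    have "ennreal (4 * pi * (x$1)\<^sup>2) + ennreal (4 * pi * (x$2)\<^sup>2) = ennreal (4 * (pi * (cyl_radius x)\<^sup>2))"
      by (subst ennreal_plus[symmetric]) (simp_all add: cyl_radius_def algebra_simps)
    also have "\<dots> = 4 * ennreal (pi * (cyl_radius x)\<^sup>2)" by (simp add: ennreal_mult)
    finally show "ennreal (4 * pi * (x$1)\<^sup>2) * g x + ennreal (4 * pi * (x$2)\<^sup>2) * g x = 4 * (ennreal (pi * (cyl_radius x)\<^sup>2) * g x)"
      by (simp add: mult.assoc flip: distrib_right)
  qed
  also have "\<dots> = 4 * B" unfolding B_def by (rule nn_integral_cmult) measurable
  finally have "2 * (2 * L) = 4 * B" using 1 by simp
  then have "4 * L = 4 * B" by (simp flip: mult.assoc)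
  then have "L = B" by (simp add: ennreal_mult_cancel_left)
  then show ?thesis using fold5_lebesgue(2)[OF g] by (simp add: L_def B_def)
qed

definition ring_potential :: "(real^3 \<Rightarrow> real) \<Rightarrow> real^5 \<Rightarrow> ennreal" where
  "ring_potential \<rho> X = (\<integral>\<^sup>+y. ennreal (\<rho> (fold5 y)) * ennreal (newton (X - y)) \<partial>lebesgue)"

lemma ring_potential_measurable:
  "\<rho> \<in> borel_measurable lebesgue \<Longrightarrow> ring_potential \<rho> \<in> borel_measurable borel"
  unfolding ring_potential_def[abs_def]
  by (rule potential_measurable[OF measurable_fold5_comp newton_measurable])

text \<open>
  A reflection that exchanges \<open>X\<close> and \<open>X'\<close> and fixes the third coordinate preserves Lebesgue measure, the
  kernel and the lifted density.
\<close>

lemma ring_potential_axisymmetric: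
  assumes \<rho>: "\<rho> \<in> borel_measurable lebesgue" and ax: "axisymmetric \<rho>"
    and X: "norm X = norm X'" "X $ 3 = X' $ 3"
  shows "ring_potential \<rho> X = ring_potential \<rho> X'"
proof -
  obtain S where S: "orthogonal_transformation S" "S X = X'" and S3: "\<And>x. S x $ 3 = x $ 3"
    using householder[OF X(1)] X(2) by metis
  have lin: "linear S" using S(1) by (rule orthogonal_transformation_linear)
  have Sm: "S \<in> borel_measurable borel"
    using lin by (intro borel_measurable_continuous_onI linear_continuous_on) (simp add: linear_conv_bounded_linear)
  have nS: "norm (S x) = norm x" for x using S(1) by (rule orthogonal_transformation_norm)
  have \<rho>S: "\<rho> (fold5 (S y)) = \<rho> (fold5 y)" for y
  proof (rule axisymmetricD[OF ax])
    show "fold5 (S y) $ 3 = fold5 y $ 3" by (simp add: fold5_comp S3)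
    then show "cyl_radius (fold5 (S y)) = cyl_radius (fold5 y)"
      by (intro cyl_radius_eqI) (simp_all add: norm_fold5 nS)
  qed
  have nwt: "newton (X' - S y) = newton (X - y)" for y
    unfolding S(2)[symmetric] linear_diff[OF lin, symmetric] newton_def nS ..
  note [measurable] = measurable_fold5_comp[OF \<rho>] kernel_measurable[OF newton_measurable, of X']
  have m: "(\<lambda>y. ennreal (\<rho> (fold5 y)) * ennreal (newton (X' - y))) \<in> borel_measurable lebesgue"
    by measurable
  show ?thesis
    unfolding ring_potential_def
    using lebesgue_measure_preserving(2)[OF Sm lborel_distr_orthogonal[OF S(1)] m]
    by (simp add: \<rho>S nwt)
qed

lemma embed5_simps: "norm (embed5 x) = norm x" "embed5 x $ 3 = x $ 3"
  by (simp_all add: embed5_def norm_vec_def L2_set_def sum_3 sum_UNIV_5)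

lemma embed5_measurable: "embed5 \<in> borel_measurable borel"
proof (rule borel_measurable_vecI)
  fix i :: 5
  have c: "(\<lambda>x::real^3. x $ i) \<in> borel_measurable borel" for i
    by (intro borel_measurable_continuous_onI continuous_intros)
  show "(\<lambda>x. embed5 x $ i) \<in> borel_measurable borel"
    unfolding embed5_def
    by (cases "i = 1"; cases "i = 2"; cases "i = 3") (use c in simp_all)
qed

lemma ring_potential_embed5_measurable:
  assumes "\<rho> \<in> borel_measurable lebesgue"
  shows "(\<lambda>x. ring_potential \<rho> (embed5 x)) \<in> borel_measurable lebesgue"
proof -
  have "(\<lambda>x. ring_potential \<rho> (embed5 x)) \<in> borel_measurable borel"
    by (rule measurable_compose[OF embed5_measurable ring_potential_measurable[OF assms]])
  then show ?thesis by (rule borel_imp_lebesgue_measurable)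
qed

text \<open>
  The magnetic energy is an integral over three-space of a potential on five-space. Axisymmetry of that potential turns
  the factor \<open>(cyl_radius x)\<^sup>2\<close> into the image of five-dimensional volume, which makes the quadratic form symmetric.
\<close>

lemma self_energy_lift5:
  assumes \<rho>: "\<rho> \<in> borel_measurable lebesgue" and ax: "axisymmetric \<rho>"
  shows "self_energy newton (\<lambda>y. \<rho> (fold5 y)) =
    (\<integral>\<^sup>+x. ennreal (pi * (cyl_radius x)\<^sup>2) * (ennreal (\<rho> x) * ring_potential \<rho> (embed5 x)) \<partial>lebesgue)"
proof -
  define g where "g = (\<lambda>x. ennreal (\<rho> x) * ring_potential \<rho> (embed5 x))"
  note [measurable] = \<rho> ring_potential_embed5_measurable[OF \<rho>]
  have gm: "g \<in> borel_measurable lebesgue" unfolding g_def by measurable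
  have "self_energy newton (\<lambda>y. \<rho> (fold5 y)) = (\<integral>\<^sup>+y. ennreal (\<rho> (fold5 y)) * ring_potential \<rho> y \<partial>lebesgue)"
    unfolding ring_potential_def by (rule self_energy_alt[OF measurable_fold5_comp[OF \<rho>] newton_measurable])
  also have "\<dots> = (\<integral>\<^sup>+y. g (fold5 y) \<partial>lebesgue)"
  proof (rule nn_integral_cong)
    fix y :: "real^5"
    have "ring_potential \<rho> y = ring_potential \<rho> (embed5 (fold5 y))"
      by (rule ring_potential_axisymmetric[OF \<rho> ax]) (simp_all add: embed5_simps norm_fold5 fold5_comp)
    then show "ennreal (\<rho> (fold5 y)) * ring_potential \<rho> y = g (fold5 y)" by (simp add: g_def)
  qed
  also have "\<dots> = (\<integral>\<^sup>+x. ennreal (pi * (cyl_radius x)\<^sup>2) * g x \<partial>lebesgue)"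
  proof (rule nn_integral_fold5_axisymmetric[OF gm])
    fix x x' :: "real^3" assume xx: "cyl_radius x = cyl_radius x'" "x $ 3 = x' $ 3"
    have "ring_potential \<rho> (embed5 x) = ring_potential \<rho> (embed5 x')"
      by (rule ring_potential_axisymmetric[OF \<rho> ax])
        (simp_all add: embed5_simps xx norm_eq_of_cyl_radius[OF xx])
    then show "g x = g x'" using axisymmetricD[OF ax xx] by (simp add: g_def)
  qed
  finally show ?thesis by (simp add: g_def)
qed

text \<open>
  Since \<open>enn2real\<close> maps infinity to 0, the real integral could lose mass; finiteness of the extended integral confines
  infinite values of \<open>W\<close> to the zeros of \<open>f\<close>, up to a null set.
\<close>

lemma LINT_mult_enn2real:
  assumes [measurable]: "f \<in> borel_measurable M" "W \<in> borel_measurable M"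
    and nn: "AE x in M. 0 \<le> f x" and fin: "(\<integral>\<^sup>+x. ennreal (f x) * W x \<partial>M) < \<infinity>"
  shows "integrable M (\<lambda>x. f x * enn2real (W x))"
    and "(LINT x|M. f x * enn2real (W x)) = enn2real (\<integral>\<^sup>+x. ennreal (f x) * W x \<partial>M)"
proof -
  have "AE x in M. ennreal (f x) * W x \<noteq> \<infinity>"
    by (rule nn_integral_PInf_AE) (use fin in auto)
  then have "AE x in M. ennreal (f x * enn2real (W x)) = ennreal (f x) * W x"
    using nn
  proof eventually_elim
    case (elim x)
    then show ?case
      by (cases "f x = 0") (auto simp: ennreal_mult ennreal_mult_eq_top_iff less_top)
  qed
  then have eq: "(\<integral>\<^sup>+x. ennreal (f x * enn2real (W x)) \<partial>M) = (\<integral>\<^sup>+x. ennreal (f x) * W x \<partial>M)"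
    by (rule nn_integral_cong_AE)
  have nn2: "AE x in M. 0 \<le> f x * enn2real (W x)" using nn by eventually_elim simp
  show "integrable M (\<lambda>x. f x * enn2real (W x))"
    using nn2 eq fin by (intro integrableI_nonneg) auto
  show "(LINT x|M. f x * enn2real (W x)) = enn2real (\<integral>\<^sup>+x. ennreal (f x) * W x \<partial>M)"
    using integral_eq_nn_integral[OF _ nn2] eq by simp
qed

section \<open>The energy in terms of self-energies\<close>

lemma distr_lebesgue_translation:
  fixes a :: "'a::euclidean_space"
  shows "(\<lambda>x. x + a) \<in> lebesgue \<rightarrow>\<^sub>M lebesgue" "distr lebesgue lebesgue (\<lambda>x. x + a) = lebesgue"
proof -
  have D: "distr lborel borel (\<lambda>x. x + a) = lborel"
    using lborel_distr_plus[of a] by (simp add: add.commute[of _ a])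
  have T: "(\<lambda>x. x + a) \<in> borel_measurable borel" by measurable
  show M: "(\<lambda>x. x + a) \<in> lebesgue \<rightarrow>\<^sub>M lebesgue"
    by (rule lebesgue_measure_preserving(1)[OF T D])
  show "distr lebesgue lebesgue (\<lambda>x. x + a) = lebesgue"
  proof (rule measure_eqI)
    fix A assume "A \<in> sets (distr lebesgue lebesgue (\<lambda>x. x + a))"
    then have A: "A \<in> sets (lebesgue :: 'a measure)" by simp
    have "emeasure (distr lebesgue lebesgue (\<lambda>x. x + a)) A = (\<integral>\<^sup>+x. indicator A x \<partial>distr lebesgue lebesgue (\<lambda>x. x + a))"
      using A by simp
    also have "\<dots> = (\<integral>\<^sup>+x. indicator A (x + a) \<partial>lebesgue)"
      using A by (intro nn_integral_distr M) simp
    also have "\<dots> = emeasure lebesgue A"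
      using A by (subst lebesgue_measure_preserving(2)[OF T D]) auto
    finally show "emeasure (distr lebesgue lebesgue (\<lambda>x. x + a)) A = emeasure lebesgue A" .
  qed simp
qed

lemma lebesgue_translation:
  fixes f :: "'a::euclidean_space \<Rightarrow> real"
  assumes f: "f \<in> borel_measurable lebesgue"
  shows "(\<lambda>x. f (x + a)) \<in> borel_measurable lebesgue"
    and "(LINT x|lebesgue. f (x + a)) = (LINT x|lebesgue. f x)"
    and "integrable lebesgue (\<lambda>x. f (x + a)) \<longleftrightarrow> integrable lebesgue f"
    and "(AE x in lebesgue. 0 \<le> f x) \<Longrightarrow> (AE x in lebesgue. 0 \<le> f (x + a))"
proof -
  note M = distr_lebesgue_translation[of a]
  show "(\<lambda>x. f (x + a)) \<in> borel_measurable lebesgue" by (rule measurable_compose[OF M(1) f])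
  show "(LINT x|lebesgue. f (x + a)) = (LINT x|lebesgue. f x)"
    using integral_distr[OF M(1) f] M(2) by simp
  show "integrable lebesgue (\<lambda>x. f (x + a)) \<longleftrightarrow> integrable lebesgue f"
    using integrable_distr_eq[OF M(1) f] M(2) by simp
  assume "AE x in lebesgue. 0 \<le> f x"
  then have "AE x in distr lebesgue lebesgue (\<lambda>x. x + a). 0 \<le> f x" unfolding M(2) .
  then show "AE x in lebesgue. 0 \<le> f (x + a)" by (rule AE_distrD[OF M(1)])
qed

lemma self_energy_translation:
  fixes \<rho> :: "'a::euclidean_space \<Rightarrow> real"
  assumes \<rho>: "\<rho> \<in> borel_measurable lebesgue" and k: "k \<in> borel_measurable borel"
  shows "self_energy k (\<lambda>x. \<rho> (x + a)) = self_energy k \<rho>"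
proof -
  note M = distr_lebesgue_translation[of a]
  define U where "U = (\<lambda>x. \<integral>\<^sup>+y. ennreal (\<rho> y) * ennreal (k (x - y)) \<partial>lebesgue)"
  have nn: "(\<integral>\<^sup>+x. f (x + a) \<partial>lebesgue) = (\<integral>\<^sup>+x. f x \<partial>lebesgue)"
    if "f \<in> borel_measurable lebesgue" for f :: "'a \<Rightarrow> ennreal"
    using nn_integral_distr[OF M(1), of f] that M(2) by simp
  note [measurable] = \<rho> kernel_measurable[OF k]
  have U: "U \<in> borel_measurable lebesgue"
    unfolding U_def by (rule borel_imp_lebesgue_measurable[OF potential_measurable[OF \<rho> k]])
  note [measurable] = U
  have pot: "(\<integral>\<^sup>+y. ennreal (\<rho> (y + a)) * ennreal (k (x - y)) \<partial>lebesgue) = U (x + a)" for x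
    unfolding U_def using nn[of "\<lambda>y. ennreal (\<rho> y) * ennreal (k (x + a - y))"] by simp
  have "(\<lambda>x. ennreal (\<rho> x) * U x) \<in> borel_measurable lebesgue" by measurable
  note eq = nn[OF this]
  show ?thesis
    unfolding self_energy_alt[OF lebesgue_translation(1)[OF \<rho>] k] self_energy_alt[OF \<rho> k] pot U_def[symmetric]
    using eq by (simp add: U_def)
qed

lemma fold5_translation: "fold5 (y + a *\<^sub>R axis 3 1) = fold5 y + a *\<^sub>R e3"
  by (simp add: fold5_def e3_def vec_eq_iff forall_3 axis_def)

lemma self_energy_lift_translation:
  assumes \<rho>: "\<rho> \<in> borel_measurable lebesgue"
  shows "self_energy newton (\<lambda>y. \<rho> (fold5 y + a *\<^sub>R e3)) = self_energy newton (\<lambda>y. \<rho> (fold5 y))"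
  unfolding fold5_translation[symmetric]
  by (rule self_energy_translation[OF measurable_fold5_comp[OF \<rho>] newton_measurable, of "a *\<^sub>R axis 3 1"])

lemma DIM_3: "DIM(real^3) = 3" and DIM_5: "DIM(real^5) = 5"
  by simp_all

lemma newton_3: "newton (z :: real^3) = 1 / norm z"
  by (simp add: newton_def)

lemma newton_5: "newton (z :: real^5) = norm z powr (- 3)"
proof (cases "z = 0")
  case False
  then show ?thesis by (simp add: newton_def powr_minus divide_inverse)
qed (simp add: newton_def)

lemma gravitational_energy:
  assumes \<rho>: "\<rho> \<in> borel_measurable lebesgue" and nn: "AE x in lebesgue. 0 \<le> \<rho> x"
    and fin: "self_energy newton \<rho> < \<infinity>"
  shows "integrable lebesgue (\<lambda>x. \<rho> x * grav_potential \<rho> x)"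
    and "(LINT x|lebesgue. \<rho> x * grav_potential \<rho> x) = enn2real (self_energy newton \<rho>)"
proof -
  define W where "W = (\<lambda>x. \<integral>\<^sup>+y. ennreal (\<rho> y) * ennreal (newton (x - y)) \<partial>lebesgue)"
  note [measurable] = \<rho> kernel_measurable[OF newton_measurable]
  have W: "W \<in> borel_measurable lebesgue"
    unfolding W_def by (rule borel_imp_lebesgue_measurable[OF potential_measurable[OF \<rho> newton_measurable]])
  have G: "grav_potential \<rho> x = enn2real (W x)" for x
  proof -
    have "grav_potential \<rho> x = (LINT y|lebesgue. \<rho> y * newton (x - y))"
      by (simp add: grav_potential_def newton_3)
    also have "\<dots> = enn2real (\<integral>\<^sup>+y. ennreal (\<rho> y * newton (x - y)) \<partial>lebesgue)"
      using nn by (intro integral_eq_nn_integral) (auto simp: newton_nonneg)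
    also have "(\<integral>\<^sup>+y. ennreal (\<rho> y * newton (x - y)) \<partial>lebesgue) = W x"
      unfolding W_def using nn by (intro nn_integral_cong_AE) (auto simp: ennreal_mult newton_nonneg)
    finally show ?thesis .
  qed
  have SE: "self_energy newton \<rho> = (\<integral>\<^sup>+x. ennreal (\<rho> x) * W x \<partial>lebesgue)"
    unfolding W_def by (rule self_energy_alt[OF \<rho> newton_measurable])
  show "integrable lebesgue (\<lambda>x. \<rho> x * grav_potential \<rho> x)"
    unfolding G using LINT_mult_enn2real(1)[OF \<rho> W nn] fin SE by simp
  show "(LINT x|lebesgue. \<rho> x * grav_potential \<rho> x) = enn2real (self_energy newton \<rho>)"
    unfolding G SE using LINT_mult_enn2real(2)[OF \<rho> W nn] fin SE by simp
qed

text \<open>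
  The constant collects \<open>\<beta>/2\<close> from the energy, \<open>4 * pi * \<beta>\<close> and the constant of the fundamental solution
  from the potential, and a factor \<open>1/pi\<close> from \<open>self_energy_lift5\<close>. The two negative signs cancel, so the
  magnetic term always lowers the energy.
\<close>

definition mag_coeff :: "real \<Rightarrow> real" where
  "mag_coeff \<beta> = 2 * \<beta>\<^sup>2 / (15 * measure lebesgue (ball (0::real^5) 1))"

lemma mag_coeff_nonneg: "mag_coeff \<beta> \<ge> 0"
  by (simp add: mag_coeff_def)

lemma magnetic_energy:
  assumes \<rho>: "\<rho> \<in> borel_measurable lebesgue" and nn: "AE x in lebesgue. 0 \<le> \<rho> x" and ax: "axisymmetric \<rho>"
    and fin: "self_energy newton (\<lambda>y. \<rho> (fold5 y)) < \<infinity>"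
  shows "integrable lebesgue (\<lambda>x. 1/2 * \<beta> * \<rho> x * mag_potential \<beta> \<rho> x)"
    and "(LINT x|lebesgue. 1/2 * \<beta> * \<rho> x * mag_potential \<beta> \<rho> x) =
      mag_coeff \<beta> * enn2real (self_energy newton (\<lambda>y. \<rho> (fold5 y)))"
proof -
  define W where "W = (\<lambda>x. ring_potential \<rho> (embed5 x))"
  define f where "f = (\<lambda>x. pi * (cyl_radius x)\<^sup>2 * \<rho> x)"
  define \<omega> where "\<omega> = measure lebesgue (ball (0::real^5) 1)"
  note [measurable] = \<rho> kernel_measurable[OF newton_measurable] cyl_radius_measurable measurable_fold5_comp[OF \<rho>]
  have W: "W \<in> borel_measurable lebesgue" unfolding W_def by (rule ring_potential_embed5_measurable[OF \<rho>])
  have f: "f \<in> borel_measurable lebesgue" unfolding f_def by measurable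
  have fnn: "AE x in lebesgue. 0 \<le> f x" using nn by eventually_elim (simp add: f_def)
  have nn5: "AE y in lebesgue. 0 \<le> \<rho> (fold5 y)" using nn by (rule AE_fold5)
  have chi: "chi5 \<beta> \<rho> X = 4 * pi * \<beta> / (15 * \<omega>) * enn2real (ring_potential \<rho> X)" for X
  proof -
    have "chi5 \<beta> \<rho> X = (LINT y|lebesgue. 4 * pi * \<beta> / (15 * \<omega>) * (\<rho> (fold5 y) * newton (X - y)))"
      unfolding chi5_def fund_sol5_def lift5_fold5[OF ax] newton_5 \<omega>_def
      by (intro Bochner_Integration.integral_cong) auto
    also have "\<dots> = 4 * pi * \<beta> / (15 * \<omega>) * (LINT y|lebesgue. \<rho> (fold5 y) * newton (X - y))"
      by simp
    also have "(LINT y|lebesgue. \<rho> (fold5 y) * newton (X - y)) = enn2real (\<integral>\<^sup>+y. ennreal (\<rho> (fold5 y) * newton (X - y)) \<partial>lebesgue)"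
      using nn5 by (intro integral_eq_nn_integral) (auto simp: newton_nonneg)
    also have "(\<integral>\<^sup>+y. ennreal (\<rho> (fold5 y) * newton (X - y)) \<partial>lebesgue) = ring_potential \<rho> X"
      unfolding ring_potential_def using nn5
      by (intro nn_integral_cong_AE) (auto simp: ennreal_mult newton_nonneg)
    finally show ?thesis .
  qed
  have SE: "self_energy newton (\<lambda>y. \<rho> (fold5 y)) = (\<integral>\<^sup>+x. ennreal (f x) * W x \<partial>lebesgue)"
    unfolding self_energy_lift5[OF \<rho> ax] W_def f_def using nn
    by (intro nn_integral_cong_AE) (auto simp: ennreal_mult mult.assoc)
  have eq: "1/2 * \<beta> * \<rho> x * mag_potential \<beta> \<rho> x = mag_coeff \<beta> * (f x * enn2real (W x))" for x
    unfolding mag_potential_def chi mag_coeff_def f_def W_def \<omega>_def by (simp add: power2_eq_square field_simps)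
  have fin': "(\<integral>\<^sup>+x. ennreal (f x) * W x \<partial>lebesgue) < \<infinity>" using fin SE by simp
  show "integrable lebesgue (\<lambda>x. 1/2 * \<beta> * \<rho> x * mag_potential \<beta> \<rho> x)"
    unfolding eq using LINT_mult_enn2real(1)[OF f W fnn fin'] by simp
  show "(LINT x|lebesgue. 1/2 * \<beta> * \<rho> x * mag_potential \<beta> \<rho> x) =
      mag_coeff \<beta> * enn2real (self_energy newton (\<lambda>y. \<rho> (fold5 y)))"
    unfolding eq SE using LINT_mult_enn2real(2)[OF f W fnn fin'] by simp
qed

lemma energy_nonmag_eq:
  assumes \<rho>: "\<rho> \<in> borel_measurable lebesgue" and nn: "AE x in lebesgue. 0 \<le> \<rho> x"
    and pint: "integrable lebesgue (\<lambda>x. \<rho> x powr \<gamma>)"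
    and fin: "self_energy newton \<rho> < \<infinity>"
  shows "energy_nonmag \<gamma> \<rho> = (LINT x|lebesgue. \<rho> x powr \<gamma>) / (\<gamma> - 1) - 1/2 * enn2real (self_energy newton \<rho>)"
    and "integrable lebesgue (\<lambda>x. internal_energy \<gamma> (\<rho> x) + 1/2 * \<rho> x * grav_potential \<rho> x)"
proof -
  note G = gravitational_energy[OF \<rho> nn fin]
  have i1: "integrable lebesgue (\<lambda>x. internal_energy \<gamma> (\<rho> x))"
    using pint by (simp add: internal_energy_def pressure_def)
  have i2: "integrable lebesgue (\<lambda>x. 1/2 * \<rho> x * grav_potential \<rho> x)"
    using G(1) by (simp add: mult.assoc)
  show "integrable lebesgue (\<lambda>x. internal_energy \<gamma> (\<rho> x) + 1/2 * \<rho> x * grav_potential \<rho> x)"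
    using i1 i2 by (rule Bochner_Integration.integrable_add)
  show "energy_nonmag \<gamma> \<rho> = (LINT x|lebesgue. \<rho> x powr \<gamma>) / (\<gamma> - 1) - 1/2 * enn2real (self_energy newton \<rho>)"
    unfolding energy_nonmag_def Bochner_Integration.integral_diff[OF i1 i2]
    using G(2) by (simp add: mult.assoc internal_energy_def pressure_def)
qed

lemma energy_eq:
  assumes \<rho>: "\<rho> \<in> borel_measurable lebesgue" and nn: "AE x in lebesgue. 0 \<le> \<rho> x" and ax: "axisymmetric \<rho>"
    and pint: "integrable lebesgue (\<lambda>x. \<rho> x powr \<gamma>)"
    and fin3: "self_energy newton \<rho> < \<infinity>" and fin5: "self_energy newton (\<lambda>y. \<rho> (fold5 y)) < \<infinity>"
  shows "energy \<gamma> \<beta> \<rho> = (LINT x|lebesgue. \<rho> x powr \<gamma>) / (\<gamma> - 1) - 1/2 * enn2real (self_energy newton \<rho>)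
    - mag_coeff \<beta> * enn2real (self_energy newton (\<lambda>y. \<rho> (fold5 y)))"
proof -
  note G = gravitational_energy[OF \<rho> nn fin3] and m = magnetic_energy[OF \<rho> nn ax fin5, of \<beta>]
  have i1: "integrable lebesgue (\<lambda>x. internal_energy \<gamma> (\<rho> x))"
    using pint by (simp add: internal_energy_def pressure_def)
  have i2: "integrable lebesgue (\<lambda>x. 1/2 * \<rho> x * grav_potential \<rho> x)"
    using G(1) by (simp add: mult.assoc)
  note i12 = Bochner_Integration.integrable_diff[OF i1 i2]
  show ?thesis
    unfolding energy_def Bochner_Integration.integral_diff[OF i12 m(1)] Bochner_Integration.integral_diff[OF i1 i2] m(2)
    using G(2) by (simp add: mult.assoc internal_energy_def pressure_def)
qed

section \<open>Weak convergence of lifted densities\<close>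

lemma AE_le_of_nn_integral_le:
  fixes f g :: "'a::euclidean_space \<Rightarrow> ennreal"
  assumes [measurable]: "f \<in> borel_measurable borel" "g \<in> borel_measurable borel"
    and fin: "\<And>n::nat. (\<integral>\<^sup>+x. g x * indicator (ball 0 (real n)) x \<partial>lborel) < \<infinity>"
    and le: "\<And>A. A \<in> sets borel \<Longrightarrow> (\<integral>\<^sup>+x. f x * indicator A x \<partial>lborel) \<le> (\<integral>\<^sup>+x. g x * indicator A x \<partial>lborel)"
  shows "AE x in lborel. f x \<le> g x"
proof -
  have "AE x in lborel. x \<in> ball 0 (real n) \<longrightarrow> f x \<le> g x" for n :: nat
  proof (rule ccontr)
    assume neg: "\<not> (AE x in lborel. x \<in> ball 0 (real n) \<longrightarrow> f x \<le> g x)"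
    define A where "A = {x. g x < f x} \<inter> ball 0 (real n)"
    have [measurable]: "{x. g x < f x} \<in> sets borel" by simp
    have A[measurable]: "A \<in> sets borel" unfolding A_def by (intro sets.Int) auto
    have "(\<integral>\<^sup>+x. g x * indicator A x \<partial>lborel) < (\<integral>\<^sup>+x. f x * indicator A x \<partial>lborel)"
    proof (rule nn_integral_less)
      have "(\<integral>\<^sup>+x. g x * indicator A x \<partial>lborel) \<le> (\<integral>\<^sup>+x. g x * indicator (ball 0 (real n)) x \<partial>lborel)"
        by (intro nn_integral_mono mult_left_mono) (auto simp: A_def indicator_def)
      with fin[of n] show "(\<integral>\<^sup>+x. g x * indicator A x \<partial>lborel) \<noteq> \<infinity>" by (auto simp: top_unique)
      show "AE x in lborel. g x * indicator A x \<le> f x * indicator A x"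
        by (intro AE_I2) (auto simp: A_def indicator_def)
      show "\<not> (AE x in lborel. f x * indicator A x \<le> g x * indicator A x)"
      proof
        assume "AE x in lborel. f x * indicator A x \<le> g x * indicator A x"
        then have "AE x in lborel. x \<in> ball 0 (real n) \<longrightarrow> f x \<le> g x"
        proof eventually_elim
          case (elim x)
          show ?case
          proof (intro impI, rule ccontr)
            assume "x \<in> ball 0 (real n)" "\<not> f x \<le> g x"
            then have "x \<in> A" by (simp add: A_def not_le)
            with elim \<open>\<not> f x \<le> g x\<close> show False by simp
          qed
        qed
        with neg show False by simp
      qed
    qed measurable
    with le[OF A] show False by simp
  qed
  then have "AE x in lborel. \<forall>n::nat. x \<in> ball 0 (real n) \<longrightarrow> f x \<le> g x"
    unfolding AE_all_countable by (rule allI)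
  then show ?thesis
  proof eventually_elim
    case (elim x)
    obtain n :: nat where "norm x < real n" using reals_Archimedean2 by blast
    then show ?case using elim by (auto dest: spec[of _ n])
  qed
qed

text \<open>
  \<open>\<Phi>\<close> is the Radon-Nikodym derivative of the image under \<open>fold5\<close> of the measure with density \<open>\<phi>\<close>. It is locally
  bounded because \<open>\<phi> \<le> B\<close> and \<open>fold_weight\<close> is locally bounded.
\<close>

lemma fold5_test_function:
  fixes \<phi> :: "real^5 \<Rightarrow> real"
  assumes \<phi>[measurable]: "\<phi> \<in> borel_measurable borel" and b: "\<And>y. 0 \<le> \<phi> y" "\<And>y. \<phi> y \<le> B"
  obtains \<Phi> :: "real^3 \<Rightarrow> real" where "\<Phi> \<in> borel_measurable borel" "\<And>x. 0 \<le> \<Phi> x"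
    "\<And>x R. norm x \<le> R \<Longrightarrow> \<Phi> x \<le> B * (4 * pi * R\<^sup>2)"
    "\<And>f. f \<in> borel_measurable lebesgue \<Longrightarrow>
      (\<integral>\<^sup>+y. ennreal (f (fold5 y)) * ennreal (\<phi> y) \<partial>lebesgue) = (\<integral>\<^sup>+x. ennreal (f x) * ennreal (\<Phi> x) \<partial>lebesgue)"
proof -
  have B: "B \<ge> 0" using b[of 0] by simp
  define \<nu> where "\<nu> = distr (density lborel (\<lambda>y. ennreal (\<phi> y))) borel fold5"
  define g where "g = (\<lambda>x. ennreal B * fold_weight x)"
  have gm[measurable]: "g \<in> borel_measurable borel" unfolding g_def by measurable
  have \<nu>int: "(\<integral>\<^sup>+x. h x \<partial>\<nu>) = (\<integral>\<^sup>+y. ennreal (\<phi> y) * h (fold5 y) \<partial>lborel)"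
    if [measurable]: "h \<in> borel_measurable borel" for h
    unfolding \<nu>_def by (subst nn_integral_distr) (auto simp: nn_integral_density)
  have \<nu>le: "emeasure \<nu> A \<le> (\<integral>\<^sup>+x. g x * indicator A x \<partial>lborel)" if A[measurable]: "A \<in> sets borel" for A
  proof -
    have "emeasure \<nu> A = (\<integral>\<^sup>+x. indicator A x \<partial>\<nu>)" using A by (simp add: \<nu>_def)
    also have "\<dots> = (\<integral>\<^sup>+y. ennreal (\<phi> y) * indicator A (fold5 y) \<partial>lborel)" by (rule \<nu>int) simp
    also have "\<dots> \<le> (\<integral>\<^sup>+y. ennreal B * indicator A (fold5 y) \<partial>lborel)"
      by (intro nn_integral_mono mult_right_mono ennreal_leI b) simp
    also have "\<dots> = (\<integral>\<^sup>+x. fold_weight x * (ennreal B * indicator A x) \<partial>lborel)"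
      by (rule nn_integral_fold5) simp
    finally show ?thesis by (simp add: g_def mult_ac)
  qed
  have ac: "absolutely_continuous lborel \<nu>"
    unfolding absolutely_continuous_def
  proof
    fix N :: "(real^3) set" assume N: "N \<in> null_sets lborel"
    then have [measurable]: "N \<in> sets borel" by auto
    have "emeasure \<nu> N = 0"
      using \<nu>le[of N] nn_integral_null_set[OF N, of g] by simp
    then show "N \<in> null_sets \<nu>" by (intro null_setsI) (auto simp: \<nu>_def)
  qed
  have "sets \<nu> = sets lborel" by (simp add: \<nu>_def)
  have "\<exists>\<Psi>\<in>borel_measurable lborel. density lborel \<Psi> = \<nu>"
    by (rule sigma_finite_measure.Radon_Nikodym[OF sigma_finite_lborel ac \<open>sets \<nu> = sets lborel\<close>])
  then obtain \<Psi> where "\<Psi> \<in> borel_measurable lborel" and \<Psi>d: "density lborel \<Psi> = \<nu>" ..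
  then have \<Psi>m[measurable]: "\<Psi> \<in> borel_measurable borel" by simp
  have ae: "AE x in lborel. \<Psi> x \<le> g x"
  proof (rule AE_le_of_nn_integral_le[OF \<Psi>m gm])
    fix n :: nat
    have "(\<integral>\<^sup>+x. g x * indicator (ball 0 (real n)) x \<partial>lborel) \<le>
        (\<integral>\<^sup>+x. ennreal B * ennreal (4 * pi * (real n)\<^sup>2) * indicator (ball (0::real^3) (real n)) x \<partial>lborel)"
    proof (rule nn_integral_mono)
      fix x :: "real^3"
      show "g x * indicator (ball 0 (real n)) x \<le> ennreal B * ennreal (4 * pi * (real n)\<^sup>2) * indicator (ball 0 (real n)) x"
        using fold_weight_le[of x "real n"] unfolding g_def
        by (cases "x \<in> ball 0 (real n)") (auto intro!: mult_left_mono)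
    qed
    also have "\<dots> < \<infinity>"
      using emeasure_lborel_ball_finite[of "0::real^3" "real n"]
      by (subst nn_integral_cmult) (auto simp: ennreal_mult_less_top intro!: borel_measurable_indicator)
    finally show "(\<integral>\<^sup>+x. g x * indicator (ball 0 (real n)) x \<partial>lborel) < \<infinity>" .
  next
    fix A :: "(real^3) set" assume A[measurable]: "A \<in> sets borel"
    have "(\<integral>\<^sup>+x. \<Psi> x * indicator A x \<partial>lborel) = emeasure \<nu> A"
      unfolding \<Psi>d[symmetric] by (simp add: emeasure_density)
    then show "(\<integral>\<^sup>+x. \<Psi> x * indicator A x \<partial>lborel) \<le> (\<integral>\<^sup>+x. g x * indicator A x \<partial>lborel)"
      using \<nu>le[OF A] by simp
  qed
  define \<Phi> where "\<Phi> = (\<lambda>x. enn2real (min (\<Psi> x) (g x)))"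
  have gfin: "g x < top" for x
    unfolding g_def fold_weight_def by (auto simp: ennreal_mult_less_top split: split_indicator)
  have \<Phi>e: "ennreal (\<Phi> x) = min (\<Psi> x) (g x)" for x
    unfolding \<Phi>_def using gfin[of x] by (simp add: min_less_iff_disj)
  have ae\<Phi>: "AE x in lborel. ennreal (\<Phi> x) = \<Psi> x"
    using ae by eventually_elim (simp add: \<Phi>e min_def)
  show thesis
  proof (rule that)
    show "\<Phi> \<in> borel_measurable borel" unfolding \<Phi>_def by measurable
    show "0 \<le> \<Phi> x" for x by (simp add: \<Phi>_def)
    show "\<Phi> x \<le> B * (4 * pi * R\<^sup>2)" if "norm x \<le> R" for x R
    proof -
      have "ennreal (\<Phi> x) \<le> g x" by (simp add: \<Phi>e)
      also have "\<dots> \<le> ennreal B * ennreal (4 * pi * R\<^sup>2)"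
        unfolding g_def using fold_weight_le[OF that] by (rule mult_left_mono) simp
      also have "\<dots> = ennreal (B * (4 * pi * R\<^sup>2))" using B by (simp add: ennreal_mult)
      finally show ?thesis using B by (subst (asm) ennreal_le_iff) auto
    qed
    fix f :: "real^3 \<Rightarrow> real" assume f: "f \<in> borel_measurable lebesgue"
    obtain f' where f': "f' \<in> borel_measurable lborel" and ff: "AE x in lborel. f x = f' x"
      using completion_ex_borel_measurable_real[OF f] by blast
    have [measurable]: "f' \<in> borel_measurable borel" using f' by simp
    have "AE y in lebesgue. f (fold5 y) = f' (fold5 y)"
      by (rule AE_fold5) (rule AE_completion[OF ff])
    then have "(\<integral>\<^sup>+y. ennreal (f (fold5 y)) * ennreal (\<phi> y) \<partial>lebesgue) =
       (\<integral>\<^sup>+y. ennreal (f' (fold5 y)) * ennreal (\<phi> y) \<partial>lebesgue)"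
      by (intro nn_integral_cong_AE) auto
    also have "\<dots> = (\<integral>\<^sup>+y. ennreal (\<phi> y) * ennreal (f' (fold5 y)) \<partial>lborel)"
      by (simp add: nn_integral_completion mult.commute)
    also have "\<dots> = (\<integral>\<^sup>+x. ennreal (f' x) \<partial>\<nu>)" by (rule \<nu>int[symmetric]) measurable
    also have "\<dots> = (\<integral>\<^sup>+x. \<Psi> x * ennreal (f' x) \<partial>lborel)"
      unfolding \<Psi>d[symmetric] by (rule nn_integral_density) auto
    also have "\<dots> = (\<integral>\<^sup>+x. ennreal (f x) * ennreal (\<Phi> x) \<partial>lborel)"
      using ff ae\<Phi> by (intro nn_integral_cong_AE) (auto simp: mult.commute)
    finally show "(\<integral>\<^sup>+y. ennreal (f (fold5 y)) * ennreal (\<phi> y) \<partial>lebesgue) = (\<integral>\<^sup>+x. ennreal (f x) * ennreal (\<Phi> x) \<partial>lebesgue)"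
      by (simp add: nn_integral_completion)
  qed
qed

lemma fold5_weak_convergence_nonneg:
  fixes \<sigma> :: "nat \<Rightarrow> real^3 \<Rightarrow> real" and \<phi> :: "real^5 \<Rightarrow> real"
  assumes \<sigma>: "\<And>i. \<sigma> i \<in> borel_measurable lebesgue" and nn: "\<And>i. AE x in lebesgue. 0 \<le> \<sigma> i x"
    and supp: "\<And>i x. R \<le> norm x \<Longrightarrow> \<sigma> i x = 0"
    and \<tau>: "\<tau> \<in> borel_measurable lebesgue" and nn': "AE x in lebesgue. 0 \<le> \<tau> x"
    and supp': "\<And>x. R \<le> norm x \<Longrightarrow> \<tau> x = 0"
    and weak: "\<And>\<phi> B. \<phi> \<in> borel_measurable borel \<Longrightarrow> (\<And>x. \<bar>\<phi> x\<bar> \<le> B) \<Longrightarrow>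
       (\<lambda>i. LINT x|lebesgue. \<sigma> i x * \<phi> x) \<longlonglongrightarrow> (LINT x|lebesgue. \<tau> x * \<phi> x)"
    and \<phi>: "\<phi> \<in> borel_measurable borel" and b: "\<And>y. 0 \<le> \<phi> y" "\<And>y. \<phi> y \<le> B"
  shows "(\<lambda>i. LINT y|lebesgue. \<sigma> i (fold5 y) * \<phi> y) \<longlonglongrightarrow> (LINT y|lebesgue. \<tau> (fold5 y) * \<phi> y)"
proof -
  obtain \<Phi> where \<Phi>[measurable]: "\<Phi> \<in> borel_measurable borel" and \<Phi>0: "\<And>x. 0 \<le> \<Phi> x"
    and \<Phi>b: "\<And>x R. norm x \<le> R \<Longrightarrow> \<Phi> x \<le> B * (4 * pi * R\<^sup>2)"
    and eq: "\<And>f. f \<in> borel_measurable lebesgue \<Longrightarrow>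
      (\<integral>\<^sup>+y. ennreal (f (fold5 y)) * ennreal (\<phi> y) \<partial>lebesgue) = (\<integral>\<^sup>+x. ennreal (f x) * ennreal (\<Phi> x) \<partial>lebesgue)"
    by (rule fold5_test_function[OF \<phi> b]) (rule that, blast+)
  define \<Phi>' where "\<Phi>' = (\<lambda>x. \<Phi> x * indicator (ball 0 R) x)"
  have [measurable]: "ball (0::real^3) R \<in> sets borel" by simp
  have \<Phi>'m: "\<Phi>' \<in> borel_measurable borel" unfolding \<Phi>'_def by measurable
  have B: "B \<ge> 0" using b[of 0] by simp
  have \<Phi>'b: "\<bar>\<Phi>' x\<bar> \<le> B * (4 * pi * R\<^sup>2)" for x
    using \<Phi>b[of x R] \<Phi>0[of x] B by (auto simp: \<Phi>'_def split: split_indicator)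
  have \<Phi>'0: "\<Phi>' x \<ge> 0" for x using \<Phi>0[of x] by (simp add: \<Phi>'_def)
  have key: "(LINT y|lebesgue. f (fold5 y) * \<phi> y) = (LINT x|lebesgue. f x * \<Phi>' x)"
    if f: "f \<in> borel_measurable lebesgue" and fn: "AE x in lebesgue. 0 \<le> f x"
      and fs: "\<And>x. R \<le> norm x \<Longrightarrow> f x = 0" for f
  proof -
    note [measurable] = f measurable_fold5_comp[OF f] borel_imp_lebesgue_measurable[OF \<phi>]
      borel_imp_lebesgue_measurable[OF \<Phi>'m]
    have fn5: "AE y in lebesgue. 0 \<le> f (fold5 y)" using fn by (rule AE_fold5)
    have "(LINT y|lebesgue. f (fold5 y) * \<phi> y) = enn2real (\<integral>\<^sup>+y. ennreal (f (fold5 y) * \<phi> y) \<partial>lebesgue)"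
      using fn5 b by (intro integral_eq_nn_integral) auto
    also have "(\<integral>\<^sup>+y. ennreal (f (fold5 y) * \<phi> y) \<partial>lebesgue) = (\<integral>\<^sup>+y. ennreal (f (fold5 y)) * ennreal (\<phi> y) \<partial>lebesgue)"
      using fn5 b by (intro nn_integral_cong_AE) (auto simp: ennreal_mult)
    also have "\<dots> = (\<integral>\<^sup>+x. ennreal (f x) * ennreal (\<Phi> x) \<partial>lebesgue)" by (rule eq[OF f])
    also have "\<dots> = (\<integral>\<^sup>+x. ennreal (f x * \<Phi>' x) \<partial>lebesgue)"
    proof (rule nn_integral_cong_AE, use fn in eventually_elim)
      fix x assume "0 \<le> f x"
      then show "ennreal (f x) * ennreal (\<Phi> x) = ennreal (f x * \<Phi>' x)"
        using fs[of x] \<Phi>0[of x] by (cases "norm x < R") (auto simp: \<Phi>'_def ennreal_mult)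
    qed
    also have "enn2real \<dots> = (LINT x|lebesgue. f x * \<Phi>' x)"
      using fn \<Phi>'0 by (intro integral_eq_nn_integral[symmetric]) auto
    finally show ?thesis .
  qed
  have k1: "(LINT y|lebesgue. \<sigma> i (fold5 y) * \<phi> y) = (LINT x|lebesgue. \<sigma> i x * \<Phi>' x)" for i
    by (rule key[OF \<sigma> nn supp])
  have k2: "(LINT y|lebesgue. \<tau> (fold5 y) * \<phi> y) = (LINT x|lebesgue. \<tau> x * \<Phi>' x)"
    by (rule key[OF \<tau> nn' supp'])
  show ?thesis unfolding k1 k2 by (rule weak[OF \<Phi>'m \<Phi>'b])
qed

lemma fold5_weak_convergence:
  fixes \<sigma> :: "nat \<Rightarrow> real^3 \<Rightarrow> real" and \<phi> :: "real^5 \<Rightarrow> real"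
  assumes \<sigma>: "\<And>i. integrable lebesgue (\<sigma> i)" and nn: "\<And>i. AE x in lebesgue. 0 \<le> \<sigma> i x"
    and supp: "\<And>i x. R \<le> norm x \<Longrightarrow> \<sigma> i x = 0"
    and \<tau>: "integrable lebesgue \<tau>" and nn': "AE x in lebesgue. 0 \<le> \<tau> x"
    and supp': "\<And>x. R \<le> norm x \<Longrightarrow> \<tau> x = 0"
    and weak: "\<And>\<phi> B. \<phi> \<in> borel_measurable borel \<Longrightarrow> (\<And>x. \<bar>\<phi> x\<bar> \<le> B) \<Longrightarrow>
       (\<lambda>i. LINT x|lebesgue. \<sigma> i x * \<phi> x) \<longlonglongrightarrow> (LINT x|lebesgue. \<tau> x * \<phi> x)"
    and \<phi>: "\<phi> \<in> borel_measurable borel" and b: "\<And>y. \<bar>\<phi> y\<bar> \<le> B"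
  shows "(\<lambda>i. LINT y|lebesgue. \<sigma> i (fold5 y) * \<phi> y) \<longlonglongrightarrow> (LINT y|lebesgue. \<tau> (fold5 y) * \<phi> y)"
proof -
  define p where "p = (\<lambda>y. max (\<phi> y) 0)"
  define q where "q = (\<lambda>y. max (- \<phi> y) 0)"
  note [measurable] = \<phi>
  have pm: "p \<in> borel_measurable borel" and qm: "q \<in> borel_measurable borel" unfolding p_def q_def by measurable
  have B: "B \<ge> 0" using b[of 0] by simp
  have pb: "0 \<le> p y" "p y \<le> B" and qb: "0 \<le> q y" "q y \<le> B" for y
    using b[of y] B by (auto simp: p_def q_def)
  have mm: "f \<in> borel_measurable lebesgue" if "integrable lebesgue f" for f :: "real^3 \<Rightarrow> real" using that by simp
  have P: "(\<lambda>i. LINT y|lebesgue. \<sigma> i (fold5 y) * p y) \<longlonglongrightarrow> (LINT y|lebesgue. \<tau> (fold5 y) * p y)"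
    by (rule fold5_weak_convergence_nonneg[OF mm[OF \<sigma>] nn supp mm[OF \<tau>] nn' supp' weak pm pb])
  have Q: "(\<lambda>i. LINT y|lebesgue. \<sigma> i (fold5 y) * q y) \<longlonglongrightarrow> (LINT y|lebesgue. \<tau> (fold5 y) * q y)"
    by (rule fold5_weak_convergence_nonneg[OF mm[OF \<sigma>] nn supp mm[OF \<tau>] nn' supp' weak qm qb])
  have split: "(LINT y|lebesgue. f (fold5 y) * \<phi> y) = (LINT y|lebesgue. f (fold5 y) * p y) - (LINT y|lebesgue. f (fold5 y) * q y)"
    if "integrable lebesgue f" "AE x in lebesgue. 0 \<le> f x" "\<And>x. R \<le> norm x \<Longrightarrow> f x = 0" for f
  proof -
    have i5: "integrable lebesgue (\<lambda>y. f (fold5 y))" by (rule fold5_integral_le(1)[OF that order_refl])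
    have "integrable lebesgue (\<lambda>y. f (fold5 y) * p y)" "integrable lebesgue (\<lambda>y. f (fold5 y) * q y)"
      using pb qb by (auto intro!: integrable_mult_bounded_borel[OF i5, of _ B] borel_imp_lebesgue_measurable pm qm)
    then have "(LINT y|lebesgue. f (fold5 y) * p y) - (LINT y|lebesgue. f (fold5 y) * q y) =
      (LINT y|lebesgue. f (fold5 y) * p y - f (fold5 y) * q y)" by simp
    also have "\<dots> = (LINT y|lebesgue. f (fold5 y) * \<phi> y)"
      by (intro Bochner_Integration.integral_cong) (auto simp: p_def q_def max_def)
    finally show ?thesis by simp
  qed
  have s1: "(LINT y|lebesgue. \<sigma> i (fold5 y) * \<phi> y) =
      (LINT y|lebesgue. \<sigma> i (fold5 y) * p y) - (LINT y|lebesgue. \<sigma> i (fold5 y) * q y)" for i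
    by (rule split[OF \<sigma> nn supp])
  have s2: "(LINT y|lebesgue. \<tau> (fold5 y) * \<phi> y) =
      (LINT y|lebesgue. \<tau> (fold5 y) * p y) - (LINT y|lebesgue. \<tau> (fold5 y) * q y)"
    by (rule split[OF \<tau> nn' supp'])
  show ?thesis unfolding s1 s2 by (rule tendsto_diff[OF P Q])
qed

section \<open>Weak sequential compactness\<close>

locale bounded_Lp_sequence =
  fixes \<sigma> :: "nat \<Rightarrow> 'a::euclidean_space \<Rightarrow> real" and \<gamma> R m P :: real
  assumes \<gamma>: "\<gamma> > 1"
    and int: "\<And>i. integrable lebesgue (\<sigma> i)" and nn: "\<And>i. AE x in lebesgue. 0 \<le> \<sigma> i x"
    and supp: "\<And>i x. R \<le> norm x \<Longrightarrow> \<sigma> i x = 0"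
    and mass: "\<And>i. (LINT x|lebesgue. \<sigma> i x) = m"
    and pint: "\<And>i. integrable lebesgue (\<lambda>x. \<sigma> i x powr \<gamma>)"
    and pbd: "\<And>i. (LINT x|lebesgue. \<sigma> i x powr \<gamma>) \<le> P"
begin

lemma integrable_times:
  assumes "\<phi> \<in> borel_measurable lebesgue" "\<And>x. \<bar>\<phi> x\<bar> \<le> B"
  shows "integrable lebesgue (\<lambda>x. \<sigma> i x * \<phi> x)"
  by (rule integrable_mult_bounded_borel[OF int assms])

text \<open>
  If the convergence were not uniform in \<open>i\<close>, indices violating it could be chosen along which
  \<open>uniform_small_pairing\<close> would be contradicted.
\<close>

lemma uniform_convergence:
  assumes f: "\<And>n. f n \<in> borel_measurable lebesgue" "f' \<in> borel_measurable lebesgue"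
    and b: "\<And>n x. \<bar>f n x\<bar> \<le> B" "\<And>x. \<bar>f' x\<bar> \<le> B"
    and lim: "\<And>x. (\<lambda>n. f n x) \<longlonglongrightarrow> f' x" and \<epsilon>: "\<epsilon> > 0"
  obtains N where "\<And>n i. n \<ge> N \<Longrightarrow> \<bar>(LINT x|lebesgue. \<sigma> i x * f n x) - (LINT x|lebesgue. \<sigma> i x * f' x)\<bar> < \<epsilon>"
proof -
  have diff: "\<bar>(LINT x|lebesgue. \<sigma> i x * f n x) - (LINT x|lebesgue. \<sigma> i x * f' x)\<bar> \<le>
      (LINT x|lebesgue. \<sigma> i x * \<bar>f n x - f' x\<bar>)" for i n
  proof -
    note i1 = integrable_times[OF f(1) b(1), of i n] and i2 = integrable_times[OF f(2) b(2), of i]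
    have "(LINT x|lebesgue. \<sigma> i x * f n x) - (LINT x|lebesgue. \<sigma> i x * f' x) =
        (LINT x|lebesgue. \<sigma> i x * f n x - \<sigma> i x * f' x)" using i1 i2 by simp
    also have "\<bar>\<dots>\<bar> \<le> (LINT x|lebesgue. \<bar>\<sigma> i x * f n x - \<sigma> i x * f' x\<bar>)" by (rule integral_abs_bound)
    also have "\<dots> = (LINT x|lebesgue. \<sigma> i x * \<bar>f n x - f' x\<bar>)"
    proof (rule integral_cong_AE)
      note [measurable] = f borel_measurable_integrable[OF int[of i]]
      show "(\<lambda>x. \<bar>\<sigma> i x * f n x - \<sigma> i x * f' x\<bar>) \<in> borel_measurable lebesgue" by measurable
      show "(\<lambda>x. \<sigma> i x * \<bar>f n x - f' x\<bar>) \<in> borel_measurable lebesgue" by measurable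
      show "AE x in lebesgue. \<bar>\<sigma> i x * f n x - \<sigma> i x * f' x\<bar> = \<sigma> i x * \<bar>f n x - f' x\<bar>"
        using nn[of i] by eventually_elim (simp add: abs_mult flip: right_diff_distrib)
    qed
    finally show ?thesis .
  qed
  have "\<exists>N. \<forall>n\<ge>N. \<forall>i. (LINT x|lebesgue. \<sigma> i x * \<bar>f n x - f' x\<bar>) < \<epsilon>"
  proof (rule ccontr)
    assume "\<not> ?thesis"
    then have "\<forall>N. \<exists>n i. n \<ge> N \<and> (LINT x|lebesgue. \<sigma> i x * \<bar>f n x - f' x\<bar>) \<ge> \<epsilon>"
      by (simp add: not_less)
    then obtain n i where ni: "\<And>N. n N \<ge> N" "\<And>N. (LINT x|lebesgue. \<sigma> (i N) x * \<bar>f (n N) x - f' x\<bar>) \<ge> \<epsilon>"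
      by metis
    have fl: "filterlim n sequentially sequentially"
      by (rule filterlim_at_top_mono[OF filterlim_ident]) (use ni(1) in auto)
    have "(\<lambda>N. LINT x|lebesgue. \<sigma> (i N) x * \<bar>f (n N) x - f' x\<bar>) \<longlonglongrightarrow> 0"
    proof (rule uniform_small_pairing[where \<sigma>="\<lambda>N. \<sigma> (i N)" and D="\<lambda>N x. \<bar>f (n N) x - f' x\<bar>" and B="2 * B", OF \<gamma> int nn supp pint pbd])
      note [measurable] = f
      show "(\<lambda>x. \<bar>f (n N) x - f' x\<bar>) \<in> borel_measurable lebesgue" for N by measurable
      show "\<bar>f (n N) x - f' x\<bar> \<le> 2 * B" for N x using b(1)[of "n N" x] b(2)[of x] by linarith
      show "(\<lambda>N. \<bar>f (n N) x - f' x\<bar>) \<longlonglongrightarrow> 0" for x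
        using tendsto_rabs[OF tendsto_diff[OF filterlim_compose[OF lim[of x] fl] tendsto_const[of "f' x"]]] by simp
    qed auto
    from LIMSEQ_le_const[OF this, of \<epsilon>] ni(2) \<epsilon> show False by (auto simp: not_le)
  qed
  then obtain N where "\<forall>n\<ge>N. \<forall>i. (LINT x|lebesgue. \<sigma> i x * \<bar>f n x - f' x\<bar>) < \<epsilon>" ..
  then show thesis using diff by (intro that[of N]) (meson le_less_trans)
qed

text \<open>
  The uniformity from \<open>uniform_convergence\<close> allows the limits in \<open>n\<close> and \<open>i\<close> to be exchanged.
\<close>

lemma interchange_limits:
  assumes f: "\<And>n. f n \<in> borel_measurable lebesgue" "f' \<in> borel_measurable lebesgue"
    and b: "\<And>n x. \<bar>f n x\<bar> \<le> B" "\<And>x. \<bar>f' x\<bar> \<le> B"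
    and lim: "\<And>x. (\<lambda>n. f n x) \<longlonglongrightarrow> f' x"
    and \<Lambda>: "\<And>n. (\<lambda>i. LINT x|lebesgue. \<sigma> i x * f n x) \<longlonglongrightarrow> \<Lambda> n"
  obtains l where "\<Lambda> \<longlonglongrightarrow> l" "(\<lambda>i. LINT x|lebesgue. \<sigma> i x * f' x) \<longlonglongrightarrow> l"
proof -
  define I where "I = (\<lambda>n i. LINT x|lebesgue. \<sigma> i x * f n x)"
  define J where "J = (\<lambda>i. LINT x|lebesgue. \<sigma> i x * f' x)"
  have unif: "\<exists>N. \<forall>n\<ge>N. \<forall>i. \<bar>I n i - J i\<bar> < \<epsilon>" if "\<epsilon> > 0" for \<epsilon>
    using uniform_convergence[OF f b lim that] unfolding I_def J_def by metis
  have I: "I n \<longlonglongrightarrow> \<Lambda> n" for n using \<Lambda> by (simp add: I_def)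
  have "Cauchy J"
  proof (rule CauchyI)
    fix e :: real assume e: "e > 0"
    then obtain n where n: "\<And>i. \<bar>I n i - J i\<bar> < e / 3" using unif[of "e / 3"] by auto
    have "Cauchy (I n)" using I by (rule LIMSEQ_imp_Cauchy)
    then obtain K where K: "\<And>i j. i \<ge> K \<Longrightarrow> j \<ge> K \<Longrightarrow> norm (I n i - I n j) < e / 3"
      using e CauchyD[of "I n" "e / 3"] by auto
    show "\<exists>K. \<forall>i\<ge>K. \<forall>j\<ge>K. norm (J i - J j) < e"
    proof (intro exI[of _ K] allI impI)
      fix i j assume "i \<ge> K" "j \<ge> K"
      then show "norm (J i - J j) < e"
        using K[of i j] n[of i] n[of j] unfolding real_norm_def by linarith
    qed
  qed
  then obtain l where l: "J \<longlonglongrightarrow> l" using Cauchy_convergent convergent_def by blast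
  have "\<Lambda> \<longlonglongrightarrow> l"
  proof (rule LIMSEQ_I)
    fix e :: real assume e: "e > 0"
    then obtain N where N: "\<And>n i. n \<ge> N \<Longrightarrow> \<bar>I n i - J i\<bar> < e / 2" using unif[of "e / 2"] by auto
    have "\<bar>\<Lambda> n - l\<bar> \<le> e / 2" if "n \<ge> N" for n
    proof (rule LIMSEQ_le_const2)
      show "(\<lambda>i. \<bar>I n i - J i\<bar>) \<longlonglongrightarrow> \<bar>\<Lambda> n - l\<bar>" by (intro tendsto_intros I l)
      show "\<exists>N. \<forall>i\<ge>N. \<bar>I n i - J i\<bar> \<le> e / 2" using N[OF that] by (auto intro: less_imp_le)
    qed
    then have "\<forall>n\<ge>N. norm (\<Lambda> n - l) < e" using e by fastforce
    then show "\<exists>N. \<forall>n\<ge>N. norm (\<Lambda> n - l) < e" ..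
  qed
  then show thesis using l by (intro that) (auto simp: J_def)
qed

lemma integrable_times_indicator:
  "A \<in> sets borel \<Longrightarrow> integrable lebesgue (\<lambda>x. \<sigma> i x * indicator A x)"
  by (rule integrable_times[of _ 1])
    (auto intro!: borel_imp_lebesgue_measurable borel_measurable_indicator simp: indicator_def)

lemma disjoint_union_limit:
  assumes A: "\<And>n. A n \<in> sets borel" and disj: "disjoint_family A"
    and \<mu>: "\<And>n. (\<lambda>i. LINT x|lebesgue. \<sigma> i x * indicator (A n) x) \<longlonglongrightarrow> \<mu> n"
  obtains l where "\<mu> sums l" "(\<lambda>i. LINT x|lebesgue. \<sigma> i x * indicator (\<Union>n. A n) x) \<longlonglongrightarrow> l"
proof -
  define f where "f = (\<lambda>n x. indicator (\<Union>i<n. A i) x :: real)"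
  have f: "f n \<in> borel_measurable lebesgue" for n
    unfolding f_def using A by (intro borel_imp_lebesgue_measurable borel_measurable_indicator) auto
  have f': "(indicator (\<Union>i. A i) :: 'a \<Rightarrow> real) \<in> borel_measurable lebesgue"
    using A by (intro borel_imp_lebesgue_measurable borel_measurable_indicator) auto
  have fsum: "f n x = (\<Sum>i<n. indicator (A i) x)" for n x
    unfolding f_def using disj
    by (intro indicator_UN_disjoint) (auto simp: disjoint_family_on_def)
  have L: "(\<lambda>i. LINT x|lebesgue. \<sigma> i x * f n x) \<longlonglongrightarrow> (\<Sum>j<n. \<mu> j)" for n
  proof -
    have "(LINT x|lebesgue. \<sigma> i x * f n x) = (\<Sum>j<n. LINT x|lebesgue. \<sigma> i x * indicator (A j) x)" for i
      unfolding fsum sum_distrib_left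
      by (rule Bochner_Integration.integral_sum) (rule integrable_times_indicator[OF A])
    then show ?thesis using \<mu> by (auto intro!: tendsto_sum)
  qed
  have "(\<lambda>n. f n x) \<longlonglongrightarrow> indicator (\<Union>i. A i) x" for x
    unfolding f_def by (rule LIMSEQ_indicator_UN)
  from interchange_limits[OF f f' _ _ this L, of 1] show thesis
    using that by (auto simp: f_def indicator_def sums_def)
qed

text \<open>
  The sets on which the masses converge form a Dynkin class: complements are covered by the constant total mass and
  disjoint unions by \<open>disjoint_union_limit\<close>. Hence a countable generator suffices.
\<close>

lemma converges_on_borel_sets:
  assumes G: "Int_stable G" "sigma_sets UNIV G = sets borel"
    and conv: "\<And>A. A \<in> G \<Longrightarrow> convergent (\<lambda>i. LINT x|lebesgue. \<sigma> i x * indicator A x)"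
    and A: "A \<in> sets borel"
  shows "convergent (\<lambda>i. LINT x|lebesgue. \<sigma> i x * indicator A x)"
proof -
  have "G \<subseteq> Pow UNIV" by simp
  moreover have "A \<in> sigma_sets UNIV G" using A G by simp
  ultimately show ?thesis
  proof (induction rule: sigma_sets_induct_disjoint[OF G(1), consumes 2, case_names basic empty compl union])
    case (basic A)
    then show ?case by (rule conv)
  next
    case empty
    then show ?case by (simp add: convergent_const)
  next
    case (compl A)
    then have A: "A \<in> sets borel" using G by simp
    have "(LINT x|lebesgue. \<sigma> i x * indicator (UNIV - A) x) = m - (LINT x|lebesgue. \<sigma> i x * indicator A x)" for i
    proof -
      have "(LINT x|lebesgue. \<sigma> i x * indicator (UNIV - A) x) = (LINT x|lebesgue. \<sigma> i x - \<sigma> i x * indicator A x)"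
        by (intro Bochner_Integration.integral_cong) (auto simp: indicator_def)
      then show ?thesis using integrable_times_indicator[OF A] int mass by simp
    qed
    then show ?case using compl by (auto intro!: convergent_diff convergent_const)
  next
    case (union A)
    have A: "A n \<in> sets borel" for n using union(2) G by auto
    have "(\<lambda>i. LINT x|lebesgue. \<sigma> i x * indicator (A n) x) \<longlonglongrightarrow> lim (\<lambda>i. LINT x|lebesgue. \<sigma> i x * indicator (A n) x)" for n
      using union(3) by (simp add: convergent_LIMSEQ_iff)
    from disjoint_union_limit[OF A union(1) this] show ?case by (auto simp: convergent_def)
  qed
qed

text \<open>
  The limits of the masses form a measure, countably additive by \<open>disjoint_union_limit\<close>, that vanishes on null sets;
  \<open>u\<close> is its density.
\<close>

lemma limit_density:
  assumes conv: "\<And>A. A \<in> sets borel \<Longrightarrow> convergent (\<lambda>i. LINT x|lebesgue. \<sigma> i x * indicator A x)"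
  obtains u where "u \<in> borel_measurable borel" "\<And>x. 0 \<le> u x" "integrable lebesgue u"
    "\<And>A. A \<in> sets borel \<Longrightarrow> (\<lambda>i. LINT x|lebesgue. \<sigma> i x * indicator A x) \<longlonglongrightarrow> (LINT x|lebesgue. u x * indicator A x)"
proof -
  define \<mu> where "\<mu> = (\<lambda>A. lim (\<lambda>i. LINT x|lebesgue. \<sigma> i x * indicator A x))"
  have \<mu>: "(\<lambda>i. LINT x|lebesgue. \<sigma> i x * indicator A x) \<longlonglongrightarrow> \<mu> A" if "A \<in> sets borel" for A
    unfolding \<mu>_def using conv[OF that] by (simp add: convergent_LIMSEQ_iff)
  have \<mu>0: "\<mu> A \<ge> 0" if "A \<in> sets borel" for A
  proof (rule LIMSEQ_le_const[OF \<mu>[OF that]], intro exI[of _ 0] allI impI)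
    fix i show "0 \<le> (LINT x|lebesgue. \<sigma> i x * indicator A x)"
      using nn[of i] by (intro integral_nonneg_AE) auto
  qed
  have \<mu>UNIV: "\<mu> UNIV = m" unfolding \<mu>_def using mass by simp
  have \<mu>empty: "\<mu> {} = 0" unfolding \<mu>_def by simp
  have sums: "(\<lambda>n. \<mu> (A n)) sums \<mu> (\<Union>n. A n)"
    if A: "\<And>n. A n \<in> sets borel" and disj: "disjoint_family A" for A
  proof -
    obtain l where l: "(\<lambda>n. \<mu> (A n)) sums l" "(\<lambda>i. LINT x|lebesgue. \<sigma> i x * indicator (\<Union>n. A n) x) \<longlonglongrightarrow> l"
      by (rule disjoint_union_limit[OF A disj \<mu>[OF A]])
    have "(\<Union>n. A n) \<in> sets borel" using A by auto
    from LIMSEQ_unique[OF \<mu>[OF this] l(2)] l(1) show ?thesis by simp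
  qed
  define N where "N = measure_of UNIV (sets (borel :: 'a measure)) (\<lambda>A. ennreal (\<mu> A))"
  have setsN: "sets N = sets lborel"
    unfolding N_def using sets.sigma_sets_eq[of "borel :: 'a measure"] by simp
  have emN: "emeasure N A = ennreal (\<mu> A)" if "A \<in> sets borel" for A
    unfolding N_def
  proof (rule emeasure_measure_of_sigma[OF _ _ _ that])
    show "sigma_algebra UNIV (sets (borel :: 'a measure))"
      using sets.sigma_algebra_axioms[of "borel :: 'a measure"] by simp
    show "positive (sets (borel :: 'a measure)) (\<lambda>A. ennreal (\<mu> A))"
      by (simp add: positive_def \<mu>empty)
    show "countably_additive (sets (borel :: 'a measure)) (\<lambda>A. ennreal (\<mu> A))"
    proof (rule countably_additiveI)
      fix A :: "nat \<Rightarrow> 'a set" assume A: "range A \<subseteq> sets borel" "disjoint_family A"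
      then show "(\<Sum>i. ennreal (\<mu> (A i))) = ennreal (\<mu> (\<Union>i. A i))"
        using \<mu>0 sums[of A] by (intro suminf_ennreal_eq) auto
    qed
  qed
  have ac: "absolutely_continuous lborel N"
    unfolding absolutely_continuous_def
  proof
    fix A :: "'a set" assume A: "A \<in> null_sets lborel"
    then have Ab: "A \<in> sets borel" by auto
    have "AE x in lebesgue. x \<notin> A" using AE_not_in[OF A] by (rule AE_completion)
    then have ae: "AE x in lebesgue. \<sigma> i x * indicator A x = 0" for i by eventually_elim simp
    have "(LINT x|lebesgue. \<sigma> i x * indicator A x) = 0" for i
      using ae by (rule integral_eq_zero_AE)
    then have "\<mu> A = 0" unfolding \<mu>_def by simp
    then show "A \<in> null_sets N" using Ab setsN emN[OF Ab] by (intro null_setsI) auto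
  qed
  obtain \<Psi> where "\<Psi> \<in> borel_measurable lborel" and \<Psi>d: "density lborel \<Psi> = N"
    using sigma_finite_measure.Radon_Nikodym[OF sigma_finite_lborel ac setsN] by (elim bexE) (rule that)
  then have \<Psi>[measurable]: "\<Psi> \<in> borel_measurable borel" by simp
  have int\<Psi>: "(\<integral>\<^sup>+x. \<Psi> x * indicator A x \<partial>lborel) = ennreal (\<mu> A)" if "A \<in> sets borel" for A
    using emN[OF that] that unfolding \<Psi>d[symmetric] by (simp add: emeasure_density)
  have fin: "(\<integral>\<^sup>+x. \<Psi> x \<partial>lborel) = ennreal m" using int\<Psi>[of UNIV] \<mu>UNIV by simp
  have "AE x in lborel. \<Psi> x \<noteq> \<infinity>" by (rule nn_integral_PInf_AE) (use fin in auto)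
  define u where "u = (\<lambda>x. enn2real (\<Psi> x))"
  have ae: "AE x in lborel. ennreal (u x) = \<Psi> x"
    using \<open>AE x in lborel. \<Psi> x \<noteq> \<infinity>\<close> by eventually_elim (simp add: u_def less_top)
  have um[measurable]: "u \<in> borel_measurable borel" unfolding u_def by measurable
  have uL: "u \<in> borel_measurable lebesgue" using um by (rule borel_imp_lebesgue_measurable)
  have intu: "(\<integral>\<^sup>+x. ennreal (u x * indicator A x) \<partial>lebesgue) = ennreal (\<mu> A)" if "A \<in> sets borel" for A
  proof -
    have "(\<integral>\<^sup>+x. ennreal (u x * indicator A x) \<partial>lborel) = (\<integral>\<^sup>+x. \<Psi> x * indicator A x \<partial>lborel)"
    proof (rule nn_integral_cong_AE, use ae in eventually_elim)
      fix x assume "ennreal (u x) = \<Psi> x"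
      then show "ennreal (u x * indicator A x) = \<Psi> x * indicator A x" by (cases "x \<in> A") auto
    qed
    then show ?thesis using int\<Psi>[OF that] by (simp add: nn_integral_completion)
  qed
  show thesis
  proof (rule that[OF um])
    show u0: "0 \<le> u x" for x by (simp add: u_def)
    show "integrable lebesgue u"
      using uL u0 intu[of UNIV] by (intro integrableI_nonneg) auto
    fix A :: "'a set" assume A: "A \<in> sets borel"
    have [measurable]: "(indicator A :: 'a \<Rightarrow> real) \<in> borel_measurable lebesgue"
      using A by (intro borel_imp_lebesgue_measurable borel_measurable_indicator) auto
    note [measurable] = uL
    have "(LINT x|lebesgue. u x * indicator A x) = enn2real (\<integral>\<^sup>+x. ennreal (u x * indicator A x) \<partial>lebesgue)"
      using u0 by (intro integral_eq_nn_integral) auto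
    also have "\<dots> = \<mu> A" unfolding intu[OF A] using \<mu>0[OF A] by simp
    finally show "(\<lambda>i. LINT x|lebesgue. \<sigma> i x * indicator A x) \<longlonglongrightarrow> (LINT x|lebesgue. u x * indicator A x)"
      using \<mu>[OF A] by simp
  qed
qed

end

lemma (in bounded_Lp_sequence) bounded_convergence:
  assumes u: "u \<in> borel_measurable borel" "\<And>x. 0 \<le> u x" "integrable lebesgue u"
    and sets: "\<And>A. A \<in> sets borel \<Longrightarrow> (\<lambda>i. LINT x|lebesgue. \<sigma> i x * indicator A x) \<longlonglongrightarrow> (LINT x|lebesgue. u x * indicator A x)"
    and \<phi>: "\<phi> \<in> borel_measurable borel" and b: "\<And>x. \<bar>\<phi> x\<bar> \<le> B"
  shows "(\<lambda>i. LINT x|lebesgue. \<sigma> i x * \<phi> x) \<longlonglongrightarrow> (LINT x|lebesgue. u x * \<phi> x)"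
proof -
  have iu: "integrable lebesgue (\<lambda>x. u x * f x)" if "f \<in> borel_measurable borel" "\<And>x. \<bar>f x\<bar> \<le> K" for f K
    by (rule integrable_mult_bounded_borel[OF u(3) borel_imp_lebesgue_measurable[OF that(1)] that(2)])
  have isg: "integrable lebesgue (\<lambda>x. \<sigma> i x * f x)" if "f \<in> borel_measurable borel" "\<And>x. \<bar>f x\<bar> \<le> K" for f K i
    by (rule integrable_times[OF borel_imp_lebesgue_measurable[OF that(1)] that(2)])
  have nonneg: "\<forall>K. (\<forall>x. f x \<le> K) \<longrightarrow> (\<lambda>i. LINT x|lebesgue. \<sigma> i x * f x) \<longlonglongrightarrow> (LINT x|lebesgue. u x * f x)"
    if "f \<in> borel_measurable borel" "\<And>x. 0 \<le> f x" for f
    using that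
  proof (induction rule: borel_measurable_induct_real)
    case (set A)
    then show ?case using sets by simp
  next
    case (mult f c)
    show ?case
    proof (intro allI impI)
      fix K assume K: "\<forall>x. c * f x \<le> K"
      show "(\<lambda>i. LINT x|lebesgue. \<sigma> i x * (c * f x)) \<longlonglongrightarrow> (LINT x|lebesgue. u x * (c * f x))"
      proof (cases "c = 0")
        case False
        then have "\<forall>x. f x \<le> K / c" using K mult.hyps(1) by (simp add: field_simps)
        then have "(\<lambda>i. LINT x|lebesgue. \<sigma> i x * f x) \<longlonglongrightarrow> (LINT x|lebesgue. u x * f x)" using mult.IH by blast
        from tendsto_mult_left[OF this, of c] show ?thesis by (simp add: mult.left_commute)
      qed simp
    qed
  next
    case (add f g)
    show ?case
    proof (intro allI impI)
      fix K assume K: "\<forall>x. g x + f x \<le> K"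
      have fK: "f x \<le> K" and gK: "g x \<le> K" for x
        using K[rule_format, of x] add.hyps(2)[of x] add.hyps(4)[of x] by linarith+
      have fb: "\<bar>f x\<bar> \<le> K" and gb: "\<bar>g x\<bar> \<le> K" for x
        using fK gK add.hyps(2)[of x] add.hyps(4)[of x] by simp_all
      have "(\<lambda>i. (LINT x|lebesgue. \<sigma> i x * g x) + (LINT x|lebesgue. \<sigma> i x * f x)) \<longlonglongrightarrow>
         (LINT x|lebesgue. u x * g x) + (LINT x|lebesgue. u x * f x)"
        using add.IH fK gK by (intro tendsto_add) blast+
      then show "(\<lambda>i. LINT x|lebesgue. \<sigma> i x * (g x + f x)) \<longlonglongrightarrow> (LINT x|lebesgue. u x * (g x + f x))"
        using iu[OF add.hyps(1) fb] iu[OF add.hyps(3) gb] isg[OF add.hyps(1) fb] isg[OF add.hyps(3) gb]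
        by (simp add: distrib_left)
    qed
  next
    case (seq U)
    show ?case
    proof (intro allI impI)
      fix K assume K: "\<forall>x. f x \<le> K"
      have lim: "(\<lambda>n. U n x) \<longlonglongrightarrow> f x" for x using seq.hyps(4) by simp
      have le: "U n x \<le> f x" for n x
        using seq.hyps(3) by (intro incseq_le[OF _ lim]) (auto simp: incseq_def le_fun_def)
      have UK: "U n x \<le> K" for n x using le[of n x] K by (meson order_trans)
      have Ub: "\<bar>U n x\<bar> \<le> K" for n x using UK[of n x] seq.hyps(2)[of n x] by simp
      have f0: "0 \<le> f x" for x using le[of 0 x] seq.hyps(2)[of 0 x] by simp
      have fb: "\<bar>f x\<bar> \<le> K" for x using K f0 by simp
      have fm: "f \<in> borel_measurable borel" using borel_measurable_LIMSEQ_real[OF lim seq.hyps(1)] by simp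
      have \<Lambda>: "(\<lambda>i. LINT x|lebesgue. \<sigma> i x * U n x) \<longlonglongrightarrow> (LINT x|lebesgue. u x * U n x)" for n
        using seq.IH[of n] UK by blast
      obtain l where l: "(\<lambda>n. LINT x|lebesgue. u x * U n x) \<longlonglongrightarrow> l" "(\<lambda>i. LINT x|lebesgue. \<sigma> i x * f x) \<longlonglongrightarrow> l"
        by (rule interchange_limits[OF borel_imp_lebesgue_measurable[OF seq.hyps(1)] borel_imp_lebesgue_measurable[OF fm] Ub fb lim \<Lambda>])
      have "(\<lambda>n. LINT x|lebesgue. u x * U n x) \<longlonglongrightarrow> (LINT x|lebesgue. u x * f x)"
      proof (rule integral_dominated_convergence[where w="\<lambda>x. K * u x"])
        show "(\<lambda>x. u x * f x) \<in> borel_measurable lebesgue" using iu[OF fm fb] by simp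
        show "(\<lambda>x. u x * U n x) \<in> borel_measurable lebesgue" for n using iu[OF seq.hyps(1) Ub] by simp
        show "integrable lebesgue (\<lambda>x. K * u x)" using u(3) by simp
        show "AE x in lebesgue. (\<lambda>n. u x * U n x) \<longlonglongrightarrow> u x * f x" by (intro AE_I2 tendsto_mult tendsto_const lim)
        show "AE x in lebesgue. norm (u x * U n x) \<le> K * u x" for n
        proof (rule AE_I2)
          fix x show "norm (u x * U n x) \<le> K * u x"
            using mult_left_mono[OF Ub[of n x] u(2)[of x]] u(2)[of x] by (simp add: abs_mult mult.commute)
        qed
      qed
      with l LIMSEQ_unique show "(\<lambda>i. LINT x|lebesgue. \<sigma> i x * f x) \<longlonglongrightarrow> (LINT x|lebesgue. u x * f x)" by blast
    qed
  qed
  have mu: "(LINT x|lebesgue. u x) = m"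
    using sets[of UNIV] mass by (simp add: LIMSEQ_const_iff)
  have B0: "0 \<le> \<phi> x + B" and B1: "\<phi> x + B \<le> B + B" for x using b[of x] by linarith+
  have "(\<lambda>x. \<phi> x + B) \<in> borel_measurable borel" using \<phi> by simp
  from nonneg[OF this B0] have "(\<lambda>i. LINT x|lebesgue. \<sigma> i x * (\<phi> x + B)) \<longlonglongrightarrow> (LINT x|lebesgue. u x * (\<phi> x + B))"
    using B1 by blast
  moreover have "(LINT x|lebesgue. \<sigma> i x * (\<phi> x + B)) = (LINT x|lebesgue. \<sigma> i x * \<phi> x) + m * B" for i
    using isg[OF \<phi> b] int mass by (simp add: distrib_left)
  moreover have "(LINT x|lebesgue. u x * (\<phi> x + B)) = (LINT x|lebesgue. u x * \<phi> x) + m * B"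
    using iu[OF \<phi> b] u(3) mu by (simp add: distrib_left)
  ultimately have "(\<lambda>i. (LINT x|lebesgue. \<sigma> i x * \<phi> x) + m * B) \<longlonglongrightarrow> (LINT x|lebesgue. u x * \<phi> x) + m * B" by simp
  from tendsto_diff[OF this tendsto_const[of "m * B"]] show ?thesis by simp
qed

section \<open>Test functions in the conjugate space\<close>

text \<open>
  The tangent at \<open>b\<close> of the convex function \<open>t powr g\<close> lies below the graph.
\<close>

lemma powr_tangent_le:
  fixes a b g :: real
  assumes "a \<ge> 0" "b \<ge> 0" "g > 1"
  shows "g * (a * b powr (g - 1)) - (g - 1) * b powr g \<le> a powr g"
proof -
  have "a * b powr (g - 1) \<le> a powr g / g + (b powr (g - 1)) powr (g / (g - 1)) / (g / (g - 1))"
    using assms by (intro Youngs_inequality) (auto simp: field_simps)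
  also have "(b powr (g - 1)) powr (g / (g - 1)) = b powr g" using assms by (simp add: powr_powr)
  finally have "g * (a * b powr (g - 1)) \<le> g * (a powr g / g + b powr g / (g / (g - 1)))"
    using assms by (intro mult_left_mono) auto
  also have "\<dots> = a powr g + (g - 1) * b powr g" using assms by (simp add: field_simps)
  finally show ?thesis by simp
qed

text \<open>
  Young's inequality with a small parameter, with a constant obtained by comparing \<open>t\<close> with \<open>\<eta> * s powr (g - 1)\<close>.
\<close>

lemma mult_le_powr_conjugate:
  fixes s t g \<eta> :: real
  assumes "s \<ge> 0" "t \<ge> 0" "g > 1" "\<eta> > 0"
  shows "s * t \<le> \<eta> * s powr g + \<eta> powr (- 1 / (g - 1)) * t powr (g / (g - 1))"
proof (cases "t \<le> \<eta> * s powr (g - 1)")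
  case True
  have "s * s powr (g - 1) = s powr g" using assms powr_add[of s 1 "g - 1"] by (cases "s = 0") auto
  then have "s * t \<le> \<eta> * s powr g"
    using mult_left_mono[OF True assms(1)] by (simp add: mult.left_commute)
  then show ?thesis by (simp add: add_increasing2)
next
  case False
  then have t: "t > 0" "s powr (g - 1) < t / \<eta>"
    using assms by (auto simp: field_simps intro: le_less_trans[of 0 "\<eta> * s powr (g - 1)"])
  have "s = (s powr (g - 1)) powr (1 / (g - 1))" using assms by (simp add: powr_powr)
  also have "\<dots> \<le> (t / \<eta>) powr (1 / (g - 1))" using t assms by (intro powr_mono2) auto
  also have "\<dots> = \<eta> powr (- 1 / (g - 1)) * t powr (1 / (g - 1))"
  proof -
    have "- 1 / (g - 1) = - (1 / (g - 1))" by simp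
    then show ?thesis using t assms by (simp only: powr_divide[of t \<eta>] powr_minus_divide less_imp_le) simp
  qed
  finally have "s * t \<le> \<eta> powr (- 1 / (g - 1)) * t powr (1 / (g - 1)) * t"
    using assms by (intro mult_right_mono)
  also have "\<dots> = \<eta> powr (- 1 / (g - 1)) * (t powr (1 / (g - 1)) * t powr 1)" using t by simp
  also have "t powr (1 / (g - 1)) * t powr 1 = t powr (1 / (g - 1) + 1)" by (rule powr_add[symmetric])
  also have "1 / (g - 1) + 1 = g / (g - 1)" using assms by (simp add: field_simps)
  finally show ?thesis using assms by (simp add: add_increasing)
qed

lemma borel_version_bounded:
  fixes \<phi> :: "'a::euclidean_space \<Rightarrow> real"
  assumes \<phi>: "\<phi> \<in> borel_measurable lebesgue" and b: "\<And>x. \<bar>\<phi> x\<bar> \<le> B"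
  obtains \<phi>' where "\<phi>' \<in> borel_measurable borel" "\<And>x. \<bar>\<phi>' x\<bar> \<le> B" "AE x in lebesgue. \<phi> x = \<phi>' x"
proof -
  have B: "B \<ge> 0" using b[of 0] by simp
  obtain f where f: "f \<in> borel_measurable lborel" "AE x in lborel. \<phi> x = f x"
    using completion_ex_borel_measurable_real[OF \<phi>] by blast
  have [measurable]: "f \<in> borel_measurable borel" using f by simp
  show thesis
  proof (rule that[of "\<lambda>x. max (- B) (min B (f x))"])
    show "(\<lambda>x. max (- B) (min B (f x))) \<in> borel_measurable borel" by measurable
    show "\<bar>max (- B) (min B (f x))\<bar> \<le> B" for x using B by (auto simp: max_def min_def)
    show "AE x in lebesgue. \<phi> x = max (- B) (min B (f x))"
      using AE_completion[OF f(2)]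
    proof eventually_elim
      case (elim x)
      then show ?case using b[of x] by (auto simp: max_def min_def)
    qed
  qed
qed

lemma integrable_times_conjugate:
  fixes \<sigma> \<phi> :: "'a::euclidean_space \<Rightarrow> real"
  assumes \<gamma>: "\<gamma> > 1" and \<sigma>: "\<sigma> \<in> borel_measurable lebesgue" "AE x in lebesgue. 0 \<le> \<sigma> x"
    and p: "integrable lebesgue (\<lambda>x. \<sigma> x powr \<gamma>)"
    and \<phi>: "\<phi> \<in> borel_measurable lebesgue" and q: "integrable lebesgue (\<lambda>x. \<bar>\<phi> x\<bar> powr (\<gamma> / (\<gamma> - 1)))"
  shows "integrable lebesgue (\<lambda>x. \<sigma> x * \<phi> x)"
proof (rule Bochner_Integration.integrable_bound)
  show "integrable lebesgue (\<lambda>x. \<sigma> x powr \<gamma> + \<bar>\<phi> x\<bar> powr (\<gamma> / (\<gamma> - 1)))" using p q by simp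
  show "(\<lambda>x. \<sigma> x * \<phi> x) \<in> borel_measurable lebesgue" using \<sigma>(1) \<phi> by simp
  show "AE x in lebesgue. norm (\<sigma> x * \<phi> x) \<le> norm (\<sigma> x powr \<gamma> + \<bar>\<phi> x\<bar> powr (\<gamma> / (\<gamma> - 1)))"
    using \<sigma>(2)
  proof eventually_elim
    case (elim x)
    then show ?case using mult_le_powr_conjugate[of "\<sigma> x" "\<bar>\<phi> x\<bar>" \<gamma> 1] \<gamma> by (simp add: abs_mult)
  qed
qed

text \<open>
  Bounded test functions suffice: \<open>\<phi>\<close> is cut at height \<open>k\<close>, and \<open>mult_le_powr_conjugate\<close> bounds the
  contribution of the rest uniformly in \<open>i\<close>.
\<close>

lemma weak_convergence_Lp:
  fixes \<sigma> :: "nat \<Rightarrow> 'a::euclidean_space \<Rightarrow> real"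
  assumes \<gamma>: "\<gamma> > 1" and int: "\<And>i. integrable lebesgue (\<sigma> i)" and nn: "\<And>i. AE x in lebesgue. 0 \<le> \<sigma> i x"
    and pint: "\<And>i. integrable lebesgue (\<lambda>x. \<sigma> i x powr \<gamma>)"
    and pbd: "\<And>i. (LINT x|lebesgue. \<sigma> i x powr \<gamma>) \<le> P"
    and u: "integrable lebesgue u" "AE x in lebesgue. 0 \<le> u x"
    and upint: "integrable lebesgue (\<lambda>x. u x powr \<gamma>)" and upbd: "(LINT x|lebesgue. u x powr \<gamma>) \<le> P"
    and weak: "\<And>\<phi> B. \<phi> \<in> borel_measurable borel \<Longrightarrow> (\<And>x. \<bar>\<phi> x\<bar> \<le> B) \<Longrightarrow>
       (\<lambda>i. LINT x|lebesgue. \<sigma> i x * \<phi> x) \<longlonglongrightarrow> (LINT x|lebesgue. u x * \<phi> x)"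
    and \<phi>: "\<phi> \<in> borel_measurable lebesgue" and q: "integrable lebesgue (\<lambda>x. \<bar>\<phi> x\<bar> powr (\<gamma> / (\<gamma> - 1)))"
  shows "(\<lambda>i. LINT x|lebesgue. \<sigma> i x * \<phi> x) \<longlonglongrightarrow> (LINT x|lebesgue. u x * \<phi> x)"
proof -
  define g where "g = \<gamma> / (\<gamma> - 1)"
  define f where "f = (\<lambda>k x. \<phi> x * indicator {x. \<bar>\<phi> x\<bar> \<le> real k} x)"
  define h where "h = (\<lambda>k x. \<bar>\<phi> x\<bar> powr g * indicator {x. \<not> \<bar>\<phi> x\<bar> \<le> real k} x)"
  note [measurable] = \<phi>
  have S[measurable]: "{x. \<bar>\<phi> x\<bar> \<le> real k} \<in> sets lebesgue" "{x. \<not> \<bar>\<phi> x\<bar> \<le> real k} \<in> sets lebesgue" for k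
    using measurable_sets[of "\<lambda>x. \<bar>\<phi> x\<bar>" lebesgue borel "{..real k}"] measurable_sets[of "\<lambda>x. \<bar>\<phi> x\<bar>" lebesgue borel "{real k<..}"]
    by (auto simp: vimage_def not_le)
  have fm: "f k \<in> borel_measurable lebesgue" for k unfolding f_def by measurable
  have fb: "\<bar>f k x\<bar> \<le> real k" for k x by (simp add: f_def indicator_def)
  have P: "P \<ge> 0" by (rule order_trans[OF Bochner_Integration.integral_nonneg pbd[of 0]]) simp
  have fconv: "(\<lambda>i. LINT x|lebesgue. \<sigma> i x * f k x) \<longlonglongrightarrow> (LINT x|lebesgue. u x * f k x)" for k
  proof -
    obtain f' where f': "f' \<in> borel_measurable borel" "\<And>x. \<bar>f' x\<bar> \<le> real k" and ae: "AE x in lebesgue. f k x = f' x"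
      by (rule borel_version_bounded[OF fm[of k] fb[of k]]) (rule that, blast+)
    have eq: "(LINT x|lebesgue. v x * f k x) = (LINT x|lebesgue. v x * f' x)" if "integrable lebesgue v" for v
    proof (rule integral_cong_AE)
      note [measurable] = borel_measurable_integrable[OF that] fm borel_imp_lebesgue_measurable[OF f'(1)]
      show "(\<lambda>x. v x * f k x) \<in> borel_measurable lebesgue" "(\<lambda>x. v x * f' x) \<in> borel_measurable lebesgue" by measurable
      show "AE x in lebesgue. v x * f k x = v x * f' x" using ae by eventually_elim simp
    qed
    show ?thesis unfolding eq[OF int] eq[OF u(1)] by (rule weak[OF f'])
  qed
  have hint: "integrable lebesgue (h k)" for k
    unfolding h_def using q S(2)[of k] by (simp add: g_def integrable_real_mult_indicator)
  have h0: "(\<lambda>k. LINT x|lebesgue. h k x) \<longlonglongrightarrow> (LINT x|(lebesgue :: 'a measure). (0::real))"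
  proof (rule integral_dominated_convergence[where s=h and f="\<lambda>_. 0" and w="\<lambda>x. \<bar>\<phi> x\<bar> powr g"])
    show "integrable lebesgue (\<lambda>x. \<bar>\<phi> x\<bar> powr g)" using q by (simp add: g_def)
    show "h k \<in> borel_measurable lebesgue" for k using hint[of k] by simp
    show "AE x in lebesgue. (\<lambda>k. h k x) \<longlonglongrightarrow> 0"
    proof (rule AE_I2)
      fix x
      obtain K :: nat where "\<bar>\<phi> x\<bar> \<le> real K" using real_arch_simple by blast
      then have "eventually (\<lambda>k. h k x = 0) sequentially"
        unfolding eventually_sequentially by (intro exI[of _ K]) (auto simp: h_def)
      then show "(\<lambda>k. h k x) \<longlonglongrightarrow> 0" by (rule tendsto_eventually)
    qed
    show "AE x in lebesgue. norm (h k x) \<le> \<bar>\<phi> x\<bar> powr g" for k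
      by (intro AE_I2) (simp add: h_def indicator_def)
  qed simp
  have tail: "\<bar>(LINT x|lebesgue. v x * \<phi> x) - (LINT x|lebesgue. v x * f k x)\<bar> \<le> \<eta> * P + \<eta> powr (- 1 / (\<gamma> - 1)) * (LINT x|lebesgue. h k x)"
    if v: "integrable lebesgue v" "AE x in lebesgue. 0 \<le> v x" "integrable lebesgue (\<lambda>x. v x powr \<gamma>)" "(LINT x|lebesgue. v x powr \<gamma>) \<le> P"
      and \<eta>: "\<eta> > 0" for v k \<eta>
  proof -
    have i1: "integrable lebesgue (\<lambda>x. v x * \<phi> x)"
      using v by (intro integrable_times_conjugate[OF \<gamma> _ _ _ \<phi> q]) auto
    have i2: "integrable lebesgue (\<lambda>x. v x * f k x)" by (rule integrable_mult_bounded_borel[OF v(1) fm fb])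
    have "(LINT x|lebesgue. v x * \<phi> x) - (LINT x|lebesgue. v x * f k x) = (LINT x|lebesgue. v x * \<phi> x - v x * f k x)"
      using i1 i2 by simp
    also have "\<bar>\<dots>\<bar> \<le> (LINT x|lebesgue. \<bar>v x * \<phi> x - v x * f k x\<bar>)" by (rule integral_abs_bound)
    also have "\<dots> \<le> (LINT x|lebesgue. \<eta> * v x powr \<gamma> + \<eta> powr (- 1 / (\<gamma> - 1)) * h k x)"
    proof (rule integral_mono_AE)
      show "AE x in lebesgue. \<bar>v x * \<phi> x - v x * f k x\<bar> \<le> \<eta> * v x powr \<gamma> + \<eta> powr (- 1 / (\<gamma> - 1)) * h k x"
        using v(2)
      proof eventually_elim
        case (elim x)
        show ?case
        proof (cases "\<bar>\<phi> x\<bar> \<le> real k")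
          case True
          then show ?thesis using \<eta> by (simp add: f_def h_def)
        next
          case False
          then show ?thesis
            using mult_le_powr_conjugate[OF elim abs_ge_zero[of "\<phi> x"] \<gamma> \<eta>] elim
            by (simp add: f_def h_def g_def abs_mult)
        qed
      qed
    qed (use i1 i2 v(3) hint in auto)
    also have "\<dots> = \<eta> * (LINT x|lebesgue. v x powr \<gamma>) + \<eta> powr (- 1 / (\<gamma> - 1)) * (LINT x|lebesgue. h k x)"
      using v(3) hint by simp
    also have "\<dots> \<le> \<eta> * P + \<eta> powr (- 1 / (\<gamma> - 1)) * (LINT x|lebesgue. h k x)"
      using v(4) \<eta> by (intro add_right_mono mult_left_mono) auto
    finally show ?thesis .
  qed
  show ?thesis
  proof (rule LIMSEQ_I)
    fix e :: real assume e: "e > 0"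
    \<comment> \<open>with \<open>P + 1\<close> in place of \<open>P\<close> to avoid dividing by zero\<close>
    define \<eta> where "\<eta> = e / (8 * (P + 1))"
    have \<eta>: "\<eta> > 0" using e P by (simp add: \<eta>_def)
    have \<eta>P: "\<eta> * P \<le> e / 8"
    proof -
      have "\<eta> * P \<le> \<eta> * (P + 1)" using \<eta> by simp
      also have "\<dots> = e / 8" using P by (simp add: \<eta>_def field_simps)
      finally show ?thesis .
    qed
    have "(\<lambda>k. \<eta> powr (- 1 / (\<gamma> - 1)) * (LINT x|lebesgue. h k x)) \<longlonglongrightarrow> \<eta> powr (- 1 / (\<gamma> - 1)) * 0"
      using h0 by (intro tendsto_intros) simp
    then have "eventually (\<lambda>k. \<eta> powr (- 1 / (\<gamma> - 1)) * (LINT x|lebesgue. h k x) < e / 8) sequentially"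
      using e by (intro order_tendstoD) auto
    then obtain k where k: "\<eta> powr (- 1 / (\<gamma> - 1)) * (LINT x|lebesgue. h k x) < e / 8"
      by (auto simp: eventually_sequentially)
    have t1: "\<bar>(LINT x|lebesgue. \<sigma> i x * \<phi> x) - (LINT x|lebesgue. \<sigma> i x * f k x)\<bar> \<le> e / 4" for i
      using tail[OF int nn pint pbd \<eta>, of i k] \<eta>P k by linarith
    have t2: "\<bar>(LINT x|lebesgue. u x * \<phi> x) - (LINT x|lebesgue. u x * f k x)\<bar> \<le> e / 4"
      using tail[OF u upint upbd \<eta>, of k] \<eta>P k by linarith
    obtain K where K: "\<And>i. i \<ge> K \<Longrightarrow> norm ((LINT x|lebesgue. \<sigma> i x * f k x) - (LINT x|lebesgue. u x * f k x)) < e / 4"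
      using LIMSEQ_D[OF fconv[of k], of "e / 4"] e by auto
    show "\<exists>K. \<forall>i\<ge>K. norm ((LINT x|lebesgue. \<sigma> i x * \<phi> x) - (LINT x|lebesgue. u x * \<phi> x)) < e"
    proof (intro exI[of _ K] allI impI)
      fix i assume "i \<ge> K"
      from K[OF this] t1[of i] t2 e
      show "norm ((LINT x|lebesgue. \<sigma> i x * \<phi> x) - (LINT x|lebesgue. u x * \<phi> x)) < e"
        unfolding real_norm_def by linarith
    qed
  qed
qed

section \<open>Semicontinuity of the power integral and compactness\<close>

text \<open>
  The truncations \<open>b n\<close> of \<open>u\<close> give bounded test functions \<open>b n x powr (\<gamma> - 1)\<close>. The tangent inequality passes to
  the limit in \<open>i\<close> and bounds the power integral of \<open>b n\<close>; monotone convergence removes the truncation.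
\<close>

lemma powr_integral_limit_bound:
  fixes \<sigma> :: "nat \<Rightarrow> 'a::euclidean_space \<Rightarrow> real"
  assumes \<gamma>: "\<gamma> > 1" and int: "\<And>i. integrable lebesgue (\<sigma> i)" and nn: "\<And>i. AE x in lebesgue. 0 \<le> \<sigma> i x"
    and pint: "\<And>i. integrable lebesgue (\<lambda>x. \<sigma> i x powr \<gamma>)"
    and pbd: "\<And>i. (LINT x|lebesgue. \<sigma> i x powr \<gamma>) \<le> P"
    and u: "u \<in> borel_measurable borel" "\<And>x. 0 \<le> u x" "integrable lebesgue u"
    and weak: "\<And>\<phi> B. \<phi> \<in> borel_measurable borel \<Longrightarrow> (\<And>x. \<bar>\<phi> x\<bar> \<le> B) \<Longrightarrow>
       (\<lambda>i. LINT x|lebesgue. \<sigma> i x * \<phi> x) \<longlonglongrightarrow> (LINT x|lebesgue. u x * \<phi> x)"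
  shows "integrable lebesgue (\<lambda>x. u x powr \<gamma>)" and "(LINT x|lebesgue. u x powr \<gamma>) \<le> P"
proof -
  note [measurable] = borel_imp_lebesgue_measurable[OF u(1)] u(1)
  define b where "b = (\<lambda>n x. min (u x) (real n))"
  have b0: "0 \<le> b n x" "b n x \<le> real n" "b n x \<le> u x" for n x using u(2)[of x] by (auto simp: b_def)
  have bm[measurable]: "b n \<in> borel_measurable borel" for n unfolding b_def by measurable
  have bL[measurable]: "b n \<in> borel_measurable lebesgue" for n by (rule borel_imp_lebesgue_measurable[OF bm])
  have pw: "b n x * b n x powr (\<gamma> - 1) = b n x powr \<gamma>" for n x
    using powr_add[of "b n x" 1 "\<gamma> - 1"] b0(1)[of n x] by (cases "b n x = 0") auto
  have tb: "\<bar>b n x powr (\<gamma> - 1)\<bar> \<le> real n powr (\<gamma> - 1)" for n x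
    using b0 \<gamma> by (auto intro!: powr_mono2)
  have tm: "(\<lambda>x. b n x powr (\<gamma> - 1)) \<in> borel_measurable borel" for n by measurable
  note tL = borel_imp_lebesgue_measurable[OF tm]
  have iu: "integrable lebesgue (\<lambda>x. u x * b n x powr (\<gamma> - 1))" for n
    by (rule integrable_mult_bounded_borel[OF u(3) tL tb])
  have is1: "integrable lebesgue (\<lambda>x. \<sigma> i x * b n x powr (\<gamma> - 1))" for i n
    by (rule integrable_mult_bounded_borel[OF int tL tb])
  have le: "b n x powr \<gamma> \<le> u x * b n x powr (\<gamma> - 1)" for n x
    unfolding pw[symmetric] using b0 by (intro mult_right_mono) auto
  have ib: "integrable lebesgue (\<lambda>x. b n x powr \<gamma>)" for n
  proof (rule Bochner_Integration.integrable_bound[OF iu])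
    show "(\<lambda>x. b n x powr \<gamma>) \<in> borel_measurable lebesgue" by measurable
    show "AE x in lebesgue. norm (b n x powr \<gamma>) \<le> norm (u x * b n x powr (\<gamma> - 1))"
      using le[of n] u(2) by (intro AE_I2) (simp add: abs_mult)
  qed
  have bP: "(LINT x|lebesgue. b n x powr \<gamma>) \<le> P" for n
  proof -
    have "\<gamma> * (LINT x|lebesgue. \<sigma> i x * b n x powr (\<gamma> - 1)) - (\<gamma> - 1) * (LINT x|lebesgue. b n x powr \<gamma>) \<le> P" for i
    proof -
      have "\<gamma> * (LINT x|lebesgue. \<sigma> i x * b n x powr (\<gamma> - 1)) - (\<gamma> - 1) * (LINT x|lebesgue. b n x powr \<gamma>) =
        (LINT x|lebesgue. \<gamma> * (\<sigma> i x * b n x powr (\<gamma> - 1)) - (\<gamma> - 1) * b n x powr \<gamma>)"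
        using is1 ib by simp
      also have "\<dots> \<le> (LINT x|lebesgue. \<sigma> i x powr \<gamma>)"
      proof (rule integral_mono_AE)
        show "AE x in lebesgue. \<gamma> * (\<sigma> i x * b n x powr (\<gamma> - 1)) - (\<gamma> - 1) * b n x powr \<gamma> \<le> \<sigma> i x powr \<gamma>"
          using nn[of i] by eventually_elim (intro powr_tangent_le b0 \<gamma>)
      qed (use is1 ib pint in auto)
      finally show ?thesis using pbd[of i] by simp
    qed
    then have "\<gamma> * (LINT x|lebesgue. u x * b n x powr (\<gamma> - 1)) - (\<gamma> - 1) * (LINT x|lebesgue. b n x powr \<gamma>) \<le> P"
      by (intro LIMSEQ_le_const2[OF tendsto_diff[OF tendsto_mult_left[OF weak[OF tm tb]] tendsto_const]]) auto
    moreover have "\<gamma> * (LINT x|lebesgue. b n x powr \<gamma>) \<le> \<gamma> * (LINT x|lebesgue. u x * b n x powr (\<gamma> - 1))"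
      using \<gamma> le by (intro mult_left_mono integral_mono ib iu) auto
    ultimately show ?thesis by (simp add: algebra_simps)
  qed
  have mono: "incseq (\<lambda>n. LINT x|lebesgue. b n x powr \<gamma>)"
    using \<gamma> b0 by (intro incseq_SucI integral_mono ib powr_mono2) (auto simp: b_def)
  obtain L where L: "(\<lambda>n. LINT x|lebesgue. b n x powr \<gamma>) \<longlonglongrightarrow> L" "\<And>n. (LINT x|lebesgue. b n x powr \<gamma>) \<le> L"
    using incseq_convergent[OF mono, of P] bP by blast
  have LP: "L \<le> P" by (rule LIMSEQ_le_const2[OF L(1)]) (use bP in auto)
  have conv: "(\<lambda>n. b n x powr \<gamma>) \<longlonglongrightarrow> u x powr \<gamma>" for x
  proof (rule tendsto_eventually)
    obtain N :: nat where "u x \<le> real N" using real_arch_simple by blast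
    then show "eventually (\<lambda>n. b n x powr \<gamma> = u x powr \<gamma>) sequentially"
      unfolding eventually_sequentially by (intro exI[of _ N]) (auto simp: b_def min_def)
  qed
  have mp: "AE x in lebesgue. mono (\<lambda>n. b n x powr \<gamma>)"
    using \<gamma> b0 by (intro AE_I2 incseq_SucI[unfolded incseq_def, folded mono_def] incseq_SucI powr_mono2) (auto simp: b_def)
  have um: "(\<lambda>x. u x powr \<gamma>) \<in> borel_measurable lebesgue" by measurable
  show "integrable lebesgue (\<lambda>x. u x powr \<gamma>)"
    by (rule integrable_monotone_convergence[OF ib mp AE_I2[OF conv] L(1) um])
  show "(LINT x|lebesgue. u x powr \<gamma>) \<le> P"
    using integral_monotone_convergence[OF ib mp AE_I2[OF conv] L(1) um] LP by simp
qed

text \<open>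
  The tangent inequality at \<open>\<tau>\<close> is linear in \<open>\<sigma> i\<close>, and its slope \<open>\<tau> x powr (\<gamma> - 1)\<close> lies in the
  conjugate space.
\<close>

lemma powr_integral_lower_semicontinuous:
  fixes \<sigma> :: "nat \<Rightarrow> 'a::euclidean_space \<Rightarrow> real"
  assumes \<gamma>: "\<gamma> > 1" and meas: "\<And>i. \<sigma> i \<in> borel_measurable lebesgue" and nn: "\<And>i. AE x in lebesgue. 0 \<le> \<sigma> i x"
    and pint: "\<And>i. integrable lebesgue (\<lambda>x. \<sigma> i x powr \<gamma>)"
    and \<tau>: "\<tau> \<in> borel_measurable lebesgue" "AE x in lebesgue. 0 \<le> \<tau> x" "integrable lebesgue (\<lambda>x. \<tau> x powr \<gamma>)"
    and weak: "\<And>\<phi>. \<phi> \<in> borel_measurable lebesgue \<Longrightarrow> integrable lebesgue (\<lambda>x. \<bar>\<phi> x\<bar> powr (\<gamma> / (\<gamma> - 1))) \<Longrightarrow>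
       (\<lambda>i. LINT x|lebesgue. \<sigma> i x * \<phi> x) \<longlonglongrightarrow> (LINT x|lebesgue. \<tau> x * \<phi> x)"
    and \<epsilon>: "\<epsilon> > 0"
  shows "eventually (\<lambda>i. (LINT x|lebesgue. \<tau> x powr \<gamma>) - \<epsilon> \<le> (LINT x|lebesgue. \<sigma> i x powr \<gamma>)) sequentially"
proof -
  define \<phi> where "\<phi> = (\<lambda>x. \<tau> x powr (\<gamma> - 1))"
  note [measurable] = \<tau>(1)
  have \<phi>m: "\<phi> \<in> borel_measurable lebesgue" unfolding \<phi>_def by measurable
  have "\<bar>\<phi> x\<bar> powr (\<gamma> / (\<gamma> - 1)) = \<tau> x powr \<gamma>" for x using \<gamma> by (simp add: \<phi>_def powr_powr)
  then have q: "integrable lebesgue (\<lambda>x. \<bar>\<phi> x\<bar> powr (\<gamma> / (\<gamma> - 1)))" using \<tau>(3) by simp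
  have T: "(LINT x|lebesgue. \<tau> x * \<phi> x) = (LINT x|lebesgue. \<tau> x powr \<gamma>)"
  proof (rule integral_cong_AE)
    show "AE x in lebesgue. \<tau> x * \<phi> x = \<tau> x powr \<gamma>"
      using \<tau>(2)
    proof eventually_elim
      case (elim x)
      then show ?case using powr_add[of "\<tau> x" 1 "\<gamma> - 1"] by (cases "\<tau> x = 0") (auto simp: \<phi>_def)
    qed
  qed (use \<phi>m in measurable)
  have i1: "integrable lebesgue (\<lambda>x. \<sigma> i x * \<phi> x)" for i
    by (rule integrable_times_conjugate[OF \<gamma> meas nn pint \<phi>m q])
  have ge: "\<gamma> * (LINT x|lebesgue. \<sigma> i x * \<phi> x) - (\<gamma> - 1) * (LINT x|lebesgue. \<tau> x powr \<gamma>) \<le> (LINT x|lebesgue. \<sigma> i x powr \<gamma>)" for i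
  proof -
    have "\<gamma> * (LINT x|lebesgue. \<sigma> i x * \<phi> x) - (\<gamma> - 1) * (LINT x|lebesgue. \<tau> x powr \<gamma>) =
      (LINT x|lebesgue. \<gamma> * (\<sigma> i x * \<phi> x) - (\<gamma> - 1) * \<tau> x powr \<gamma>)"
      using i1 \<tau>(3) by simp
    also have "\<dots> \<le> (LINT x|lebesgue. \<sigma> i x powr \<gamma>)"
    proof (rule integral_mono_AE)
      show "AE x in lebesgue. \<gamma> * (\<sigma> i x * \<phi> x) - (\<gamma> - 1) * \<tau> x powr \<gamma> \<le> \<sigma> i x powr \<gamma>"
        using nn[of i] \<tau>(2) unfolding \<phi>_def by eventually_elim (intro powr_tangent_le \<gamma>)
    qed (use i1 \<tau>(3) pint in auto)
    finally show ?thesis .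
  qed
  have "(\<lambda>i. \<gamma> * (LINT x|lebesgue. \<sigma> i x * \<phi> x)) \<longlonglongrightarrow> \<gamma> * (LINT x|lebesgue. \<tau> x powr \<gamma>)"
    using weak[OF \<phi>m q] unfolding T by (rule tendsto_mult_left)
  then have "eventually (\<lambda>i. \<gamma> * (LINT x|lebesgue. \<tau> x powr \<gamma>) - \<epsilon> < \<gamma> * (LINT x|lebesgue. \<sigma> i x * \<phi> x)) sequentially"
    using \<epsilon> by (intro order_tendstoD(1)) auto
  then show ?thesis
  proof eventually_elim
    case (elim i)
    then show ?case using ge[of i] by (simp add: algebra_simps)
  qed
qed

lemma countable_Int_stable_generator:
  obtains G :: "'a::second_countable_topology set set" where "countable G" "Int_stable G" "G \<noteq> {}" "sigma_sets UNIV G = sets borel"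
proof -
  obtain B :: "'a set set" where B: "countable B" "topological_basis B"
    using ex_countable_basis by blast
  define G where "G = (\<lambda>F. \<Inter>F) ` {F. finite F \<and> F \<subseteq> B}"
  have sB: "sigma_sets UNIV B = sets borel"
    using borel_eq_countable_basis[OF B] by (metis Pow_UNIV sets_measure_of top_greatest)
  have op: "open U" if "U \<in> B" for U using topological_basis_open[OF B(2) that] .
  show thesis
  proof (rule that)
    show "countable G" unfolding G_def using countable_Collect_finite_subset[OF B(1)] by simp
    show "G \<noteq> {}" unfolding G_def by auto
    show "Int_stable G"
    proof (rule Int_stableI)
      fix a b assume "a \<in> G" "b \<in> G"
      then obtain F F' where F: "a = \<Inter>F" "b = \<Inter>F'" "finite F" "F \<subseteq> B" "finite F'" "F' \<subseteq> B"
        by (auto simp: G_def)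
      then have "a \<inter> b = \<Inter>(F \<union> F')" "F \<union> F' \<in> {F. finite F \<and> F \<subseteq> B}" by auto
      then show "a \<inter> b \<in> G" unfolding G_def by blast
    qed
    show "sigma_sets UNIV G = sets borel"
    proof
      have "G \<subseteq> sets borel"
      proof
        fix a assume "a \<in> G"
        then obtain F where "a = \<Inter>F" "finite F" "F \<subseteq> B" by (auto simp: G_def)
        then have "open a" using op by (auto intro!: open_Inter)
        then show "a \<in> sets borel" by simp
      qed
      then show "sigma_sets UNIV G \<subseteq> sets borel"
        using sets.sigma_sets_subset[of G borel] by simp
      have "B \<subseteq> G"
      proof
        fix U assume "U \<in> B"
        then have "U = \<Inter>{U}" "{U} \<in> {F. finite F \<and> F \<subseteq> B}" by auto
        then show "U \<in> G" unfolding G_def by blast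
      qed
      then show "sets borel \<subseteq> sigma_sets UNIV G"
        unfolding sB[symmetric] by (rule sigma_sets_mono'[of B G])
    qed
  qed
qed

text \<open>
  A diagonal subsequence has convergent masses on each set of a countable generator. The density of the limit measure is
  set to zero outside the ball, where it has no mass anyway.
\<close>

lemma (in bounded_Lp_sequence) weakly_convergent_subsequence:
  obtains s u where "strict_mono s" "u \<in> borel_measurable borel" "\<And>x. 0 \<le> u x" "integrable lebesgue u"
    "\<And>x. R \<le> norm x \<Longrightarrow> u x = 0"
    "integrable lebesgue (\<lambda>x. u x powr \<gamma>)" "(LINT x|lebesgue. u x powr \<gamma>) \<le> P"
    "\<And>\<phi> B. \<phi> \<in> borel_measurable borel \<Longrightarrow> (\<And>x. \<bar>\<phi> x\<bar> \<le> B) \<Longrightarrow>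
       (\<lambda>i. LINT x|lebesgue. \<sigma> (s i) x * \<phi> x) \<longlonglongrightarrow> (LINT x|lebesgue. u x * \<phi> x)"
proof -
  obtain G :: "'a set set" where G: "countable G" "Int_stable G" "G \<noteq> {}" "sigma_sets UNIV G = sets borel"
    by (rule countable_Int_stable_generator)
  have Gb: "A \<in> sets borel" if "A \<in> G" for A using that G(4) by (metis sigma_sets.Basic)
  define I where "I = (\<lambda>n i. LINT x|lebesgue. \<sigma> i x * indicator (from_nat_into G n) x)"
  have Ib: "I n i \<in> {0..m}" for n i
  proof -
    have A: "from_nat_into G n \<in> sets borel" using from_nat_into[OF G(3)] by (rule Gb)
    have "0 \<le> I n i" unfolding I_def using nn[of i] by (intro integral_nonneg_AE) auto
    moreover have "I n i \<le> (LINT x|lebesgue. \<sigma> i x)"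
      unfolding I_def
    proof (rule integral_mono_AE[OF integrable_times_indicator[OF A] int])
      show "AE x in lebesgue. \<sigma> i x * indicator (from_nat_into G n) x \<le> \<sigma> i x"
        using nn[of i] by eventually_elim (simp add: indicator_def)
    qed
    ultimately show ?thesis using mass by simp
  qed
  interpret D: subseqs "\<lambda>n s. convergent (\<lambda>i. I n (s i))"
  proof
    fix n and s :: "nat \<Rightarrow> nat"
    have "seq_compact {0..m}" by (rule compact_imp_seq_compact[OF compact_Icc])
    from this[unfolded seq_compact_def, rule_format, of "\<lambda>i. I n (s i)"]
    obtain l r where "strict_mono r" "((\<lambda>i. I n (s i)) \<circ> r) \<longlonglongrightarrow> l"
      using Ib by (auto simp del: atLeastAtMost_iff)
    then show "\<exists>r. strict_mono r \<and> convergent (\<lambda>i. I n ((s \<circ> r) i))"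
      by (auto simp: o_def convergent_def)
  qed
  define s where "s = D.diagseq"
  have s: "strict_mono s" unfolding s_def by (rule D.subseq_diagseq)
  have convI: "convergent (\<lambda>i. I n (s i))" for n
  proof -
    have "convergent (\<lambda>i. I n ((D.diagseq \<circ> (+) (Suc n)) i))"
    proof (rule D.diagseq_holds)
      fix r t :: "nat \<Rightarrow> nat" and k assume "strict_mono r" "convergent (\<lambda>i. I k (t i))"
      then show "convergent (\<lambda>i. I k ((t \<circ> r) i))"
        using convergent_subseq_convergent[of "\<lambda>i. I k (t i)" r] by (simp add: o_def)
    qed
    then have "convergent (\<lambda>i. I n (s (i + Suc n)))" by (simp add: s_def o_def add.commute)
    then show ?thesis using convergent_ignore_initial_segment[of "\<lambda>i. I n (s i)" "Suc n"] by simp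
  qed
  interpret S: bounded_Lp_sequence "\<lambda>i. \<sigma> (s i)" \<gamma> R m P
    by (unfold_locales) (rule \<gamma> int nn supp mass pint pbd; assumption?)+
  have convG: "convergent (\<lambda>i. LINT x|lebesgue. \<sigma> (s i) x * indicator A x)" if A: "A \<in> G" for A
  proof -
    obtain n where "A = from_nat_into G n" using from_nat_into_surj[OF G(1) A] by metis
    then show ?thesis using convI[of n] by (simp add: I_def)
  qed
  obtain u where u: "u \<in> borel_measurable borel" "\<And>x. 0 \<le> u x" "integrable lebesgue u"
    and us: "\<And>A. A \<in> sets borel \<Longrightarrow> (\<lambda>i. LINT x|lebesgue. \<sigma> (s i) x * indicator A x) \<longlonglongrightarrow> (LINT x|lebesgue. u x * indicator A x)"
    by (rule S.limit_density[OF S.converges_on_borel_sets[OF G(2,4) convG]]) (assumption, assumption, rule that, blast+)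
  define v where "v = (\<lambda>x. u x * indicator (ball 0 R) x)"
  have [measurable]: "ball (0::'a) R \<in> sets borel" by simp
  have v: "v \<in> borel_measurable borel" "\<And>x. 0 \<le> v x"
    using u by (auto simp: v_def)
  have iv: "integrable lebesgue v"
    unfolding v_def by (rule integrable_mult_bounded_borel[OF u(3), of _ 1])
      (auto intro!: borel_imp_lebesgue_measurable borel_measurable_indicator simp: indicator_def)
  have vs: "(\<lambda>i. LINT x|lebesgue. \<sigma> (s i) x * indicator A x) \<longlonglongrightarrow> (LINT x|lebesgue. v x * indicator A x)"
    if A: "A \<in> sets borel" for A
  proof -
    have "(LINT x|lebesgue. \<sigma> (s i) x * indicator (A \<inter> ball 0 R) x) = (LINT x|lebesgue. \<sigma> (s i) x * indicator A x)" for i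
      using supp by (intro Bochner_Integration.integral_cong) (auto simp: indicator_def not_less)
    moreover have "(LINT x|lebesgue. u x * indicator (A \<inter> ball 0 R) x) = (LINT x|lebesgue. v x * indicator A x)"
      by (intro Bochner_Integration.integral_cong) (auto simp: indicator_def v_def)
    ultimately show ?thesis using us[of "A \<inter> ball 0 R"] A by simp
  qed
  note weak = S.bounded_convergence[OF v iv vs]
  note pw = powr_integral_limit_bound[OF \<gamma> S.int S.nn S.pint S.pbd v iv weak]
  show thesis
    by (rule that[OF s v iv _ pw weak]) (simp_all add: v_def)
qed

section \<open>Axisymmetric weak limits\<close>

lemma axisymmetricI:
  assumes "\<And>x x'. cyl_radius x = cyl_radius x' \<Longrightarrow> x $ 3 = x' $ 3 \<Longrightarrow> f x = f x'"
  shows "axisymmetric f"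
  unfolding axisymmetric_def
proof (intro exI allI)
  fix x :: "real^3"
  show "f x = (\<lambda>r z. f (vector [r, 0, z])) (cyl_radius x) (x $ 3)"
    by (rule assms) (simp_all add: cyl_radius_def)
qed

text \<open>
  Lebesgue sets that are unions of circles about the axis. A function measurable for this sigma-algebra has
  preimages of points of this form, so it is axisymmetric at every point and not only almost everywhere.
\<close>

definition axisymmetric_sets :: "(real^3) set set" where
  "axisymmetric_sets = {A \<in> sets lebesgue. axisymmetric (indicator A)}"

definition axisymmetric_algebra :: "(real^3) measure" where
  "axisymmetric_algebra = sigma UNIV axisymmetric_sets"

lemma axisymmetric_setsI:
  assumes "A \<in> sets lebesgue" "\<And>x x'. cyl_radius x = cyl_radius x' \<Longrightarrow> x $ 3 = x' $ 3 \<Longrightarrow> x \<in> A \<longleftrightarrow> x' \<in> A"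
  shows "A \<in> axisymmetric_sets"
  unfolding axisymmetric_sets_def
proof (intro CollectI conjI assms(1) axisymmetricI)
  fix x x' :: "real^3" assume "cyl_radius x = cyl_radius x'" "x $ 3 = x' $ 3"
  from assms(2)[OF this] show "indicator A x = (indicator A x' :: real)" by (simp add: indicator_def)
qed

lemma axisymmetric_setsD:
  assumes "A \<in> axisymmetric_sets"
  shows "A \<in> sets lebesgue" "cyl_radius x = cyl_radius x' \<Longrightarrow> x $ 3 = x' $ 3 \<Longrightarrow> x \<in> A \<longleftrightarrow> x' \<in> A"
proof -
  show "A \<in> sets lebesgue" using assms by (simp add: axisymmetric_sets_def)
  assume x: "cyl_radius x = cyl_radius x'" "x $ 3 = x' $ 3"
  have "axisymmetric (indicator A)" using assms by (simp add: axisymmetric_sets_def)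
  from axisymmetricD[OF this x] have "indicator A x = (indicator A x' :: real)" .
  then show "x \<in> A \<longleftrightarrow> x' \<in> A" by (cases "x \<in> A"; cases "x' \<in> A") simp_all
qed

lemma sets_axisymmetric_algebra: "sets axisymmetric_algebra = axisymmetric_sets"
proof -
  have "sigma_algebra UNIV axisymmetric_sets"
    unfolding sigma_algebra_iff2
  proof (intro conjI ballI allI impI)
    show "axisymmetric_sets \<subseteq> Pow UNIV" by simp
    show "{} \<in> axisymmetric_sets" by (rule axisymmetric_setsI) simp_all
    fix A assume A: "A \<in> axisymmetric_sets"
    show "UNIV - A \<in> axisymmetric_sets"
    proof (rule axisymmetric_setsI)
      show "UNIV - A \<in> sets lebesgue" using sets.compl_sets[OF axisymmetric_setsD(1)[OF A]] by simp
      fix x x' :: "real^3" assume "cyl_radius x = cyl_radius x'" "x $ 3 = x' $ 3"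
      from axisymmetric_setsD(2)[OF A this] show "x \<in> UNIV - A \<longleftrightarrow> x' \<in> UNIV - A" by simp
    qed
  next
    fix A :: "nat \<Rightarrow> (real^3) set" assume "range A \<subseteq> axisymmetric_sets"
    then have A: "A i \<in> axisymmetric_sets" for i by blast
    show "(\<Union>i. A i) \<in> axisymmetric_sets"
    proof (rule axisymmetric_setsI)
      show "(\<Union>i. A i) \<in> sets lebesgue" using axisymmetric_setsD(1)[OF A] by (intro sets.countable_UN) blast
      fix x x' :: "real^3" assume "cyl_radius x = cyl_radius x'" "x $ 3 = x' $ 3"
      from axisymmetric_setsD(2)[OF A this] show "x \<in> (\<Union>i. A i) \<longleftrightarrow> x' \<in> (\<Union>i. A i)" by simp
    qed
  qed
  then show ?thesis
    unfolding axisymmetric_algebra_def by (rule sigma_algebra.sets_measure_of_eq)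
qed

lemma space_axisymmetric_algebra: "space axisymmetric_algebra = UNIV"
  by (simp add: axisymmetric_algebra_def space_measure_of_conv)

lemma axisymmetric_imp_measurable:
  assumes "f \<in> borel_measurable lebesgue" "axisymmetric f"
  shows "f \<in> borel_measurable axisymmetric_algebra"
proof (rule measurableI)
  fix A :: "real set" assume "A \<in> sets borel"
  have "f -` A \<in> axisymmetric_sets"
  proof (rule axisymmetric_setsI)
    show "f -` A \<in> sets lebesgue" using measurable_sets[OF assms(1) \<open>A \<in> sets borel\<close>] by simp
    fix x x' :: "real^3" assume "cyl_radius x = cyl_radius x'" "x $ 3 = x' $ 3"
    from axisymmetricD[OF assms(2) this] show "x \<in> f -` A \<longleftrightarrow> x' \<in> f -` A" by simp
  qed
  then show "f -` A \<inter> space axisymmetric_algebra \<in> sets axisymmetric_algebra"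
    by (simp add: sets_axisymmetric_algebra space_axisymmetric_algebra)
qed simp

lemma measurable_imp_axisymmetric:
  fixes f :: "real^3 \<Rightarrow> real"
  assumes "f \<in> borel_measurable axisymmetric_algebra"
  shows "axisymmetric f"
proof (rule axisymmetricI)
  fix x x' :: "real^3" assume x: "cyl_radius x = cyl_radius x'" "x $ 3 = x' $ 3"
  have "f -` {f x} \<in> axisymmetric_sets"
    using measurable_sets[OF assms, of "{f x}"] by (simp add: sets_axisymmetric_algebra space_axisymmetric_algebra)
  then have "x \<in> f -` {f x} \<longleftrightarrow> x' \<in> f -` {f x}" by (rule axisymmetric_setsD(2)[OF _ x])
  then show "f x = f x'" by simp
qed

lemma axisymmetric_subalgebra: "sigma_finite_subalgebra lebesgue axisymmetric_algebra"
proof (rule sigma_finite_subalgebra.intro)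
  show sub: "subalgebra lebesgue axisymmetric_algebra"
    by (auto simp: subalgebra_def sets_axisymmetric_algebra space_axisymmetric_algebra axisymmetric_setsD(1))
  have ball: "ball 0 (real n) \<in> sets axisymmetric_algebra" for n :: nat
    unfolding sets_axisymmetric_algebra
  proof (rule axisymmetric_setsI)
    fix x x' :: "real^3" assume "cyl_radius x = cyl_radius x'" "x $ 3 = x' $ 3"
    from norm_eq_of_cyl_radius[OF this] show "x \<in> ball 0 (real n) \<longleftrightarrow> x' \<in> ball 0 (real n)" by simp
  qed simp
  show "sigma_finite_measure (restr_to_subalg lebesgue axisymmetric_algebra)"
  proof
    show "\<exists>A. countable A \<and> A \<subseteq> sets (restr_to_subalg lebesgue axisymmetric_algebra) \<and>
      \<Union>A = space (restr_to_subalg lebesgue axisymmetric_algebra) \<and>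
      (\<forall>a\<in>A. emeasure (restr_to_subalg lebesgue axisymmetric_algebra) a \<noteq> \<infinity>)"
    proof (intro exI[of _ "range (\<lambda>n::nat. ball 0 (real n))"] conjI)
      show "range (\<lambda>n::nat. ball 0 (real n)) \<subseteq> sets (restr_to_subalg lebesgue axisymmetric_algebra)"
        using ball by (auto simp: sets_restr_to_subalg[OF sub])
      show "\<Union> (range (\<lambda>n::nat. ball (0::real^3) (real n))) = space (restr_to_subalg lebesgue axisymmetric_algebra)"
        by (auto simp: space_restr_to_subalg reals_Archimedean2)
      show "\<forall>a\<in>range (\<lambda>n::nat. ball 0 (real n)). emeasure (restr_to_subalg lebesgue axisymmetric_algebra) a \<noteq> \<infinity>"
        using ball emeasure_lborel_ball_finite[of "0::real^3"]
        by (auto simp: emeasure_restr_to_subalg[OF sub] less_top[symmetric])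
    qed simp
  qed
qed

text \<open>
  Conditional expectation on the axisymmetric sets fixes each \<open>\<sigma> i\<close> and is symmetric with respect to the pairing. It can
  thus be moved from the limit to the test function and from there to the sequence, which shows that it fixes \<open>u\<close> almost everywhere as well.
\<close>

lemma axisymmetric_weak_limit:
  fixes \<sigma> :: "nat \<Rightarrow> real^3 \<Rightarrow> real"
  assumes int: "\<And>i. integrable lebesgue (\<sigma> i)" and ax: "\<And>i. axisymmetric (\<sigma> i)"
    and u: "integrable lebesgue u" and supp: "\<And>x. R \<le> norm x \<Longrightarrow> u x = 0"
    and weak: "\<And>\<phi> B. \<phi> \<in> borel_measurable borel \<Longrightarrow> (\<And>x. \<bar>\<phi> x\<bar> \<le> B) \<Longrightarrow>
       (\<lambda>i. LINT x|lebesgue. \<sigma> i x * \<phi> x) \<longlonglongrightarrow> (LINT x|lebesgue. u x * \<phi> x)"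
  obtains w where "axisymmetric w" "w \<in> borel_measurable lebesgue" "\<And>x. R \<le> norm x \<Longrightarrow> w x = 0" "AE x in lebesgue. u x = w x"
proof -
  interpret F: sigma_finite_subalgebra "lebesgue :: (real^3) measure" axisymmetric_algebra
    by (rule axisymmetric_subalgebra)
  define E where "E = real_cond_exp (lebesgue :: (real^3) measure) axisymmetric_algebra"
  have EF: "E f \<in> borel_measurable axisymmetric_algebra" and EL: "E f \<in> borel_measurable lebesgue" for f
    unfolding E_def by simp_all
  have um: "u \<in> borel_measurable lebesgue" using u by simp
  have iE: "integrable lebesgue (E u)" unfolding E_def by (rule F.real_cond_exp_int(1)[OF u])
  have weakL: "(\<lambda>i. LINT x|lebesgue. \<sigma> i x * \<phi> x) \<longlonglongrightarrow> (LINT x|lebesgue. u x * \<phi> x)"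
    if \<phi>: "\<phi> \<in> borel_measurable lebesgue" and ae01: "AE x in lebesgue. 0 \<le> \<phi> x" "AE x in lebesgue. \<phi> x \<le> 1" for \<phi>
  proof -
    define \<psi> where "\<psi> = (\<lambda>x. max 0 (min 1 (\<phi> x)))"
    note [measurable] = \<phi>
    have "\<psi> \<in> borel_measurable lebesgue" unfolding \<psi>_def by measurable
    moreover have "\<bar>\<psi> x\<bar> \<le> 1" for x by (simp add: \<psi>_def)
    ultimately obtain \<phi>' where \<phi>': "\<phi>' \<in> borel_measurable borel" "\<And>x. \<bar>\<phi>' x\<bar> \<le> 1" "AE x in lebesgue. \<psi> x = \<phi>' x"
      by (rule borel_version_bounded) blast
    have ae: "AE x in lebesgue. \<phi> x = \<phi>' x"
      using \<phi>'(3) ae01 by eventually_elim (simp add: \<psi>_def)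
    have eq: "(LINT x|lebesgue. v x * \<phi> x) = (LINT x|lebesgue. v x * \<phi>' x)" if "integrable lebesgue v" for v
    proof (rule integral_cong_AE)
      note [measurable] = borel_measurable_integrable[OF that] borel_imp_lebesgue_measurable[OF \<phi>'(1)]
      show "(\<lambda>x. v x * \<phi> x) \<in> borel_measurable lebesgue" "(\<lambda>x. v x * \<phi>' x) \<in> borel_measurable lebesgue" by measurable
      show "AE x in lebesgue. v x * \<phi> x = v x * \<phi>' x" using ae by eventually_elim simp
    qed
    show ?thesis unfolding eq[OF int] eq[OF u] by (rule weak[OF \<phi>'(1,2)])
  qed
  have key: "(LINT x|lebesgue. u x * indicator A x) = (LINT x|lebesgue. E u x * indicator A x)"
    if A: "A \<in> sets lebesgue" "emeasure lebesgue A < \<infinity>" for A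
  proof -
    define g where "g = (indicator A :: real^3 \<Rightarrow> real)"
    have gm: "g \<in> borel_measurable lebesgue" unfolding g_def using A by simp
    have gi: "integrable lebesgue g" unfolding g_def using A by (simp add: integrable_indicator_iff)
    have g1: "\<bar>g x\<bar> \<le> 1" for x by (simp add: g_def)
    have Eg0: "AE x in lebesgue. 0 \<le> E g x" and Eg1: "AE x in lebesgue. E g x \<le> 1"
      unfolding E_def by (rule F.real_cond_exp_ge_c[OF gi], simp add: g_def, rule F.real_cond_exp_le_c[OF gi], simp add: g_def)
    have c1: "(LINT x|lebesgue. \<sigma> i x * g x) = (LINT x|lebesgue. \<sigma> i x * E g x)" for i
      unfolding E_def
      by (rule F.real_cond_exp_intg(2)[symmetric, OF integrable_mult_bounded_borel[OF int gm g1]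
            axisymmetric_imp_measurable[OF _ ax] gm]) (use int[of i] in simp)
    have "(\<lambda>i. LINT x|lebesgue. \<sigma> i x * g x) \<longlonglongrightarrow> (LINT x|lebesgue. u x * g x)"
      by (rule weakL[OF gm]) (simp_all add: g_def)
    moreover have "(\<lambda>i. LINT x|lebesgue. \<sigma> i x * g x) \<longlonglongrightarrow> (LINT x|lebesgue. u x * E g x)"
      unfolding c1 by (rule weakL[OF EL Eg0 Eg1])
    ultimately have "(LINT x|lebesgue. u x * g x) = (LINT x|lebesgue. u x * E g x)"
      by (rule LIMSEQ_unique)
    also have "\<dots> = (LINT x|lebesgue. E g x * u x)" by (simp add: mult.commute)
    also have "\<dots> = (LINT x|lebesgue. E g x * E u x)"
    proof -
      have "integrable lebesgue (\<lambda>x. E g x * u x)"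
      proof (rule Bochner_Integration.integrable_bound[OF u])
        show "(\<lambda>x. E g x * u x) \<in> borel_measurable lebesgue" using EL um by simp
        show "AE x in lebesgue. norm (E g x * u x) \<le> norm (u x)"
          using Eg0 Eg1 by eventually_elim (simp add: abs_mult mult_left_le_one_le)
      qed
      from F.real_cond_exp_intg(2)[OF this EF um] show ?thesis by (simp add: E_def)
    qed
    also have "\<dots> = (LINT x|lebesgue. E u x * E g x)" by (simp add: mult.commute)
    also have "\<dots> = (LINT x|lebesgue. E u x * g x)"
      using F.real_cond_exp_intg(2)[OF integrable_mult_bounded_borel[OF iE gm g1] EF gm] by (simp add: E_def)
    finally show ?thesis by (simp add: g_def)
  qed
  define w where "w = (\<lambda>x. E u x * indicator (ball 0 R) x)"
  have ballL: "ball (0::real^3) R \<in> sets lebesgue" by simp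
  have wm: "w \<in> borel_measurable lebesgue"
    unfolding w_def using EL ballL by (intro borel_measurable_times borel_measurable_indicator)
  have wi: "integrable lebesgue w"
    unfolding w_def by (rule integrable_mult_bounded_borel[OF iE borel_measurable_indicator[OF ballL], of 1])
      (simp add: indicator_def)
  have wax: "axisymmetric w"
  proof (rule axisymmetricI)
    fix x x' :: "real^3" assume x: "cyl_radius x = cyl_radius x'" "x $ 3 = x' $ 3"
    have "E u x = E u x'" by (rule axisymmetricD[OF measurable_imp_axisymmetric[OF EF] x])
    then show "w x = w x'" using norm_eq_of_cyl_radius[OF x] by (simp add: w_def indicator_def)
  qed
  have "AE x in lebesgue. u x = w x"
  proof (rule density_unique_real[OF u wi])
    fix A :: "(real^3) set" assume A: "A \<in> sets lebesgue"
    have fin: "emeasure lebesgue (A \<inter> ball 0 R) < \<infinity>"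
    proof (rule le_less_trans)
      show "emeasure lebesgue (A \<inter> ball 0 R) \<le> emeasure lebesgue (ball (0::real^3) R)"
        using ballL by (intro emeasure_mono) auto
      show "emeasure lebesgue (ball (0::real^3) R) < \<infinity>"
        using emeasure_lborel_ball_finite[of "0::real^3" R] by simp
    qed
    have "(\<integral>x\<in>A. u x \<partial>lebesgue) = (LINT x|lebesgue. u x * indicator (A \<inter> ball 0 R) x)"
      unfolding set_lebesgue_integral_def
      using supp by (intro Bochner_Integration.integral_cong) (auto simp: indicator_def not_less)
    also have "\<dots> = (LINT x|lebesgue. E u x * indicator (A \<inter> ball 0 R) x)"
      using A ballL by (intro key fin) auto
    also have "\<dots> = (\<integral>x\<in>A. w x \<partial>lebesgue)"
      unfolding set_lebesgue_integral_def w_def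
      by (intro Bochner_Integration.integral_cong) (auto simp: indicator_def)
    finally show "(\<integral>x\<in>A. u x \<partial>lebesgue) = (\<integral>x\<in>A. w x \<partial>lebesgue)" .
  qed
  then show thesis by (intro that[OF wax wm]) (simp add: w_def)
qed

section \<open>Coercivity of the energy\<close>

lemma cyl_height_norm: "sqrt ((cyl_radius x)\<^sup>2 + (x $ 3)\<^sup>2) = norm x"
  unfolding cyl_radius_norm by simp

lemma Lp_fun_1_iff: "Lp_fun 1 f \<longleftrightarrow> integrable lebesgue f"
proof
  assume "Lp_fun 1 f"
  then have "f \<in> borel_measurable lebesgue" "integrable lebesgue (\<lambda>x. \<bar>f x\<bar>)" by (simp_all add: Lp_fun_def)
  then show "integrable lebesgue f" by (simp add: integrable_abs_iff)
next
  assume "integrable lebesgue f"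
  then show "Lp_fun 1 f" by (simp add: Lp_fun_def)
qed

lemma Lp_fun_nonneg_iff:
  assumes nn: "AE x in lebesgue. 0 \<le> f x"
  shows "Lp_fun p f \<longleftrightarrow> f \<in> borel_measurable lebesgue \<and> integrable lebesgue (\<lambda>x. f x powr p)"
proof -
  have "integrable lebesgue (\<lambda>x. \<bar>f x\<bar> powr p) \<longleftrightarrow> integrable lebesgue (\<lambda>x. f x powr p)"
    if [measurable]: "f \<in> borel_measurable lebesgue"
  proof (rule integrable_cong_AE)
    show "AE x in lebesgue. \<bar>f x\<bar> powr p = f x powr p" using nn by eventually_elim simp
  qed measurable
  then show ?thesis unfolding Lp_fun_def by blast
qed

text \<open>
  Nonnegativity removes the absolute values in the definition of the Lebesgue classes, and the support condition is one
  on the norm.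
\<close>

lemma W_class_supp_iff:
  "\<rho> \<in> W_class_supp \<gamma> M R \<longleftrightarrow> axisymmetric \<rho> \<and> (AE x in lebesgue. 0 \<le> \<rho> x) \<and> integrable lebesgue \<rho> \<and>
     integrable lebesgue (\<lambda>x. \<rho> x powr \<gamma>) \<and> (LINT x|lebesgue. \<rho> x) = M \<and> (\<forall>x. R \<le> norm x \<longrightarrow> \<rho> x = 0)"
  unfolding W_class_supp_def W_class_def mem_Collect_eq cyl_height_norm Lp_fun_1_iff
  using Lp_fun_nonneg_iff[of \<rho> \<gamma>] borel_measurable_integrable[of lebesgue \<rho>] by blast

lemma W_class_suppD:
  assumes "\<rho> \<in> W_class_supp \<gamma> M R"
  shows "axisymmetric \<rho>" "AE x in lebesgue. 0 \<le> \<rho> x" "integrable lebesgue \<rho>" "\<rho> \<in> borel_measurable lebesgue"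
    "integrable lebesgue (\<lambda>x. \<rho> x powr \<gamma>)" "(LINT x|lebesgue. \<rho> x) = M" "\<And>x. R \<le> norm x \<Longrightarrow> \<rho> x = 0"
  using assms borel_measurable_integrable[of lebesgue \<rho>] unfolding W_class_supp_iff by auto

lemma W_class_supp_mono: "R \<le> R' \<Longrightarrow> W_class_supp \<gamma> M R \<subseteq> W_class_supp \<gamma> M R'"
  unfolding W_class_supp_iff subset_iff by auto

lemma lift_integral_bounds:
  assumes \<rho>: "\<rho> \<in> W_class_supp \<gamma> M R" and P: "(LINT x|lebesgue. \<rho> x powr \<gamma>) \<le> P"
  shows "integrable lebesgue (\<lambda>y. \<rho> (fold5 y))" "(LINT y|lebesgue. \<rho> (fold5 y)) \<le> 4 * pi * R\<^sup>2 * M"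
    "integrable lebesgue (\<lambda>y. \<rho> (fold5 y) powr \<gamma>)" "(LINT y|lebesgue. \<rho> (fold5 y) powr \<gamma>) \<le> 4 * pi * R\<^sup>2 * P"
proof -
  note w = W_class_suppD[OF \<rho>]
  show "integrable lebesgue (\<lambda>y. \<rho> (fold5 y))" "(LINT y|lebesgue. \<rho> (fold5 y)) \<le> 4 * pi * R\<^sup>2 * M"
    by (rule fold5_integral_le[where R=R and m=M]; use w in auto)+
  show "integrable lebesgue (\<lambda>y. \<rho> (fold5 y) powr \<gamma>)" "(LINT y|lebesgue. \<rho> (fold5 y) powr \<gamma>) \<le> 4 * pi * R\<^sup>2 * P"
    by (rule fold5_integral_le[where R=R and m=P]; use w P in auto)+
qed

text \<open>
  In dimension five the mass and the power integral of the lift are at most \<open>4 * pi * R\<^sup>2\<close> times those of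
  \<open>\<rho>\<close>; the small parameter is divided accordingly.
\<close>

lemma self_energy_bounds:
  assumes M: "M \<ge> 0" and \<gamma>: "\<gamma> > 8/5" and \<epsilon>: "\<epsilon> > 0"
  obtains C where "C \<ge> 0" "\<And>\<rho>. \<rho> \<in> W_class_supp \<gamma> M R \<Longrightarrow>
      self_energy newton \<rho> \<le> ennreal (C + \<epsilon> * (LINT x|lebesgue. \<rho> x powr \<gamma>)) \<and>
      self_energy newton (\<lambda>y. \<rho> (fold5 y)) \<le> ennreal (C + \<epsilon> * (LINT x|lebesgue. \<rho> x powr \<gamma>))"
proof -
  define \<epsilon>' where "\<epsilon>' = \<epsilon> / (4 * pi * R\<^sup>2 + 1)"
  have K: "4 * pi * R\<^sup>2 + 1 > 0" by (simp add: add_nonneg_pos)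
  have \<epsilon>': "\<epsilon>' > 0" using \<epsilon> K by (simp add: \<epsilon>'_def)
  obtain C3 where C3: "C3 \<ge> 0" and b3: "\<And>(\<rho> :: real^3 \<Rightarrow> real) P. \<rho> \<in> borel_measurable lebesgue \<Longrightarrow> P \<ge> 0 \<Longrightarrow>
    (\<integral>\<^sup>+x. ennreal (\<rho> x) \<partial>lebesgue) \<le> ennreal M \<Longrightarrow> (\<integral>\<^sup>+x. ennreal (\<rho> x powr \<gamma>) \<partial>lebesgue) \<le> ennreal P \<Longrightarrow>
    self_energy newton \<rho> \<le> ennreal (C3 + \<epsilon> * P)"
    using self_energy_newton_bound[where 'a="real^3", of \<gamma> M \<epsilon>] \<gamma> M \<epsilon> by (auto simp: DIM_3)
  have m5: "4 * pi * R\<^sup>2 * M \<ge> 0" using M by simp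
  obtain C5 where C5: "C5 \<ge> 0" and b5: "\<And>(\<rho> :: real^5 \<Rightarrow> real) P. \<rho> \<in> borel_measurable lebesgue \<Longrightarrow> P \<ge> 0 \<Longrightarrow>
    (\<integral>\<^sup>+x. ennreal (\<rho> x) \<partial>lebesgue) \<le> ennreal (4 * pi * R\<^sup>2 * M) \<Longrightarrow> (\<integral>\<^sup>+x. ennreal (\<rho> x powr \<gamma>) \<partial>lebesgue) \<le> ennreal P \<Longrightarrow>
    self_energy newton \<rho> \<le> ennreal (C5 + \<epsilon>' * P)"
    using self_energy_newton_bound[where 'a="real^5", of \<gamma> "4 * pi * R\<^sup>2 * M" \<epsilon>'] \<gamma> m5 \<epsilon>' by (auto simp: DIM_5)
  show thesis
  proof (rule that[of "max C3 C5"])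
    show "max C3 C5 \<ge> 0" using C3 by simp
    fix \<rho> assume \<rho>: "\<rho> \<in> W_class_supp \<gamma> M R"
    note w = W_class_suppD[OF \<rho>]
    define P where "P = (LINT x|lebesgue. \<rho> x powr \<gamma>)"
    have P: "P \<ge> 0" unfolding P_def by (intro Bochner_Integration.integral_nonneg) simp
    note l = lift_integral_bounds[OF \<rho> order_refl, folded P_def]
    have "self_energy newton \<rho> \<le> ennreal (C3 + \<epsilon> * P)"
      by (rule b3[OF w(4) P nn_integral_le_of_LINT[OF w(3,2)] nn_integral_le_of_LINT[OF w(5)]]) (simp_all add: w(6) P_def)
    also have "\<dots> \<le> ennreal (max C3 C5 + \<epsilon> * P)" by (intro ennreal_leI) simp
    finally have 1: "self_energy newton \<rho> \<le> ennreal (max C3 C5 + \<epsilon> * P)" .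
    have "self_energy newton (\<lambda>y. \<rho> (fold5 y)) \<le> ennreal (C5 + \<epsilon>' * (4 * pi * R\<^sup>2 * P))"
      by (rule b5[OF measurable_fold5_comp[OF w(4)] _ nn_integral_le_of_LINT[OF l(1) AE_fold5[OF w(2)] l(2)] nn_integral_le_of_LINT[OF l(3) _ l(4)]])
        (use P in simp_all)
    also have "\<dots> \<le> ennreal (max C3 C5 + \<epsilon> * P)"
    proof (rule ennreal_leI)
      have "\<epsilon>' * (4 * pi * R\<^sup>2) \<le> \<epsilon>' * (4 * pi * R\<^sup>2 + 1)" using \<epsilon>' by (intro mult_left_mono) auto
      also have "\<dots> = \<epsilon>" using K by (simp add: \<epsilon>'_def)
      finally have "\<epsilon>' * (4 * pi * R\<^sup>2) * P \<le> \<epsilon> * P" using P by (rule mult_right_mono)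
      then show "C5 + \<epsilon>' * (4 * pi * R\<^sup>2 * P) \<le> max C3 C5 + \<epsilon> * P" by (simp add: mult.assoc)
    qed
    finally have 2: "self_energy newton (\<lambda>y. \<rho> (fold5 y)) \<le> ennreal (max C3 C5 + \<epsilon> * P)" .
    show "self_energy newton \<rho> \<le> ennreal (max C3 C5 + \<epsilon> * (LINT x|lebesgue. \<rho> x powr \<gamma>)) \<and>
      self_energy newton (\<lambda>y. \<rho> (fold5 y)) \<le> ennreal (max C3 C5 + \<epsilon> * (LINT x|lebesgue. \<rho> x powr \<gamma>))"
      using 1 2 by (simp add: P_def)
  qed
qed

lemma self_energy_finite:
  assumes M: "M \<ge> 0" and \<gamma>: "\<gamma> > 8/5" and \<rho>: "\<rho> \<in> W_class_supp \<gamma> M R"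
  shows "self_energy newton \<rho> < \<infinity>" "self_energy newton (\<lambda>y. \<rho> (fold5 y)) < \<infinity>"
proof -
  obtain C where "self_energy newton \<rho> \<le> ennreal (C + 1 * (LINT x|lebesgue. \<rho> x powr \<gamma>)) \<and>
      self_energy newton (\<lambda>y. \<rho> (fold5 y)) \<le> ennreal (C + 1 * (LINT x|lebesgue. \<rho> x powr \<gamma>))"
    using self_energy_bounds[OF M \<gamma> zero_less_one, of R] \<rho> by blast
  then show "self_energy newton \<rho> < \<infinity>" "self_energy newton (\<lambda>y. \<rho> (fold5 y)) < \<infinity>"
    by (auto intro: le_less_trans)
qed

lemma energy_of_W_class_supp:
  assumes M: "M \<ge> 0" and \<gamma>: "\<gamma> > 8/5" and \<rho>: "\<rho> \<in> W_class_supp \<gamma> M R"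
  shows "energy \<gamma> \<beta> \<rho> = (LINT x|lebesgue. \<rho> x powr \<gamma>) / (\<gamma> - 1) - 1/2 * enn2real (self_energy newton \<rho>)
    - mag_coeff \<beta> * enn2real (self_energy newton (\<lambda>y. \<rho> (fold5 y)))"
  using W_class_suppD[OF \<rho>] self_energy_finite[OF M \<gamma> \<rho>] by (intro energy_eq)

lemma energy_coercive:
  assumes M: "M \<ge> 0" and \<gamma>: "\<gamma> > 8/5"
  obtains C1 C2 where "C1 > 0" "C2 > 0"
    "\<And>\<rho>. \<rho> \<in> W_class_supp \<gamma> M R \<Longrightarrow> energy \<gamma> \<beta> \<rho> \<ge> C1 * (LINT x|lebesgue. \<rho> x powr \<gamma>) - C2"
proof -
  define a where "a = 1/2 + mag_coeff \<beta>"
  have a: "a > 0" using mag_coeff_nonneg[of \<beta>] by (simp add: a_def)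
  \<comment> \<open>chosen so that the self-energies use up half of the internal energy\<close>
  define \<epsilon> where "\<epsilon> = 1 / (2 * (\<gamma> - 1) * a)"
  have \<epsilon>: "\<epsilon> > 0" using a \<gamma> by (simp add: \<epsilon>_def)
  have a\<epsilon>: "a * \<epsilon> = 1 / (2 * (\<gamma> - 1))" using a by (simp add: \<epsilon>_def)
  obtain C where C: "C \<ge> 0" and b: "\<And>\<rho>. \<rho> \<in> W_class_supp \<gamma> M R \<Longrightarrow>
      self_energy newton \<rho> \<le> ennreal (C + \<epsilon> * (LINT x|lebesgue. \<rho> x powr \<gamma>)) \<and>
      self_energy newton (\<lambda>y. \<rho> (fold5 y)) \<le> ennreal (C + \<epsilon> * (LINT x|lebesgue. \<rho> x powr \<gamma>))"
    by (rule self_energy_bounds[OF M \<gamma> \<epsilon>]) (rule that, blast+)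
  show thesis
  proof (rule that[of "1 / (2 * (\<gamma> - 1))" "a * C + 1"])
    show "1 / (2 * (\<gamma> - 1)) > 0" using \<gamma> by simp
    show "a * C + 1 > 0" using a C by (simp add: add_nonneg_pos)
    fix \<rho> assume \<rho>: "\<rho> \<in> W_class_supp \<gamma> M R"
    define P where "P = (LINT x|lebesgue. \<rho> x powr \<gamma>)"
    have P: "P \<ge> 0" unfolding P_def by (intro Bochner_Integration.integral_nonneg) simp
    have nn: "C + \<epsilon> * P \<ge> 0" using C \<epsilon> P by simp
    have e3: "enn2real (self_energy newton \<rho>) \<le> C + \<epsilon> * P"
      using enn2real_mono[of "self_energy newton \<rho>" "ennreal (C + \<epsilon> * P)"] b[OF \<rho>] nn by (simp add: P_def)
    have e5: "enn2real (self_energy newton (\<lambda>y. \<rho> (fold5 y))) \<le> C + \<epsilon> * P"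
      using enn2real_mono[of "self_energy newton (\<lambda>y. \<rho> (fold5 y))" "ennreal (C + \<epsilon> * P)"] b[OF \<rho>] nn by (simp add: P_def)
    have "1/2 * enn2real (self_energy newton \<rho>) + mag_coeff \<beta> * enn2real (self_energy newton (\<lambda>y. \<rho> (fold5 y)))
        \<le> 1/2 * (C + \<epsilon> * P) + mag_coeff \<beta> * (C + \<epsilon> * P)"
      using e3 e5 mag_coeff_nonneg by (intro add_mono mult_left_mono) auto
    also have "\<dots> = a * C + a * \<epsilon> * P" by (simp add: a_def algebra_simps)
    also have "\<dots> = a * C + 1 / (2 * (\<gamma> - 1)) * P" unfolding a\<epsilon> ..
    finally have "energy \<gamma> \<beta> \<rho> \<ge> P / (\<gamma> - 1) - (a * C + 1 / (2 * (\<gamma> - 1)) * P)"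
      unfolding energy_of_W_class_supp[OF M \<gamma> \<rho>] P_def[symmetric] by linarith
    moreover have "P / h = 1 / (2 * h) * P + 1 / (2 * h) * P" for h
      by simp
    note this[of "\<gamma> - 1"]
    ultimately show "energy \<gamma> \<beta> \<rho> \<ge> 1 / (2 * (\<gamma> - 1)) * (LINT x|lebesgue. \<rho> x powr \<gamma>) - (a * C + 1)"
      unfolding P_def[symmetric] by linarith
  qed
qed

lemma W_class_supp_subset_X_class:
  assumes M: "M \<ge> 0" and \<gamma>: "\<gamma> > 8/5" and \<rho>: "\<rho> \<in> W_class_supp \<gamma> M R"
  shows "\<rho> \<in> X_class \<gamma> M"
  using W_class_suppD[OF \<rho>] energy_nonmag_eq(2)[OF W_class_suppD(4,2,5)[OF \<rho>] self_energy_finite(1)[OF M \<gamma> \<rho>]]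
  by (simp add: X_class_def)

section \<open>Densities of negative energy\<close>

lemma ball_density_in_W:
  assumes M: "M > 0" and t: "t > 0"
  defines "V \<equiv> measure lebesgue (ball (0::real^3) t)"
  shows "(\<lambda>x. M / V * indicator (ball 0 t) x) \<in> W_class_supp \<gamma> M t"
    and "V > 0" and "(LINT x|lebesgue. (M / V * indicator (ball (0::real^3) t) x) powr \<gamma>) = (M / V) powr \<gamma> * V"
proof -
  show V: "V > 0" unfolding V_def using t by (simp add: content_ball_pos)
  have i: "integrable lebesgue (indicator (ball (0::real^3) t) :: _ \<Rightarrow> real)"
    using emeasure_lborel_ball_finite[of "0::real^3" t] by (simp add: integrable_indicator_iff)
  have p: "(M / V * indicator (ball 0 t) x) powr \<gamma> = (M / V) powr \<gamma> * indicator (ball 0 t) x" for x :: "real^3"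
    by (simp add: indicator_def)
  have int1: "(LINT x|lebesgue. indicator (ball (0::real^3) t) x) = V" unfolding V_def by simp
  show "(LINT x|lebesgue. (M / V * indicator (ball (0::real^3) t) x) powr \<gamma>) = (M / V) powr \<gamma> * V"
    unfolding p using int1 by simp
  have ax: "axisymmetric (\<lambda>x. M / V * indicator (ball 0 t) x)"
  proof (rule axisymmetricI)
    fix x x' :: "real^3" assume x: "cyl_radius x = cyl_radius x'" "x $ 3 = x' $ 3"
    show "M / V * indicator (ball 0 t) x = M / V * indicator (ball 0 t) x'"
      using norm_eq_of_cyl_radius[OF x] by (simp add: indicator_def)
  qed
  show "(\<lambda>x. M / V * indicator (ball 0 t) x) \<in> W_class_supp \<gamma> M t"
    unfolding W_class_supp_iff p
  proof (intro conjI ax)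
    show "integrable lebesgue (\<lambda>x. M / V * indicator (ball (0::real^3) t) x)"
      "integrable lebesgue (\<lambda>x. (M / V) powr \<gamma> * indicator (ball (0::real^3) t) x)"
      by (rule Bochner_Integration.integrable_mult_right[OF i])+
    show "AE x in lebesgue. 0 \<le> M / V * indicator (ball (0::real^3) t) x" using V M by simp
    show "(LINT x|lebesgue. M / V * indicator (ball (0::real^3) t) x) = M" using V int1 by simp
    show "\<forall>x. t \<le> norm x \<longrightarrow> M / V * indicator (ball (0::real^3) t) x = 0" by simp
  qed
qed

text \<open>
  Two points of the support are at distance at most \<open>2 * t\<close>.
\<close>

lemma self_energy_ge_diameter:
  fixes \<rho> :: "real^3 \<Rightarrow> real"
  assumes [measurable]: "\<rho> \<in> borel_measurable lebesgue" and t: "t > 0" and supp: "\<And>x. t \<le> norm x \<Longrightarrow> \<rho> x = 0"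
  shows "self_energy newton \<rho> \<ge> (\<integral>\<^sup>+x. ennreal (\<rho> x) \<partial>lebesgue) * (\<integral>\<^sup>+x. ennreal (\<rho> x) \<partial>lebesgue) * ennreal (1 / (2 * t))"
proof -
  have "(\<integral>\<^sup>+x. ennreal (\<rho> x) \<partial>lebesgue) * (\<integral>\<^sup>+x. ennreal (\<rho> x) \<partial>lebesgue) * ennreal (1 / (2 * t)) =
    (\<integral>\<^sup>+x. \<integral>\<^sup>+y. ennreal (\<rho> x) * ennreal (\<rho> y) * ennreal (1 / (2 * t)) \<partial>lebesgue \<partial>lebesgue)"
    by (simp add: nn_integral_cmult nn_integral_multc)
  also have "\<dots> \<le> self_energy newton \<rho>"
    unfolding self_energy_def
  proof (rule nn_integral_mono, rule nn_integral_mono_AE)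
    fix x :: "real^3"
    \<comment> \<open>the kernel is 0 on the diagonal, where the lower bound fails\<close>
    have "AE y in lebesgue. y \<noteq> x" by (rule AE_completion[OF AE_lborel_singleton])
    then show "AE y in lebesgue. ennreal (\<rho> x) * ennreal (\<rho> y) * ennreal (1 / (2 * t)) \<le>
      ennreal (\<rho> x) * ennreal (\<rho> y) * ennreal (newton (x - y))"
    proof eventually_elim
      case (elim y)
      show ?case
      proof (cases "norm x < t \<and> norm y < t")
        case True
        then have "norm (x - y) \<le> 2 * t" using norm_triangle_ineq4[of x y] by linarith
        then have "1 / (2 * t) \<le> newton (x - y)"
          unfolding newton_3 using elim t by (intro divide_left_mono) auto
        then show ?thesis by (intro mult_left_mono ennreal_leI) auto
      next
        case False
        then show ?thesis using supp[of x] supp[of y] by (auto simp: not_less)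
      qed
    qed
  qed
  finally show ?thesis .
qed

text \<open>
  Uniform balls of mass \<open>M\<close> and radius \<open>t\<close>: the internal energy is of order \<open>t powr (3 - 3 * \<gamma>)\<close> and the
  gravitational energy at least of order \<open>1 / t\<close>, which dominates for large \<open>t\<close> as \<open>\<gamma> > 4/3\<close>.
\<close>

lemma energy_nonmag_negative:
  assumes M: "M > 0" and \<gamma>: "\<gamma> > 8/5"
  obtains \<rho> where "\<rho> \<in> X_class \<gamma> M" "energy_nonmag \<gamma> \<rho> < 0"
proof -
  define V1 where "V1 = unit_ball_vol 3"
  have V1: "V1 > 0" by (simp add: V1_def)
  define K where "K = (M / V1) powr \<gamma> * V1 / (\<gamma> - 1)"
  have "((\<lambda>t. K * t powr (- (3 * \<gamma> - 4))) \<longlongrightarrow> K * 0) at_top"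
    using \<gamma> by (intro tendsto_intros powr_neg_tendsto_0) auto
  then have "eventually (\<lambda>t. K * t powr (- (3 * \<gamma> - 4)) < M\<^sup>2 / 4) at_top"
    using M by (intro order_tendstoD) auto
  then have "eventually (\<lambda>t. K * t powr (- (3 * \<gamma> - 4)) < M\<^sup>2 / 4 \<and> t > 0) at_top"
    using eventually_gt_at_top[of 0] by eventually_elim auto
  then obtain t where t: "K * t powr (- (3 * \<gamma> - 4)) < M\<^sup>2 / 4" "t > 0"
    by (auto simp: eventually_at_top_linorder)
  define V where "V = measure lebesgue (ball (0::real^3) t)"
  have V: "V = V1 * t ^ 3"
    using content_ball[of t "0::real^3"] t(2) by (simp add: V_def V1_def)
  define \<rho> where "\<rho> = (\<lambda>x. M / V * indicator (ball (0::real^3) t) x)"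
  have \<rho>: "\<rho> \<in> W_class_supp \<gamma> M t" using ball_density_in_W(1)[OF M t(2)] by (simp add: \<rho>_def V_def)
  have Vp: "V > 0" using V V1 t(2) by simp
  have pw: "(LINT x|lebesgue. \<rho> x powr \<gamma>) = (M / V) powr \<gamma> * V"
    using ball_density_in_W(3)[OF M t(2)] by (simp add: \<rho>_def V_def)
  note w = W_class_suppD[OF \<rho>]
  have M0: "M \<ge> 0" using M by simp
  have mass: "(\<integral>\<^sup>+x. ennreal (\<rho> x) \<partial>lebesgue) = ennreal M"
    using nn_integral_eq_integral[OF w(3,2)] w(6) by simp
  have fin: "self_energy newton \<rho> < \<infinity>" by (rule self_energy_finite(1)[OF M0 \<gamma> \<rho>])
  have "ennreal (M\<^sup>2 / (2 * t)) = ennreal M * ennreal M * ennreal (1 / (2 * t))"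
    using M t(2) by (simp add: ennreal_mult[symmetric] power2_eq_square)
  also have "\<dots> \<le> self_energy newton \<rho>"
    using self_energy_ge_diameter[OF w(4) t(2) w(7)] unfolding mass by simp
  finally have "M\<^sup>2 / (2 * t) \<le> enn2real (self_energy newton \<rho>)"
    using fin M t(2) by (metis enn2real_ennreal enn2real_mono less_imp_le divide_nonneg_pos infinity_ennreal_def
        mult_pos_pos zero_le_power2 zero_less_numeral)
  moreover have "(M / V) powr \<gamma> * V / (\<gamma> - 1) < M\<^sup>2 / (4 * t)"
  proof -
    have t3: "t ^ 3 = t powr 3" using t(2) by (simp add: powr_numeral)
    have "(M / V) powr \<gamma> = (M / V1) powr \<gamma> * t powr (- (3 * \<gamma>))"
    proof -
      have "M / V = (M / V1) * t powr (- 3)"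
        unfolding V t3 powr_minus_divide by simp
      then have "(M / V) powr \<gamma> = (M / V1) powr \<gamma> * (t powr (- 3)) powr \<gamma>"
        using M V1 by (simp only: powr_mult)
      then show ?thesis by (simp add: powr_powr)
    qed
    then have "(M / V) powr \<gamma> * V / (\<gamma> - 1) = K * (t powr (- (3 * \<gamma>)) * t powr 3)"
      unfolding V t3 K_def by simp
    also have "t powr (- (3 * \<gamma>)) * t powr 3 = t powr (- (3 * \<gamma> - 4)) * t powr (- 1)"
      unfolding powr_add[symmetric] by (rule arg_cong[where f="\<lambda>x. t powr x"]) simp
    also have "t powr (- 1) = 1 / t" using t(2) by (simp add: powr_minus_divide)
    also have "K * (t powr (- (3 * \<gamma> - 4)) * (1 / t)) = (K * t powr (- (3 * \<gamma> - 4))) / t" by simp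
    also have "\<dots> < (M\<^sup>2 / 4) / t" using t by (intro divide_strict_right_mono)
    finally show ?thesis by simp
  qed
  ultimately have "energy_nonmag \<gamma> \<rho> < 0"
    unfolding energy_nonmag_eq(1)[OF w(4,2,5) fin] pw by simp
  then show thesis using W_class_supp_subset_X_class[OF M0 \<gamma> \<rho>] by (rule that[rotated])
qed

text \<open>
  The star minimizes the non-magnetic energy over the whole class, in particular against the uniform balls, although those
  may be larger than the ball of radius \<open>Rmax\<close>.
\<close>

lemma star_energy_negative:
  assumes M: "M > 0" and \<gamma>: "\<gamma> > 8/5" and star: "star_radius \<gamma> M R\<^sub>M" and R: "Rmax \<ge> R\<^sub>M"
  obtains \<rho> where "\<rho> \<in> W_class_supp \<gamma> M Rmax" "energy \<gamma> \<beta> \<rho> < 0"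
proof -
  obtain \<rho> where min: "is_arg_min (energy_nonmag \<gamma>) (\<lambda>\<sigma>. \<sigma> \<in> X_class \<gamma> M) \<rho>" and rad: "radial \<rho>"
    and supp: "\<And>x. R\<^sub>M \<le> norm x \<Longrightarrow> \<rho> x = 0"
    using star unfolding star_radius_def by blast
  have M0: "M \<ge> 0" using M by simp
  have X: "\<rho> \<in> X_class \<gamma> M" using min by (simp add: is_arg_min_def)
  have neg: "energy_nonmag \<gamma> \<rho> < 0"
  proof -
    obtain \<sigma> where "\<sigma> \<in> X_class \<gamma> M" "energy_nonmag \<gamma> \<sigma> < 0" by (rule energy_nonmag_negative[OF M \<gamma>])
    then show ?thesis using min unfolding is_arg_min_def by (meson less_le_trans not_less le_less_trans)
  qed
  have nn: "AE x in lebesgue. 0 \<le> \<rho> x" and i: "integrable lebesgue \<rho>" and m: "(LINT x|lebesgue. \<rho> x) = M"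
    and iE: "integrable lebesgue (\<lambda>x. internal_energy \<gamma> (\<rho> x) + 1/2 * \<rho> x * grav_potential \<rho> x)"
    using X by (simp_all add: X_class_def)
  note [measurable] = borel_measurable_integrable[OF i]
  have iA: "integrable lebesgue (\<lambda>x. \<rho> x powr \<gamma>)"
  proof (rule Bochner_Integration.integrable_bound)
    show "integrable lebesgue (\<lambda>x. (\<gamma> - 1) * (internal_energy \<gamma> (\<rho> x) + 1/2 * \<rho> x * grav_potential \<rho> x))"
      using iE by (rule Bochner_Integration.integrable_mult_right)
    show "(\<lambda>x. \<rho> x powr \<gamma>) \<in> borel_measurable lebesgue" by measurable
    show "AE x in lebesgue. norm (\<rho> x powr \<gamma>) \<le>
        norm ((\<gamma> - 1) * (internal_energy \<gamma> (\<rho> x) + 1/2 * \<rho> x * grav_potential \<rho> x))"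
      using nn
    proof eventually_elim
      case (elim x)
      have G: "grav_potential \<rho> x \<ge> 0"
        unfolding grav_potential_def using nn by (intro integral_nonneg_AE) (auto elim!: eventually_mono)
      have "\<rho> x powr \<gamma> = (\<gamma> - 1) * internal_energy \<gamma> (\<rho> x)"
        using \<gamma> by (simp add: internal_energy_def pressure_def)
      also have "\<dots> \<le> (\<gamma> - 1) * (internal_energy \<gamma> (\<rho> x) + 1/2 * \<rho> x * grav_potential \<rho> x)"
        using \<gamma> elim G by (intro mult_left_mono) auto
      finally show ?case by simp
    qed
  qed
  have ax: "axisymmetric \<rho>"
  proof (rule axisymmetricI)
    fix x x' :: "real^3" assume "cyl_radius x = cyl_radius x'" "x $ 3 = x' $ 3"
    then have "norm x = norm x'" by (rule norm_eq_of_cyl_radius)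
    then show "\<rho> x = \<rho> x'" using rad unfolding radial_def by metis
  qed
  have \<rho>: "\<rho> \<in> W_class_supp \<gamma> M Rmax"
    unfolding W_class_supp_iff using ax nn i iA m supp R by (meson order_trans)
  have "energy \<gamma> \<beta> \<rho> \<le> energy_nonmag \<gamma> \<rho>"
    unfolding energy_of_W_class_supp[OF M0 \<gamma> \<rho>] energy_nonmag_eq(1)[OF W_class_suppD(4,2,5)[OF \<rho>] self_energy_finite(1)[OF M0 \<gamma> \<rho>]]
    using mag_coeff_nonneg[of \<beta>] by simp
  with neg have "energy \<gamma> \<beta> \<rho> < 0" by simp
  with \<rho> show thesis by (rule that)
qed

section \<open>Translation and lower semicontinuity of the energy\<close>

lemma W_class_supp_translation:
  assumes \<rho>: "\<rho> \<in> W_class_supp \<gamma> M R" and a: "\<bar>a\<bar> \<le> b"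
  shows "(\<lambda>x. \<rho> (x + a *\<^sub>R e3)) \<in> W_class_supp \<gamma> M (R + b)"
proof -
  note w = W_class_suppD[OF \<rho>]
  have ax: "axisymmetric (\<lambda>x. \<rho> (x + a *\<^sub>R e3))"
  proof (rule axisymmetricI)
    fix x x' :: "real^3" assume "cyl_radius x = cyl_radius x'" "x $ 3 = x' $ 3"
    then show "\<rho> (x + a *\<^sub>R e3) = \<rho> (x' + a *\<^sub>R e3)"
      by (intro axisymmetricD[OF w(1)]) (simp_all add: cyl_radius_def e3_def axis_def)
  qed
  have pm: "(\<lambda>x. \<rho> x powr \<gamma>) \<in> borel_measurable lebesgue" using w(5) by simp
  have supp: "\<rho> (x + a *\<^sub>R e3) = 0" if "R + b \<le> norm x" for x
  proof (rule w(7))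
    have "norm (a *\<^sub>R e3) = \<bar>a\<bar>" by (simp add: e3_def)
    then show "R \<le> norm (x + a *\<^sub>R e3)" using norm_diff_ineq[of x "a *\<^sub>R e3"] that a by linarith
  qed
  show ?thesis
    unfolding W_class_supp_iff
    using ax lebesgue_translation(4)[OF w(4,2)] lebesgue_translation(3)[OF w(4)] lebesgue_translation(3)[OF pm]
      lebesgue_translation(2)[OF w(4)] w supp by simp
qed

lemma energy_translation:
  assumes M: "M \<ge> 0" and \<gamma>: "\<gamma> > 8/5" and \<rho>: "\<rho> \<in> W_class_supp \<gamma> M R"
  shows "energy \<gamma> \<beta> (\<lambda>x. \<rho> (x + a *\<^sub>R e3)) = energy \<gamma> \<beta> \<rho>"
    and "(LINT x|lebesgue. \<rho> (x + a *\<^sub>R e3) powr \<gamma>) = (LINT x|lebesgue. \<rho> x powr \<gamma>)"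
proof -
  note w = W_class_suppD[OF \<rho>]
  have pm: "(\<lambda>x. \<rho> x powr \<gamma>) \<in> borel_measurable lebesgue" using w(5) by simp
  show p: "(LINT x|lebesgue. \<rho> (x + a *\<^sub>R e3) powr \<gamma>) = (LINT x|lebesgue. \<rho> x powr \<gamma>)"
    by (rule lebesgue_translation(2)[OF pm])
  show "energy \<gamma> \<beta> (\<lambda>x. \<rho> (x + a *\<^sub>R e3)) = energy \<gamma> \<beta> \<rho>"
    unfolding energy_of_W_class_supp[OF M \<gamma> \<rho>] energy_of_W_class_supp[OF M \<gamma> W_class_supp_translation[OF \<rho> order_refl]] p
      self_energy_translation[OF w(4) newton_measurable] self_energy_lift_translation[OF w(4)] ..
qed

text \<open>
  The convex internal energy is lower semicontinuous and the two subtracted self-energies are upper semicontinuous.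
\<close>

lemma energy_lower_semicontinuous:
  assumes M: "M \<ge> 0" and \<gamma>: "\<gamma> > 8/5"
    and \<sigma>: "\<And>i. \<sigma> i \<in> W_class_supp \<gamma> M R" and \<tau>: "\<tau> \<in> W_class_supp \<gamma> M R"
    and P: "\<And>i. (LINT x|lebesgue. \<sigma> i x powr \<gamma>) \<le> P"
    and weak: "weakly_converges_Lp \<gamma> \<sigma> \<tau>" and \<epsilon>: "\<epsilon> > 0"
  shows "eventually (\<lambda>i. energy \<gamma> \<beta> \<tau> \<le> energy \<gamma> \<beta> (\<sigma> i) + \<epsilon>) sequentially"
proof -
  have \<gamma>1: "\<gamma> > 1" using \<gamma> by simp
  note w = W_class_suppD[OF \<sigma>] and v = W_class_suppD[OF \<tau>]
  have wk: "(\<lambda>i. LINT x|lebesgue. \<sigma> i x * \<phi> x) \<longlonglongrightarrow> (LINT x|lebesgue. \<tau> x * \<phi> x)"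
    if "\<phi> \<in> borel_measurable lebesgue" "integrable lebesgue (\<lambda>x. \<bar>\<phi> x\<bar> powr (\<gamma> / (\<gamma> - 1)))" for \<phi>
    using weak that unfolding weakly_converges_Lp_def Lp_fun_def by blast
  have wkb: "(\<lambda>i. LINT x|lebesgue. \<sigma> i x * \<phi> x) \<longlonglongrightarrow> (LINT x|lebesgue. \<tau> x * \<phi> x)"
    if \<phi>: "\<phi> \<in> borel_measurable borel" and b: "\<And>x. \<bar>\<phi> x\<bar> \<le> B" for \<phi> :: "real^3 \<Rightarrow> real" and B
  proof -
    define \<psi> where "\<psi> = (\<lambda>x. \<phi> x * indicator (ball 0 R) x)"
    have ball: "ball (0::real^3) R \<in> sets lebesgue" by simp
    have \<psi>m: "\<psi> \<in> borel_measurable lebesgue"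
      unfolding \<psi>_def by (intro borel_measurable_times borel_imp_lebesgue_measurable[OF \<phi>] borel_measurable_indicator[OF ball])
    have q: "integrable lebesgue (\<lambda>x. \<bar>\<psi> x\<bar> powr (\<gamma> / (\<gamma> - 1)))"
    proof (rule Bochner_Integration.integrable_bound)
      show "integrable lebesgue (\<lambda>x. B powr (\<gamma> / (\<gamma> - 1)) * indicator (ball (0::real^3) R) x)"
        using emeasure_lborel_ball_finite[of "0::real^3" R]
        by (intro Bochner_Integration.integrable_mult_right) (simp add: integrable_indicator_iff)
      show "(\<lambda>x. \<bar>\<psi> x\<bar> powr (\<gamma> / (\<gamma> - 1))) \<in> borel_measurable lebesgue" using \<psi>m by measurable
      show "AE x in lebesgue. norm (\<bar>\<psi> x\<bar> powr (\<gamma> / (\<gamma> - 1))) \<le> norm (B powr (\<gamma> / (\<gamma> - 1)) * indicator (ball 0 R) x)"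
        using b \<gamma>1 by (intro AE_I2) (auto simp: \<psi>_def intro!: powr_mono2 split: split_indicator)
    qed
    have eq: "(LINT x|lebesgue. f x * \<psi> x) = (LINT x|lebesgue. f x * \<phi> x)" if "\<And>x. R \<le> norm x \<Longrightarrow> f x = 0" for f
      using that by (intro Bochner_Integration.integral_cong) (auto simp: \<psi>_def indicator_def not_less)
    have e1: "(LINT x|lebesgue. \<sigma> i x * \<psi> x) = (LINT x|lebesgue. \<sigma> i x * \<phi> x)" for i by (rule eq[OF w(7)])
    have e2: "(LINT x|lebesgue. \<tau> x * \<psi> x) = (LINT x|lebesgue. \<tau> x * \<phi> x)" by (rule eq[OF v(7)])
    show ?thesis using wk[OF \<psi>m q] unfolding e1 e2 .
  qed
  define c where "c = 3/2 + mag_coeff \<beta>"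
  have c: "c > 0" using mag_coeff_nonneg[of \<beta>] by (simp add: c_def)
  \<comment> \<open>an error \<open>\<delta>\<close> in each of the three terms of the energy costs at most \<open>\<epsilon>\<close> in total\<close>
  define \<delta> where "\<delta> = \<epsilon> / (c + 1 / (\<gamma> - 1))"
  have \<delta>: "\<delta> > 0" using \<epsilon> c \<gamma>1 by (simp add: \<delta>_def add_pos_pos)
  have \<delta>c: "\<delta> * (c + 1 / (\<gamma> - 1)) = \<epsilon>"
  proof -
    have "c + 1 / (\<gamma> - 1) > 0" using c \<gamma>1 by (simp add: add_pos_pos)
    then show ?thesis by (simp add: \<delta>_def)
  qed
  have lp: "eventually (\<lambda>i. (LINT x|lebesgue. \<tau> x powr \<gamma>) - \<delta> \<le> (LINT x|lebesgue. \<sigma> i x powr \<gamma>)) sequentially"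
    by (rule powr_integral_lower_semicontinuous[OF \<gamma>1 w(4,2,5) v(4,2,5) wk \<delta>])
  have g3: "\<gamma> > 2 - 2 / real DIM(real^3)" and g5: "\<gamma> > 2 - 2 / real DIM(real^5)"
    using \<gamma> by (simp_all add: DIM_3 DIM_5)
  have n3: "DIM(real^3) \<ge> 2" and n5: "DIM(real^5) \<ge> 2" by (simp_all add: DIM_3 DIM_5)
  have u3: "eventually (\<lambda>i. enn2real (self_energy newton (\<sigma> i)) \<le> enn2real (self_energy newton \<tau>) + \<delta>) sequentially"
    by (rule self_energy_newton_usc[OF n3 g3 w(3,2,7) eq_refl[OF w(6)] w(5) P v(3,2) self_energy_finite(1)[OF M \<gamma> \<tau>] wkb \<delta>])
  note l = lift_integral_bounds[OF \<sigma> P]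
  have u5: "eventually (\<lambda>i. enn2real (self_energy newton (\<lambda>y. \<sigma> i (fold5 y))) \<le>
      enn2real (self_energy newton (\<lambda>y. \<tau> (fold5 y))) + \<delta>) sequentially"
  proof (rule self_energy_newton_usc[where \<sigma>="\<lambda>i y. \<sigma> i (fold5 y)" and R=R, OF n5 g5 l(1) AE_fold5[OF w(2)] _ l(2,3,4)
        lift_integral_bounds(1)[OF \<tau> order_refl] AE_fold5[OF v(2)] self_energy_finite(2)[OF M \<gamma> \<tau>] _ \<delta>])
    show "\<sigma> i (fold5 y) = 0" if "R \<le> norm y" for i y
      using that by (intro w(7)) (simp add: norm_fold5)
    show "(\<lambda>i. LINT x|lebesgue. \<sigma> i (fold5 x) * \<phi> x) \<longlonglongrightarrow> (LINT x|lebesgue. \<tau> (fold5 x) * \<phi> x)"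
      if "\<phi> \<in> borel_measurable borel" "\<And>x. \<bar>\<phi> x\<bar> \<le> B" for \<phi> B
      by (rule fold5_weak_convergence[OF w(3,2,7) v(3,2,7) wkb that])
  qed
  show ?thesis
    using lp u3 u5
  proof eventually_elim
    case (elim i)
    have "(LINT x|lebesgue. \<tau> x powr \<gamma>) / (\<gamma> - 1) \<le> (LINT x|lebesgue. \<sigma> i x powr \<gamma>) / (\<gamma> - 1) + \<delta> / (\<gamma> - 1)"
      using elim(1) \<gamma>1 by (simp add: divide_right_mono flip: add_divide_distrib)
    moreover have "mag_coeff \<beta> * enn2real (self_energy newton (\<lambda>y. \<sigma> i (fold5 y))) \<le>
        mag_coeff \<beta> * enn2real (self_energy newton (\<lambda>y. \<tau> (fold5 y))) + mag_coeff \<beta> * \<delta>"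
      using mult_left_mono[OF elim(3) mag_coeff_nonneg[of \<beta>]] by (simp add: distrib_left)
    moreover have "\<delta> / (\<gamma> - 1) + 1/2 * \<delta> + mag_coeff \<beta> * \<delta> \<le> \<epsilon>"
    proof -
      have "\<delta> / (\<gamma> - 1) + 1/2 * \<delta> + mag_coeff \<beta> * \<delta> \<le> \<delta> * (c + 1 / (\<gamma> - 1))"
        using \<delta> by (simp add: c_def algebra_simps)
      then show ?thesis unfolding \<delta>c .
    qed
    ultimately show ?case
      unfolding energy_of_W_class_supp[OF M \<gamma> \<sigma>] energy_of_W_class_supp[OF M \<gamma> \<tau>] using elim(2) by linarith
  qed
qed

section \<open>Minimizing sequences\<close>

lemma minimizing_sequence_bounded:
  assumes min: "minimizing_sequence (energy \<gamma> \<beta>) (W_class_supp \<gamma> M R) \<rho>" and C1: "C1 > 0"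
    and coer: "\<And>\<rho>. \<rho> \<in> W_class_supp \<gamma> M R \<Longrightarrow> energy \<gamma> \<beta> \<rho> \<ge> C1 * (LINT x|lebesgue. \<rho> x powr \<gamma>) - C2"
  obtains P where "\<And>i. (LINT x|lebesgue. \<rho> i x powr \<gamma>) \<le> P"
proof -
  have "Bseq (\<lambda>i. energy \<gamma> \<beta> (\<rho> i))"
    using min unfolding minimizing_sequence_def by (intro convergent_imp_Bseq) (auto simp: convergent_def)
  then obtain K where K: "\<And>i. \<bar>energy \<gamma> \<beta> (\<rho> i)\<bar> \<le> K" unfolding Bseq_def by auto
  show thesis
  proof (rule that[of "(K + C2) / C1"])
    fix i
    have "\<rho> i \<in> W_class_supp \<gamma> M R" using min by (simp add: minimizing_sequence_def)
    from coer[OF this] K[of i] have "C1 * (LINT x|lebesgue. \<rho> i x powr \<gamma>) \<le> K + C2" by linarith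
    then show "(LINT x|lebesgue. \<rho> i x powr \<gamma>) \<le> (K + C2) / C1" using C1 by (simp add: field_simps)
  qed
qed

text \<open>
  All densities vanish outside one ball, so tightness holds with the shifts equal to zero.
\<close>

lemma minimizing_sequence_weak_limit:
  assumes M: "M > 0" and \<gamma>: "\<gamma> > 1" and R: "R > 0"
    and \<rho>: "\<And>i. \<rho> i \<in> W_class_supp \<gamma> M R" and P: "\<And>i. (LINT x|lebesgue. \<rho> i x powr \<gamma>) \<le> P"
  obtains s w where "shifted_weak_limit \<gamma> M R \<rho> (\<lambda>_. 0) s w"
proof -
  note r = W_class_suppD[OF \<rho>]
  interpret B: bounded_Lp_sequence \<rho> \<gamma> R M P
    by unfold_locales (use r P \<gamma> in auto)
  obtain s u where s: "strict_mono s" and u: "u \<in> borel_measurable borel" "\<And>x. 0 \<le> u x" "integrable lebesgue u"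
    "\<And>x. R \<le> norm x \<Longrightarrow> u x = 0"
    and up: "integrable lebesgue (\<lambda>x. u x powr \<gamma>)" "(LINT x|lebesgue. u x powr \<gamma>) \<le> P"
    and weak: "\<And>\<phi> B. \<phi> \<in> borel_measurable borel \<Longrightarrow> (\<And>x. \<bar>\<phi> x\<bar> \<le> B) \<Longrightarrow>
       (\<lambda>i. LINT x|lebesgue. \<rho> (s i) x * \<phi> x) \<longlonglongrightarrow> (LINT x|lebesgue. u x * \<phi> x)"
    by (rule B.weakly_convergent_subsequence) (rule that, blast+)
  obtain w where w: "axisymmetric w" "w \<in> borel_measurable lebesgue" "\<And>x. R \<le> norm x \<Longrightarrow> w x = 0" "AE x in lebesgue. u x = w x"
    by (rule axisymmetric_weak_limit[where \<sigma>="\<lambda>i. \<rho> (s i)" and u=u and R=R, OF r(3) r(1) u(3,4) weak]) (assumption+, rule that, blast+)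
  have uL: "u \<in> borel_measurable lebesgue" using u(3) by simp
  have wnn: "AE x in lebesgue. 0 \<le> w x" using w(4) by eventually_elim (use u(2) in metis)
  have wi: "integrable lebesgue w" using integrable_cong_AE[OF uL w(2) w(4)] u(3) by simp
  note [measurable] = uL w(2)
  have aep: "AE x in lebesgue. u x powr \<gamma> = w x powr \<gamma>" using w(4) by eventually_elim simp
  have wp: "integrable lebesgue (\<lambda>x. w x powr \<gamma>)"
    using integrable_cong_AE[OF _ _ aep] up(1) by simp
  have wpb: "(LINT x|lebesgue. w x powr \<gamma>) \<le> P"
    using integral_cong_AE[OF _ _ aep] up(2) by simp
  have weakw: "(\<lambda>i. LINT x|lebesgue. \<rho> (s i) x * \<phi> x) \<longlonglongrightarrow> (LINT x|lebesgue. w x * \<phi> x)"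
    if \<phi>: "\<phi> \<in> borel_measurable borel" "\<And>x. \<bar>\<phi> x\<bar> \<le> B" for \<phi> B
  proof -
    note [measurable] = borel_imp_lebesgue_measurable[OF \<phi>(1)]
    have "(LINT x|lebesgue. u x * \<phi> x) = (LINT x|lebesgue. w x * \<phi> x)"
    proof (rule integral_cong_AE)
      show "AE x in lebesgue. u x * \<phi> x = w x * \<phi> x" using w(4) by eventually_elim simp
    qed measurable
    then show ?thesis using weak[OF \<phi>] by simp
  qed
  have mass: "(LINT x|lebesgue. w x) = M"
    using weakw[of "\<lambda>_. 1" 1] r(6) by (simp add: LIMSEQ_const_iff)
  have W: "w \<in> W_class_supp \<gamma> M R"
    unfolding W_class_supp_iff using w wnn wi wp mass by auto
  have Lp: "Lp_fun \<gamma> (\<rho> i)" for i using Lp_fun_nonneg_iff[OF r(2)] r(4,5) by simp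
  have Lpw: "Lp_fun \<gamma> w" using Lp_fun_nonneg_iff[OF wnn] w(2) wp by simp
  have "weakly_converges_Lp \<gamma> (\<lambda>i x. \<rho> (s i) (x + 0 *\<^sub>R e3)) w"
    unfolding weakly_converges_Lp_def
  proof (intro conjI allI impI)
    show "Lp_fun \<gamma> (\<lambda>x. \<rho> (s i) (x + 0 *\<^sub>R e3))" for i using Lp by simp
    show "Lp_fun \<gamma> w" by (rule Lpw)
    fix \<phi> assume "Lp_fun (\<gamma> / (\<gamma> - 1)) \<phi>"
    then have \<phi>: "\<phi> \<in> borel_measurable lebesgue" "integrable lebesgue (\<lambda>x. \<bar>\<phi> x\<bar> powr (\<gamma> / (\<gamma> - 1)))"
      by (simp_all add: Lp_fun_def)
    have "(\<lambda>i. LINT x|lebesgue. \<rho> (s i) x * \<phi> x) \<longlonglongrightarrow> (LINT x|lebesgue. w x * \<phi> x)"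
      by (rule weak_convergence_Lp[where \<sigma>="\<lambda>i. \<rho> (s i)" and u=w and P=P, OF \<gamma> r(3) r(2) r(5) P wi wnn wp wpb weakw \<phi>])
    then show "(\<lambda>i. LINT x|lebesgue. \<rho> (s i) (x + 0 *\<^sub>R e3) * \<phi> x) \<longlonglongrightarrow> (LINT x|lebesgue. w x * \<phi> x)" by simp
  qed
  moreover have "\<exists>R'>0. \<forall>i. (LINT x:(\<lambda>x. 0 *\<^sub>R e3 + x) ` ball 0 R'|lebesgue. \<rho> (s i) x) \<ge> M - \<epsilon>" if "\<epsilon> > 0" for \<epsilon>
  proof (intro exI[of _ R] conjI allI R)
    fix i
    have "(LINT x:(\<lambda>x. 0 *\<^sub>R e3 + x) ` ball 0 R|lebesgue. \<rho> (s i) x) = (LINT x|lebesgue. \<rho> (s i) x)"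
      unfolding set_lebesgue_integral_def
      using r(7)[of _ "s i"] by (intro Bochner_Integration.integral_cong) (auto split: split_indicator simp: not_less)
    then show "(LINT x:(\<lambda>x. 0 *\<^sub>R e3 + x) ` ball 0 R|lebesgue. \<rho> (s i) x) \<ge> M - \<epsilon>"
      using r(6) that by simp
  qed
  ultimately have "shifted_weak_limit \<gamma> M R \<rho> (\<lambda>_. 0) s w"
    unfolding shifted_weak_limit_def using s W by auto
  then show thesis by (rule that)
qed

text \<open>
  If a shift exceeds the sum of the two radii, the ball around it misses the support and carries no mass, contradicting
  tightness with \<open>\<epsilon> = M / 2\<close>.
\<close>

lemma shifts_bounded:
  assumes M: "M > 0" and \<rho>: "\<And>i. \<rho> i \<in> W_class_supp \<gamma> M R"
    and lim: "shifted_weak_limit \<gamma> M R \<rho> a s \<rho>'"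
  obtains b where "b \<ge> 0" "\<And>i. \<bar>a i\<bar> \<le> b"
proof -
  from lim have tight: "\<forall>\<epsilon>>0. \<exists>R'>0. \<forall>i. (LINT x:(\<lambda>x. a i *\<^sub>R e3 + x) ` ball 0 R'|lebesgue. \<rho> (s i) x) \<ge> M - \<epsilon>"
    by (simp add: shifted_weak_limit_def)
  have "M / 2 > 0" using M by simp
  with tight obtain R' where R': "R' > 0" and T: "\<And>i. (LINT x:(\<lambda>x. a i *\<^sub>R e3 + x) ` ball 0 R'|lebesgue. \<rho> (s i) x) \<ge> M - M / 2"
    by blast
  have "\<bar>a i\<bar> \<le> \<bar>R\<bar> + R'" for i
  proof (rule ccontr)
    assume far: "\<not> \<bar>a i\<bar> \<le> \<bar>R\<bar> + R'"
    have zero: "\<rho> (s i) x = 0" if x: "x \<in> (\<lambda>x. a i *\<^sub>R e3 + x) ` ball 0 R'" for x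
    proof -
      obtain y where y: "x = a i *\<^sub>R e3 + y" "y \<in> ball 0 R'" using x by (rule imageE)
      then have "norm y < R'" by simp
      have "norm (a i *\<^sub>R e3) = \<bar>a i\<bar>" by (simp add: e3_def)
      then have "R \<le> norm x" using norm_diff_ineq[of "a i *\<^sub>R e3" y] \<open>norm y < R'\<close> far unfolding y(1) by linarith
      then show ?thesis by (rule W_class_suppD(7)[OF \<rho>])
    qed
    have "(\<lambda>x. indicator ((\<lambda>x. a i *\<^sub>R e3 + x) ` ball 0 R') x *\<^sub>R \<rho> (s i) x) = (\<lambda>x. 0)"
    proof
      fix x show "indicator ((\<lambda>x. a i *\<^sub>R e3 + x) ` ball 0 R') x *\<^sub>R \<rho> (s i) x = 0"
        using zero[of x] by (cases "x \<in> (\<lambda>x. a i *\<^sub>R e3 + x) ` ball 0 R'") simp_all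
    qed
    then have "(LINT x:(\<lambda>x. a i *\<^sub>R e3 + x) ` ball 0 R'|lebesgue. \<rho> (s i) x) = 0"
      unfolding set_lebesgue_integral_def by simp
    with T[of i] M show False by simp
  qed
  then show thesis using R' by (intro that[of "\<bar>R\<bar> + R'"]) auto
qed

theorem theoremA2:
  fixes M \<beta> \<gamma> R\<^sub>M Rmax :: real
  assumes "M > 0" and "\<gamma> > 8/5"
    and "star_radius \<gamma> M R\<^sub>M" and "Rmax \<ge> R\<^sub>M"
  shows
    "((INF \<rho>\<in>W_class_supp \<gamma> M Rmax. energy \<gamma> \<beta> \<rho>) < 0 \<and>
      (\<exists>C1>0. \<exists>C2>0. \<forall>\<rho>\<in>W_class_supp \<gamma> M Rmax.
         energy \<gamma> \<beta> \<rho> \<ge> C1 * (LINT x|lebesgue. \<rho> x powr \<gamma>) - C2)) \<and>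
     (\<forall>\<rho>. minimizing_sequence (energy \<gamma> \<beta>) (W_class_supp \<gamma> M Rmax) \<rho> \<longrightarrow>
        (\<exists>a s \<rho>'. shifted_weak_limit \<gamma> M Rmax \<rho> a s \<rho>')) \<and>
     (\<forall>\<rho> a s \<rho>'. minimizing_sequence (energy \<gamma> \<beta>) (W_class_supp \<gamma> M Rmax) \<rho> \<longrightarrow>
        shifted_weak_limit \<gamma> M Rmax \<rho> a s \<rho>' \<longrightarrow>
        is_arg_min (energy \<gamma> \<beta>) (\<lambda>\<sigma>. \<sigma> \<in> W_class_supp \<gamma> M Rmax) \<rho>')"
proof -
  let ?W = "W_class_supp \<gamma> M Rmax" and ?F = "energy \<gamma> \<beta>"
  have M0: "M \<ge> 0" and \<gamma>1: "\<gamma> > 1" using assms by auto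
  have Rpos: "Rmax > 0" using assms(3,4) by (auto simp: star_radius_def)
  obtain C1 C2 where C: "C1 > 0" "C2 > 0"
    and coer: "\<And>\<rho>. \<rho> \<in> ?W \<Longrightarrow> ?F \<rho> \<ge> C1 * (LINT x|lebesgue. \<rho> x powr \<gamma>) - C2"
    using energy_coercive[OF M0 assms(2), of Rmax \<beta>] by metis
  have bdd: "bdd_below (?F ` ?W)"
  proof (rule bdd_belowI2)
    fix \<rho> assume \<rho>: "\<rho> \<in> ?W"
    have "(LINT x|lebesgue. \<rho> x powr \<gamma>) \<ge> 0" by (intro Bochner_Integration.integral_nonneg) simp
    then have "C1 * (LINT x|lebesgue. \<rho> x powr \<gamma>) \<ge> 0" using C(1) by simp
    then show "- C2 \<le> ?F \<rho>" using coer[OF \<rho>] by linarith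
  qed
  have inf_le: "(INF \<rho>\<in>?W. ?F \<rho>) \<le> ?F \<sigma>" if "\<sigma> \<in> ?W" for \<sigma>
    using bdd that by (rule cINF_lower)
  obtain \<rho>0 where \<rho>0: "\<rho>0 \<in> ?W" "?F \<rho>0 < 0"
    by (rule star_energy_negative[OF assms])
  have part1: "(INF \<rho>\<in>?W. ?F \<rho>) < 0" using inf_le[OF \<rho>0(1)] \<rho>0(2) by simp
  have part2: "\<exists>a s \<rho>'. shifted_weak_limit \<gamma> M Rmax \<rho> a s \<rho>'" if min: "minimizing_sequence ?F ?W \<rho>" for \<rho>
  proof -
    obtain P where P: "\<And>i. (LINT x|lebesgue. \<rho> i x powr \<gamma>) \<le> P"
      using minimizing_sequence_bounded[OF min C(1) coer] by blast
    have \<rho>: "\<rho> i \<in> ?W" for i using min by (simp add: minimizing_sequence_def)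
    obtain s w where "shifted_weak_limit \<gamma> M Rmax \<rho> (\<lambda>_. 0) s w"
      by (rule minimizing_sequence_weak_limit[where \<rho>=\<rho>, OF assms(1) \<gamma>1 Rpos \<rho> P])
    then show ?thesis by blast
  qed
  have part3: "is_arg_min ?F (\<lambda>\<sigma>. \<sigma> \<in> ?W) \<rho>'"
    if min: "minimizing_sequence ?F ?W \<rho>" and lim: "shifted_weak_limit \<gamma> M Rmax \<rho> a s \<rho>'" for \<rho> a s \<rho>'
  proof -
    obtain P where P: "\<And>i. (LINT x|lebesgue. \<rho> i x powr \<gamma>) \<le> P"
      using minimizing_sequence_bounded[OF min C(1) coer] by blast
    have \<rho>: "\<rho> i \<in> ?W" for i using min by (simp add: minimizing_sequence_def)
    obtain b where b: "b \<ge> 0" "\<And>i. \<bar>a i\<bar> \<le> b"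
      using shifts_bounded[where \<rho>=\<rho>, OF assms(1) \<rho> lim] by blast
    have s: "strict_mono s" and \<rho>': "\<rho>' \<in> ?W"
      and weak: "weakly_converges_Lp \<gamma> (\<lambda>i x. \<rho> (s i) (x + a i *\<^sub>R e3)) \<rho>'"
      using lim by (simp_all add: shifted_weak_limit_def)
    define \<sigma> where "\<sigma> = (\<lambda>i x. \<rho> (s i) (x + a i *\<^sub>R e3))"
    have \<sigma>W: "\<sigma> i \<in> W_class_supp \<gamma> M (Rmax + b)" for i
      unfolding \<sigma>_def by (rule W_class_supp_translation[OF \<rho> b(2)])
    have \<rho>'W: "\<rho>' \<in> W_class_supp \<gamma> M (Rmax + b)"
      using W_class_supp_mono[of Rmax "Rmax + b" \<gamma> M] \<rho>' b(1) by auto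
    have \<sigma>F: "?F (\<sigma> i) = ?F (\<rho> (s i))" for i
      unfolding \<sigma>_def by (rule energy_translation(1)[OF M0 assms(2) \<rho>])
    have \<sigma>P: "(LINT x|lebesgue. \<sigma> i x powr \<gamma>) \<le> P" for i
      unfolding \<sigma>_def energy_translation(2)[OF M0 assms(2) \<rho>] by (rule P)
    have "(\<lambda>i. ?F (\<rho> i)) \<longlonglongrightarrow> (INF \<rho>\<in>?W. ?F \<rho>)" using min by (simp add: minimizing_sequence_def)
    from LIMSEQ_subseq_LIMSEQ[OF this s]
    have conv: "(\<lambda>i. ?F (\<sigma> i)) \<longlonglongrightarrow> (INF \<rho>\<in>?W. ?F \<rho>)" unfolding \<sigma>F by (simp add: o_def)
    have "?F \<rho>' \<le> (INF \<rho>\<in>?W. ?F \<rho>)"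
    proof (rule field_le_epsilon)
      fix \<epsilon> :: real assume \<epsilon>: "\<epsilon> > 0"
      have "eventually (\<lambda>i. ?F \<rho>' - \<epsilon> \<le> ?F (\<sigma> i)) sequentially"
        using energy_lower_semicontinuous[where \<sigma>=\<sigma>, OF M0 assms(2) \<sigma>W \<rho>'W \<sigma>P weak[folded \<sigma>_def] \<epsilon>, of \<beta>]
        by eventually_elim simp
      from tendsto_lowerbound[OF conv this] show "?F \<rho>' \<le> (INF \<rho>\<in>?W. ?F \<rho>) + \<epsilon>" by simp
    qed
    then show ?thesis
      unfolding is_arg_min_def using \<rho>' inf_le by (meson not_less order_trans)
  qed
  show ?thesis using part1 C coer part2 part3 by blast
qed

end
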